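(* Let $(\Omega^{(\bullet,\bullet)},\bar\partial,\partial,\kappa)$ be a positive definite ($A$-covariant) Kähler structure over $M$. Let $\mathbf f$ be a state on $M$ such that the integral $\int=\mathbf f\circ\mathrm{vol}_\kappa$ is closed. Let $(\mathcal F,\bar\partial_{\mathcal F},h)$ be an ($A$-covariant) Hermitian holomorphic vector bundle over $M$, with Chern connection $\nabla_{\mathcal F}=\bar\partial_{\mathcal F}+\partial_{\mathcal F}$. Then, as operators on $\Omega^\bullet\otimes_M\mathcal F$, $$[L_{\mathcal F},\partial_{\mathcal F}^\dagger]=i\,\bar\partial_{\mathcal F},\qquad [L_{\mathcal F},\bar\partial_{\mathcal F}^\dagger]=-i\,\partial_{\mathcal F},\qquad [\Lambda_{\mathcal F},\partial_{\mathcal F}]=i\,\bar\partial_{\mathcal F}^\dagger,\qquad [\Lambda_{\mathcal F},\bar\partial_{\mathcal F}]=-i\,\partial_{\mathcal F}^\dagger .$$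
   Context: **Calculi.** Everything is over $\mathbb C$. $A$ is a fixed Hopf $*$-algebra ($A=\mathbb C$, i.e. no covariance, is allowed); left coactions are written $v\mapsto v_{(-1)}\otimes v_{(0)}$. An $A$-comodule $*$-algebra is a unital $*$-algebra $M$ with a left $A$-coaction that is an algebra map and commutes with $*$. An $A$-covariant differential $*$-calculus over $M$ is a graded algebra $\Omega^\bullet=\bigoplus_{k\ge 0}\Omega^k$ (product $\wedge$) with $\Omega^0=M$, a degree one map $d$ with $d^2=0$ satisfying the graded Leibniz rule, generated by $M$ as a dg algebra, with a conjugate-linear involution $*$ extending that of $M$, $(d\omega)^*=d(\omega^* )$, $(\omega\wedge\nu)^*=(-1)^{|\omega||\nu|}\nu^*\wedge\omega^*$, and a graded left $A$-coaction compatible with product, $d$ and $*$. A complex structure is an algebra $\mathbb N_0^2$-grading $\Omega^{(a,b)}$ with $\Omega^k=\bigoplus_{a+b=k}\Omega^{(a,b)}$ (as $A$-comodules and $M$-bimodules), $(\Omega^{(a,b)})^*=\Omega^{(b,a)}$ and $d=\partial+\bar\partial$, where $\partial,\bar\partial$ are the components of $d$ of bidegree $(1,0),(0,1)$. **Kähler structures.** Let $\Omega^\bullet$ have total dimension $2n$ ($\Omega^{2n}\neq0$, $\Omega^k=0$ for $k>2n$). A Kähler structure is a complex structure together with a closed, central, real ($\kappa^*=\kappa$), $A$-coinvariant form $\kappa\in\Omega^{(1,1)}$ such that, for $L(\omega)=\kappa\wedge\omega$, the maps $L^{n-k}:\Omega^k\to\Omega^{2n-k}$ are isomorphisms for $0\le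 k<n$. Put $P^k=\{\alpha\in\Omega^k: L^{n-k+1}\alpha=0\}$ for $k\le n$, $P^k=0$ for $k>n$, and $P^{(a,b)}=P^{a+b}\cap\Omega^{(a,b)}$. The Hodge map $\ast_H:\Omega^\bullet\to\Omega^\bullet$ is the linear map determined by $$\ast_H(L^j\alpha)=(-1)^{\frac{k(k+1)}2}i^{a-b}\frac{j!}{(n-j-k)!}L^{n-j-k}(\alpha),\qquad \alpha\in P^{(a,b)},\ k=a+b,\ 0\le j\le n-k.$$ $\mathrm{vol}_\kappa=\ast_H|_{\Omega^{2n}}:\Omega^{2n}\to M$ (extended by $0$ to lower degrees) and $\Lambda=\ast_H^{-1}\circ L\circ\ast_H$. **Bundles.** A vector bundle $\mathcal F$ is a left $M$-module, finitely generated projective, with a compatible left $A$-coaction; ${}^\vee\mathcal F$ is the right $M$-module of left $M$-linear maps $\mathcal F\to M$ (with coaction $\phi_{(-1)}\otimes\phi_{(0)}(f)=S(f_{(-1)})\phi(f_{(0)})_{(-1)}\otimes\phi(f_{(0)})_{(0)}$). A (left) holomorphic structure is an $A$-comodule map $\bar\partial_{\mathcal F}:\mathcal F\to\Omega^{(0,1)}\otimes_M\mathcal F$ with $\bar\partial_{\mathcal F}(mf)=\bar\partial m\otimes f+m\bar\partial_{\mathcal F}f$ whose extension $\bar\partial_{\mathcal F}(\omega\otimes f)=\bar\partial\omega\otimes f+(-1)^{|\omega|}\omega\wedge\bar\partial_{\mathcal F}f$ to $\Omega^\bullet\otimes_M\mathcal F$ squares to zero; anti-holomorphic structures are defined likewise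 with $(1,0),\partial$ in place of $(0,1),\bar\partial$. A Hermitian structure is an isomorphism of right $M$-modules and $A$-comodules $h:\overline{\mathcal F}\to{}^\vee\mathcal F$ with $h(\overline f)(g)=h(\overline g)(f)^*$; here $\overline{\mathcal F}$ is the conjugate vector space with $\overline f\,m=\overline{m^*f}$ and coaction $\overline f\mapsto (f_{(-1)})^*\otimes\overline{f_{(0)}}$. Put $\mathfrak h(\omega\otimes f,\nu\otimes g)=\omega\, h(\overline g)(f)\wedge\nu^*$. The Chern connection of $(\mathcal F,\bar\partial_{\mathcal F},h)$ is the unique ($A$-covariant) connection $\nabla_{\mathcal F}:\mathcal F\to\Omega^1\otimes_M\mathcal F$ with $d\,\mathfrak h(f,g)=\mathfrak h(\nabla_{\mathcal F}f,g)+\mathfrak h(f,\nabla_{\mathcal F}g)$ and $(0,1)$-part $\bar\partial_{\mathcal F}$; its $(1,0)$-part $\partial_{\mathcal F}$ is an anti-holomorphic structure, extended to $\Omega^\bullet\otimes_M\mathcal F$ by the Leibniz rule. **Metric and adjoints.** $L_{\mathcal F}=L\otimes\mathrm{id}$, $\Lambda_{\mathcal F}=\Lambda\otimes\mathrm{id}$. The evaluation pairing is $(\omega\otimes f)\wedge_{\mathrm{ev}}(\phi\otimes\nu)=\omega\,\phi(f)\wedge\nu$. Put $\bar\ast_{\mathcal F}(\omega\otimes f)=h(\overline f)\otimes\ast_H(\omega^* )$ and $g_{\mathcal F}(\alpha,\beta)=\mathrm{vol}_\kappa(\alpha\wedge_{\mathrm{ev}}\bar\ast_{\mathcal F}\beta)\in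 M$. $M_{>0}$ is the set of non-zero finite sums $\sum\lambda_i m_im_i^*$ with $\lambda_i\ge0$. The Kähler structure is positive definite if $g(\omega,\omega)=\mathrm{vol}_\kappa(\omega\wedge\ast_H(\omega^* ))\in M_{>0}$ for all non-zero $\omega\in\Omega^\bullet$. A state is a unital linear functional $\mathbf f:M\to\mathbb C$ with $\mathbf f(M_{>0})\subseteq\mathbb R_{>0}$. The integral $\int=\mathbf f\circ\mathrm{vol}_\kappa$ is closed if $\int d\omega=0$ for all $\omega\in\Omega^{2n-1}$. $\langle\alpha,\beta\rangle_{\mathcal F}=\mathbf f(g_{\mathcal F}(\alpha,\beta))$, and $\dagger$ denotes the adjoint with respect to $\langle\cdot,\cdot\rangle_{\mathcal F}$ (which exists for $\partial_{\mathcal F}$ and $\bar\partial_{\mathcal F}$). *)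

theory Defs
  imports Complex_Main "HOL-Library.Poly_Mapping" "HOL-Library.Function_Algebras"
begin

section \<open>Complex vector spaces and algebras\<close>

class scaleC =
  fixes scaleC :: "complex \<Rightarrow> 'a \<Rightarrow> 'a"  (infixr \<open>*\<^sub>C\<close> 75)

class complex_vector = scaleC + ab_group_add +
  assumes scaleC_add_right: "c *\<^sub>C (x + y) = c *\<^sub>C x + c *\<^sub>C y"
    and scaleC_add_left: "(b + c) *\<^sub>C x = b *\<^sub>C x + c *\<^sub>C x"
    and scaleC_scaleC: "b *\<^sub>C c *\<^sub>C x = (b * c) *\<^sub>C x"
    and scaleC_one: "1 *\<^sub>C x = x"

class complex_algebra_1 = complex_vector + ring_1 +
  assumes mult_scaleC_left: "(c *\<^sub>C x) * y = c *\<^sub>C (x * y)"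
    and mult_scaleC_right: "x * (c *\<^sub>C y) = c *\<^sub>C (x * y)"

global_interpretation complex_vector: vector_space "scaleC :: complex \<Rightarrow> 'v \<Rightarrow> 'v::complex_vector"
  by unfold_locales (simp_all add: scaleC_add_right scaleC_add_left scaleC_scaleC scaleC_one)

instantiation complex :: complex_algebra_1
begin
definition scaleC_complex :: "complex \<Rightarrow> complex \<Rightarrow> complex" where "scaleC_complex c x = c * x"
instance by standard (simp_all add: scaleC_complex_def algebra_simps)
end

instantiation "fun" :: (type, complex_vector) complex_vector
begin
definition scaleC_fun :: "complex \<Rightarrow> ('a \<Rightarrow> 'b) \<Rightarrow> 'a \<Rightarrow> 'b" where "scaleC_fun c f = (\<lambda>x. c *\<^sub>C f x)"
instance
  by standard (simp_all add: scaleC_fun_def fun_eq_iff scaleC_add_right scaleC_add_left scaleC_scaleC scaleC_one)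
end

abbreviation csubspace :: "'v::complex_vector set \<Rightarrow> bool"
  where "csubspace \<equiv> module.subspace scaleC"

abbreviation cspan :: "'v::complex_vector set \<Rightarrow> 'v set"
  where "cspan \<equiv> module.span scaleC"

abbreviation clinear :: "('v::complex_vector \<Rightarrow> 'u::complex_vector) \<Rightarrow> bool"
  where "clinear \<equiv> Vector_Spaces.linear scaleC scaleC"

definition conj_linear :: "('v::complex_vector \<Rightarrow> 'u::complex_vector) \<Rightarrow> bool"
  where "conj_linear f \<longleftrightarrow> additive f \<and> (\<forall>c x. f (c *\<^sub>C x) = cnj c *\<^sub>C f x)"

definition is_decomposition ::
    "'i set \<Rightarrow> ('i \<Rightarrow> 'v::complex_vector set) \<Rightarrow> 'v \<Rightarrow> ('i \<Rightarrow> 'v) \<Rightarrow> bool"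
  where "is_decomposition I V x c \<longleftrightarrow>
    finite {i. c i \<noteq> 0} \<and> (\<forall>i\<in>I. c i \<in> V i) \<and> (\<forall>i. i \<notin> I \<longrightarrow> c i = 0) \<and> x = (\<Sum>i | c i \<noteq> 0. c i)"

definition internal_direct_sum ::
    "'i set \<Rightarrow> ('i \<Rightarrow> 'v::complex_vector set) \<Rightarrow> 'v set \<Rightarrow> bool"
  where "internal_direct_sum I V X \<longleftrightarrow>
    csubspace X \<and> (\<forall>i\<in>I. csubspace (V i) \<and> V i \<subseteq> X) \<and> (\<forall>x\<in>X. \<exists>!c. is_decomposition I V x c)"

definition component :: "('i \<Rightarrow> 'v::complex_vector set) \<Rightarrow> 'i \<Rightarrow> 'v \<Rightarrow> 'v"
  where "component V i x = (THE c. is_decomposition UNIV V x c) i"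


section \<open>Tensor products\<close>

text \<open>
  The tensor product of a right module on \<open>X\<close> and a left module on \<open>Y\<close> over a ring \<open>R\<close> is the free
  abelian group on \<open>X \<times> Y\<close> modulo the following subgroup.  Carrier sets and actions are parameters
  because the base algebra below is the degree zero part of a larger algebra.
\<close>

inductive_set tensor_relations ::
    "'x::ab_group_add set \<Rightarrow> 'y::ab_group_add set \<Rightarrow> 'r set \<Rightarrow> ('x \<Rightarrow> 'r \<Rightarrow> 'x) \<Rightarrow> ('r \<Rightarrow> 'y \<Rightarrow> 'y)
      \<Rightarrow> ('x \<times> 'y \<Rightarrow>\<^sub>0 int) set"
  for X Y R ra la
  where
    zero: "0 \<in> tensor_relations X Y R ra la"
  | diff: "u \<in> tensor_relations X Y R ra la \<Longrightarrow> v \<in> tensor_relations X Y R ra la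
      \<Longrightarrow> u - v \<in> tensor_relations X Y R ra la"
  | add_left: "x \<in> X \<Longrightarrow> x' \<in> X \<Longrightarrow> y \<in> Y
      \<Longrightarrow> frag_of (x + x', y) - frag_of (x, y) - frag_of (x', y) \<in> tensor_relations X Y R ra la"
  | add_right: "x \<in> X \<Longrightarrow> y \<in> Y \<Longrightarrow> y' \<in> Y
      \<Longrightarrow> frag_of (x, y + y') - frag_of (x, y) - frag_of (x, y') \<in> tensor_relations X Y R ra la"
  | balanced: "x \<in> X \<Longrightarrow> r \<in> R \<Longrightarrow> y \<in> Y
      \<Longrightarrow> frag_of (ra x r, y) - frag_of (x, la r y) \<in> tensor_relations X Y R ra la"

definition frag_eval :: "('x \<Rightarrow> 'y \<Rightarrow> 't::complex_vector) \<Rightarrow> ('x \<times> 'y \<Rightarrow>\<^sub>0 int) \<Rightarrow> 't"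
  where "frag_eval t u = (\<Sum>p\<in>Poly_Mapping.keys u. of_int (Poly_Mapping.lookup u p) *\<^sub>C t (fst p) (snd p))"

text \<open>
  The type \<open>'t\<close> together with \<open>t\<close> is a model of the tensor product if the induced map from the free
  abelian group on \<open>X \<times> Y\<close> is onto and its kernel is exactly the subgroup of relations.
\<close>

definition is_tensor_product ::
    "'x::complex_vector set \<Rightarrow> 'y::complex_vector set \<Rightarrow> 'r set \<Rightarrow> ('x \<Rightarrow> 'r \<Rightarrow> 'x) \<Rightarrow> ('r \<Rightarrow> 'y \<Rightarrow> 'y)
      \<Rightarrow> ('x \<Rightarrow> 'y \<Rightarrow> 't::complex_vector) \<Rightarrow> bool"
  where "is_tensor_product X Y R ra la t \<longleftrightarrow>
    frag_eval t ` {u. Poly_Mapping.keys u \<subseteq> X \<times> Y} = UNIV \<and>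
    {u. Poly_Mapping.keys u \<subseteq> X \<times> Y \<and> frag_eval t u = 0} = tensor_relations X Y R ra la \<and>
    (\<forall>c. \<forall>x\<in>X. \<forall>y\<in>Y. t (c *\<^sub>C x) y = c *\<^sub>C t x y)"

text \<open>The additive map on a tensor product with prescribed values on pure tensors.\<close>

definition tensor_lift ::
    "'x set \<Rightarrow> 'y set \<Rightarrow> ('x \<Rightarrow> 'y \<Rightarrow> 't::complex_vector) \<Rightarrow> ('x \<Rightarrow> 'y \<Rightarrow> 'z::complex_vector) \<Rightarrow> 't \<Rightarrow> 'z"
  where "tensor_lift X Y t B = (THE T. additive T \<and> (\<forall>x\<in>X. \<forall>y\<in>Y. T (t x y) = B x y))"

lemma frag_eval_superset:
  assumes "finite S" "Poly_Mapping.keys u \<subseteq> S"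
  shows "frag_eval t u = (\<Sum>p\<in>S. of_int (Poly_Mapping.lookup u p) *\<^sub>C t (fst p) (snd p))"
  unfolding frag_eval_def
  by (rule sum.mono_neutral_left) (use assms in \<open>auto simp: in_keys_iff\<close>)

lemma frag_eval_diff: "frag_eval t (u - v) = frag_eval t u - frag_eval t v"
proof -
  let ?S = "Poly_Mapping.keys u \<union> Poly_Mapping.keys v"
  have "Poly_Mapping.keys (u - v) \<subseteq> ?S" by (rule keys_diff)
  then show ?thesis
    by (simp add: frag_eval_superset[of ?S] lookup_minus complex_vector.scale_left_diff_distrib sum_subtractf)
qed

lemma frag_eval_0 [simp]: "frag_eval t 0 = 0"
  by (simp add: frag_eval_def)

lemma frag_eval_add: "frag_eval t (u + v) = frag_eval t u + frag_eval t v"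
  using frag_eval_diff[of t u "0 - v"] frag_eval_diff[of t 0 v] by simp

lemma frag_eval_of [simp]: "frag_eval t (frag_of (x, y)) = t x y"
  by (simp add: frag_eval_def scaleC_one)

lemma frag_eval_relations:
  assumes "u \<in> tensor_relations X Y R ra la"
    and "\<And>x x' y. x \<in> X \<Longrightarrow> x' \<in> X \<Longrightarrow> y \<in> Y \<Longrightarrow> B (x + x') y = B x y + B x' y"
    and "\<And>x y y'. x \<in> X \<Longrightarrow> y \<in> Y \<Longrightarrow> y' \<in> Y \<Longrightarrow> B x (y + y') = B x y + B x y'"
    and "\<And>x r y. x \<in> X \<Longrightarrow> r \<in> R \<Longrightarrow> y \<in> Y \<Longrightarrow> B (ra x r) y = B x (la r y)"
  shows "frag_eval B u = 0"
  using assms(1) by induction (simp_all add: frag_eval_diff assms(2-4))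

text \<open>The universal property, which makes the description of \<open>tensor_lift\<close> a proper one.\<close>

lemma tensor_lift_unique_existence:
  fixes B :: "'x::complex_vector \<Rightarrow> 'y::complex_vector \<Rightarrow> 'z::complex_vector"
  assumes t: "is_tensor_product X Y R ra la t"
    and B: "\<And>x x' y. x \<in> X \<Longrightarrow> x' \<in> X \<Longrightarrow> y \<in> Y \<Longrightarrow> B (x + x') y = B x y + B x' y"
      "\<And>x y y'. x \<in> X \<Longrightarrow> y \<in> Y \<Longrightarrow> y' \<in> Y \<Longrightarrow> B x (y + y') = B x y + B x y'"
      "\<And>x r y. x \<in> X \<Longrightarrow> r \<in> R \<Longrightarrow> y \<in> Y \<Longrightarrow> B (ra x r) y = B x (la r y)"
  shows "\<exists>!T. additive T \<and> (\<forall>x\<in>X. \<forall>y\<in>Y. T (t x y) = B x y)"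
proof -
  let ?F = "{u :: 'x \<times> 'y \<Rightarrow>\<^sub>0 int. Poly_Mapping.keys u \<subseteq> X \<times> Y}"
  have surj: "\<exists>u\<in>?F. frag_eval t u = s" for s
    using t unfolding is_tensor_product_def by (metis (no_types, lifting) UNIV_I image_iff)
  have diffF: "u - v \<in> ?F" if "u \<in> ?F" "v \<in> ?F" for u v
    using that keys_diff[of u v] by blast
  have addF: "u + v \<in> ?F" if "u \<in> ?F" "v \<in> ?F" for u v
    using that Poly_Mapping.keys_add[of u v] by blast
  have wd: "frag_eval B u = frag_eval B v" if "u \<in> ?F" "v \<in> ?F" "frag_eval t u = frag_eval t v" for u v
  proof -
    have "u - v \<in> tensor_relations X Y R ra la"
      using t that diffF[OF that(1,2)] unfolding is_tensor_product_def by (auto simp: frag_eval_diff)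
    then have "frag_eval B (u - v) = 0"
    proof (rule frag_eval_relations)
      show "B (x + x') y = B x y + B x' y" if "x \<in> X" "x' \<in> X" "y \<in> Y" for x x' y
        by (rule B(1)[OF that])
      show "B x (y + y') = B x y + B x y'" if "x \<in> X" "y \<in> Y" "y' \<in> Y" for x y y'
        by (rule B(2)[OF that])
      show "B (ra x r) y = B x (la r y)" if "x \<in> X" "r \<in> R" "y \<in> Y" for x r y
        by (rule B(3)[OF that])
    qed
    then show ?thesis by (simp add: frag_eval_diff)
  qed
  define r where "r s = (SOME u. u \<in> ?F \<and> frag_eval t u = s)" for s
  have r: "r s \<in> ?F" "frag_eval t (r s) = s" for s
  proof -
    have "r s \<in> ?F \<and> frag_eval t (r s) = s"
      unfolding r_def by (rule someI_ex) (use surj in blast)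
    then show "r s \<in> ?F" "frag_eval t (r s) = s" by auto
  qed
  define T where "T s = frag_eval B (r s)" for s
  have "T (x + y) = T x + T y" for x y
    unfolding T_def frag_eval_add[symmetric]
    by (rule wd) (use r addF[OF r(1)[of x] r(1)[of y]] in \<open>auto simp: frag_eval_add\<close>)
  then have addT: "additive T" by (rule additive.intro)
  have T: "T (t x y) = B x y" if "x \<in> X" "y \<in> Y" for x y
  proof -
    have "frag_eval B (r (t x y)) = frag_eval B (frag_of (x, y))"
      by (rule wd) (use r that in auto)
    then show ?thesis by (simp add: T_def)
  qed
  have uniq: "T' = T" if T': "additive T'" "\<forall>x\<in>X. \<forall>y\<in>Y. T' (t x y) = B x y" for T'
  proof
    fix s
    interpret D: additive "\<lambda>s. T' s - T s"
      using T'(1) addT by (simp add: additive_def)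
    have D0: "(\<lambda>s. T' s - T s) (t x y) = 0" if "x \<in> X" "y \<in> Y" for x y
      using T'(2) T that by simp
    have "T' (frag_eval t u) - T (frag_eval t u) = 0" if "u \<in> ?F" for u
    proof -
      have "Poly_Mapping.keys u \<subseteq> X \<times> Y" using that by simp
      then show ?thesis
        by (induction u rule: frag_induction)
           (auto simp: frag_eval_diff D.zero D.diff D0 T T'(2))
    qed
    from this[OF r(1)[of s]] show "T' s = T s" by (simp add: r(2))
  qed
  show ?thesis using addT T uniq by blast
qed

abbreviation tensor_relations_C :: "('a::complex_vector \<times> 'b::complex_vector \<Rightarrow>\<^sub>0 int) set"
  where "tensor_relations_C \<equiv> tensor_relations UNIV UNIV (UNIV :: complex set) (\<lambda>x c. c *\<^sub>C x) scaleC"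

definition tensor_eq :: "('a::complex_vector \<times> 'b::complex_vector \<Rightarrow>\<^sub>0 int) \<Rightarrow> ('a \<times> 'b \<Rightarrow>\<^sub>0 int) \<Rightarrow> bool"
  where "tensor_eq u v \<longleftrightarrow> u - v \<in> tensor_relations_C"

lemma tensor_relations_uminus:
  "u \<in> tensor_relations X Y R ra la \<Longrightarrow> - u \<in> tensor_relations X Y R ra la"
  using tensor_relations.diff[OF tensor_relations.zero] by fastforce

lemma tensor_relations_add:
  "u \<in> tensor_relations X Y R ra la \<Longrightarrow> v \<in> tensor_relations X Y R ra la \<Longrightarrow>
    u + v \<in> tensor_relations X Y R ra la"
  using tensor_relations.diff[of u X Y R ra la "- v"] tensor_relations_uminus by fastforce

quotient_type (overloaded) ('a, 'b) tensor (infixr \<open>\<otimes>\<close> 70) =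
    "('a::complex_vector \<times> 'b::complex_vector) \<Rightarrow>\<^sub>0 int" / tensor_eq
proof (rule equivpI)
  show "reflp tensor_eq" by (simp add: reflp_def tensor_eq_def tensor_relations.zero)
  show "symp tensor_eq"
    unfolding symp_def tensor_eq_def using tensor_relations_uminus by fastforce
  show "transp tensor_eq"
    unfolding transp_def tensor_eq_def using tensor_relations_add by fastforce
qed

definition scale_frag :: "complex \<Rightarrow> ('a::complex_vector \<times> 'b::complex_vector \<Rightarrow>\<^sub>0 int) \<Rightarrow> ('a \<times> 'b \<Rightarrow>\<^sub>0 int)"
  where "scale_frag c = frag_extend (\<lambda>p. frag_of (c *\<^sub>C fst p, snd p))"

lemma scale_frag_diff: "scale_frag c (u - v) = scale_frag c u - scale_frag c v"
  by (simp add: scale_frag_def frag_extend_diff)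

lemma scale_frag_relations: "u \<in> tensor_relations_C \<Longrightarrow> scale_frag c u \<in> tensor_relations_C"
proof (induction rule: tensor_relations.induct)
  case zero
  show ?case by (simp add: scale_frag_def tensor_relations.zero)
next
  case (diff u v)
  then show ?case by (simp add: scale_frag_diff tensor_relations.diff)
next
  case (balanced x r y)
  have "frag_of (r *\<^sub>C c *\<^sub>C x, y) - frag_of (c *\<^sub>C x, r *\<^sub>C y) \<in> tensor_relations_C"
    by (rule tensor_relations.balanced) auto
  then show ?case
    by (simp add: scale_frag_diff) (simp add: scale_frag_def scaleC_scaleC mult.commute)
qed (auto simp: scale_frag_diff, auto simp: scale_frag_def scaleC_add_right
       intro: tensor_relations.add_left tensor_relations.add_right)

lemma tensor_relations_extend:
  assumes "\<And>p. f p - g p \<in> tensor_relations X Y R ra la"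
  shows "frag_extend f u - frag_extend g u \<in> tensor_relations X Y R ra la"
proof -
  have "Poly_Mapping.keys u \<subseteq> UNIV" by simp
  then show ?thesis
  proof (induction u rule: frag_induction)
    case (diff a b)
    have "frag_extend f (a - b) - frag_extend g (a - b)
        = (frag_extend f a - frag_extend g a) - (frag_extend f b - frag_extend g b)"
      by (simp add: frag_extend_diff)
    then show ?case using diff by (simp add: tensor_relations.diff)
  qed (use assms in \<open>auto simp: tensor_relations.zero\<close>)
qed

instantiation tensor :: (complex_vector, complex_vector) complex_vector
begin

lift_definition zero_tensor :: "'a \<otimes> 'b" is 0 .

lift_definition plus_tensor :: "'a \<otimes> 'b \<Rightarrow> 'a \<otimes> 'b \<Rightarrow> 'a \<otimes> 'b" is "(+)"
  unfolding tensor_eq_def by (simp only: add_diff_add tensor_relations_add)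

lift_definition minus_tensor :: "'a \<otimes> 'b \<Rightarrow> 'a \<otimes> 'b \<Rightarrow> 'a \<otimes> 'b" is "(-)"
proof -
  fix u u' v v' :: "'a \<times> 'b \<Rightarrow>\<^sub>0 int"
  assume "tensor_eq u u'" "tensor_eq v v'"
  moreover have "(u - v) - (u' - v') = (u - u') - (v - v')" by simp
  ultimately show "tensor_eq (u - v) (u' - v')"
    unfolding tensor_eq_def by (simp only: tensor_relations.diff)
qed

lift_definition uminus_tensor :: "'a \<otimes> 'b \<Rightarrow> 'a \<otimes> 'b" is uminus
  unfolding tensor_eq_def by (simp only: minus_diff_minus tensor_relations_uminus)

lift_definition scaleC_tensor :: "complex \<Rightarrow> 'a \<otimes> 'b \<Rightarrow> 'a \<otimes> 'b" is scale_frag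
  unfolding tensor_eq_def by (simp only: scale_frag_diff[symmetric] scale_frag_relations)

instance
proof
  fix a b c :: "'a \<otimes> 'b" and r s :: complex
  show "a + b + c = a + (b + c)" "a + b = b + a" "0 + a = a" "- a + a = 0" "a - b = a + - b"
    by (transfer; simp add: tensor_eq_def tensor_relations.zero algebra_simps)+
  show "r *\<^sub>C (a + b) = r *\<^sub>C a + r *\<^sub>C b"
    by transfer (simp add: tensor_eq_def tensor_relations.zero scale_frag_def frag_extend_add)
  show "1 *\<^sub>C a = a"
  proof transfer
    fix u :: "'a \<times> 'b \<Rightarrow>\<^sub>0 int"
    have "scale_frag 1 u = u"
      by (simp add: scale_frag_def scaleC_one frag_expansion[symmetric])
    then show "tensor_eq (scale_frag 1 u) u" by (simp add: tensor_eq_def tensor_relations.zero)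
  qed
  show "r *\<^sub>C s *\<^sub>C a = (r * s) *\<^sub>C a"
  proof transfer
    fix r s and u :: "'a \<times> 'b \<Rightarrow>\<^sub>0 int"
    have "Poly_Mapping.keys u \<subseteq> UNIV" by simp
    then have "scale_frag r (scale_frag s u) = scale_frag (r * s) u"
      by (induction u rule: frag_induction) (simp_all add: scale_frag_def frag_extend_diff scaleC_scaleC)
    then show "tensor_eq (scale_frag r (scale_frag s u)) (scale_frag (r * s) u)"
      by (simp add: tensor_eq_def tensor_relations.zero)
  qed
  show "(r + s) *\<^sub>C a = r *\<^sub>C a + s *\<^sub>C a"
  proof transfer
    fix r s and u :: "'a \<times> 'b \<Rightarrow>\<^sub>0 int"
    have *: "frag_of ((r + s) *\<^sub>C fst p, snd p) - (frag_of (r *\<^sub>C fst p, snd p) + frag_of (s *\<^sub>C fst p, snd p))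
        \<in> tensor_relations_C" for p :: "'a \<times> 'b"
      using tensor_relations.add_left[of "r *\<^sub>C fst p" UNIV "s *\<^sub>C fst p" "snd p" UNIV]
      by (simp add: scaleC_add_left diff_diff_add)
    have "Poly_Mapping.keys u \<subseteq> UNIV" by simp
    then have "scale_frag r u + scale_frag s u =
        frag_extend (\<lambda>p. frag_of (r *\<^sub>C fst p, snd p) + frag_of (s *\<^sub>C fst p, snd p)) u"
      by (induction u rule: frag_induction) (simp_all add: scale_frag_def frag_extend_diff algebra_simps)
    then show "tensor_eq (scale_frag (r + s) u) (scale_frag r u + scale_frag s u)"
      using tensor_relations_extend[OF *] by (simp add: tensor_eq_def scale_frag_def)
  qed
qed

end

lift_definition pure_tensor :: "'a::complex_vector \<Rightarrow> 'b::complex_vector \<Rightarrow> 'a \<otimes> 'b"  (infixr \<open>\<otimes>\<close> 70)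
  is "\<lambda>x y. frag_of (x, y)" .

lemma is_tensor_product_pure_tensor:
  "is_tensor_product UNIV UNIV (UNIV :: complex set) (\<lambda>x c. c *\<^sub>C x) scaleC
    (pure_tensor :: 'a::complex_vector \<Rightarrow> 'b::complex_vector \<Rightarrow> 'a \<otimes> 'b)"
proof -
  have abs: "frag_eval (\<otimes>) u = abs_tensor u" for u :: "'a \<times> 'b \<Rightarrow>\<^sub>0 int"
  proof -
    have "Poly_Mapping.keys u \<subseteq> UNIV" by simp
    then show ?thesis
      by (induction u rule: frag_induction)
         (auto simp: frag_eval_diff zero_tensor_def pure_tensor.abs_eq minus_tensor.abs_eq)
  qed
  have surj: "range (frag_eval ((\<otimes>) :: 'a \<Rightarrow> 'b \<Rightarrow> 'a \<otimes> 'b)) = UNIV"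
  proof (rule surjI)
    show "frag_eval (\<otimes>) (rep_tensor s) = s" for s :: "'a \<otimes> 'b"
      unfolding abs by (rule Quotient_abs_rep[OF Quotient_tensor])
  qed
  have ker: "frag_eval (\<otimes>) u = (0 :: 'a \<otimes> 'b) \<longleftrightarrow> u \<in> tensor_relations_C" for u
    unfolding abs zero_tensor_def by (simp add: tensor.abs_eq_iff tensor_eq_def)
  have scale: "(c *\<^sub>C x) \<otimes> y = c *\<^sub>C (x \<otimes> y)" for c and x :: 'a and y :: 'b
    by transfer (simp add: scale_frag_def tensor_eq_def tensor_relations.zero)
  show ?thesis
    unfolding is_tensor_product_def by (simp add: surj ker scale)
qed

abbreviation lift2 ::
    "('a::complex_vector \<Rightarrow> 'b::complex_vector \<Rightarrow> 'z::complex_vector) \<Rightarrow> 'a \<otimes> 'b \<Rightarrow> 'z"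
  where "lift2 \<equiv> tensor_lift UNIV UNIV (\<otimes>)"

definition tensor_map ::
    "('a::complex_vector \<Rightarrow> 'c::complex_vector) \<Rightarrow> ('b::complex_vector \<Rightarrow> 'd::complex_vector)
      \<Rightarrow> 'a \<otimes> 'b \<Rightarrow> 'c \<otimes> 'd"
  where "tensor_map f g = lift2 (\<lambda>x y. f x \<otimes> g y)"

definition tensor_assoc ::
    "('a::complex_vector \<otimes> 'b::complex_vector) \<otimes> 'c::complex_vector \<Rightarrow> 'a \<otimes> 'b \<otimes> 'c"
  where "tensor_assoc = lift2 (\<lambda>u z. lift2 (\<lambda>x y. x \<otimes> (y \<otimes> z)) u)"

text \<open>\<open>(a \<otimes> x) (b \<otimes> y) = a b \<otimes> B x y\<close>\<close>

definition tensor_mult ::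
    "('x::complex_vector \<Rightarrow> 'y::complex_vector \<Rightarrow> 'z::complex_vector)
      \<Rightarrow> 'a::complex_algebra_1 \<otimes> 'x \<Rightarrow> 'a \<otimes> 'y \<Rightarrow> 'a \<otimes> 'z"
  where "tensor_mult B u v = lift2 (\<lambda>a x. lift2 (\<lambda>b y. (a * b) \<otimes> B x y) v) u"

definition tensor_subspace :: "'x::complex_vector set \<Rightarrow> ('a::complex_vector \<otimes> 'x) set"
  where "tensor_subspace V = cspan {a \<otimes> x | a x. x \<in> V}"


section \<open>Hopf star-algebras and comodules\<close>

record (overloaded) 'a hopf =
  comult :: "'a \<Rightarrow> 'a::complex_algebra_1 \<otimes> 'a"
  counit :: "'a \<Rightarrow> complex"
  antipode :: "'a \<Rightarrow> 'a"
  hstar :: "'a \<Rightarrow> 'a"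

definition left_comodule ::
    "('a::complex_algebra_1, 'h) hopf_scheme \<Rightarrow> ('v::complex_vector \<Rightarrow> 'a \<otimes> 'v) \<Rightarrow> bool"
  where "left_comodule H \<delta> \<longleftrightarrow> clinear \<delta> \<and>
    (\<forall>v. tensor_assoc (tensor_map (comult H) id (\<delta> v)) = tensor_map id \<delta> (\<delta> v)) \<and>
    (\<forall>v. lift2 (\<lambda>a x. counit H a *\<^sub>C x) (\<delta> v) = v)"

locale hopf_star_algebra =
  fixes H :: "('a::complex_algebra_1, 'h) hopf_scheme"
  assumes comult_comodule: "left_comodule H (comult H)"
    and counit_right: "lift2 (\<lambda>a b. counit H b *\<^sub>C a) (comult H a) = a"
    and comult_mult: "comult H (a * b) = tensor_mult (*) (comult H a) (comult H b)"
    and comult_one: "comult H 1 = 1 \<otimes> 1"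
    and counit_linear: "clinear (counit H)"
    and counit_mult: "counit H (a * b) = counit H a * counit H b"
    and counit_one: "counit H 1 = 1"
    and antipode_linear: "clinear (antipode H)"
    and antipode_left: "lift2 (\<lambda>a b. antipode H a * b) (comult H a) = counit H a *\<^sub>C 1"
    and antipode_right: "lift2 (\<lambda>a b. a * antipode H b) (comult H a) = counit H a *\<^sub>C 1"
    and hstar_conj_linear: "conj_linear (hstar H)"
    and hstar_hstar: "hstar H (hstar H a) = a"
    and hstar_mult: "hstar H (a * b) = hstar H b * hstar H a"
    and comult_hstar: "comult H (hstar H a) = tensor_map (hstar H) (hstar H) (comult H a)"


section \<open>Covariant differential star-calculi and complex structures\<close>

text \<open>
  The algebra of all forms is the whole type \<open>'w\<close>, its product being \<open>*\<close>; the base algebra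
  is the set of forms of degree zero.
\<close>

record (overloaded) ('a, 'w) calculus =
  forms :: "nat \<Rightarrow> 'w::complex_algebra_1 set"
  diff :: "'w \<Rightarrow> 'w"
  star :: "'w \<Rightarrow> 'w"
  coact :: "'w \<Rightarrow> 'a::complex_algebra_1 \<otimes> 'w"

abbreviation base :: "('a::complex_algebra_1, 'w::complex_algebra_1, 'z) calculus_scheme \<Rightarrow> 'w set"
  where "base C \<equiv> forms C 0"

inductive_set dg_subalgebra :: "('a::complex_algebra_1, 'w::complex_algebra_1, 'z) calculus_scheme \<Rightarrow> 'w set"
  for C
  where
    base: "m \<in> base C \<Longrightarrow> m \<in> dg_subalgebra C"
  | add: "\<omega> \<in> dg_subalgebra C \<Longrightarrow> \<nu> \<in> dg_subalgebra C \<Longrightarrow> \<omega> + \<nu> \<in> dg_subalgebra C"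
  | scale: "\<omega> \<in> dg_subalgebra C \<Longrightarrow> c *\<^sub>C \<omega> \<in> dg_subalgebra C"
  | mult: "\<omega> \<in> dg_subalgebra C \<Longrightarrow> \<nu> \<in> dg_subalgebra C \<Longrightarrow> \<omega> * \<nu> \<in> dg_subalgebra C"
  | diff: "\<omega> \<in> dg_subalgebra C \<Longrightarrow> diff C \<omega> \<in> dg_subalgebra C"

locale star_calculus = hopf_star_algebra H
  for H :: "('a::complex_algebra_1, 'h) hopf_scheme" +
  fixes C :: "('a, 'w::complex_algebra_1, 'z) calculus_scheme"
  assumes grading: "internal_direct_sum UNIV (forms C) UNIV"
    and one_base: "1 \<in> base C"
    and forms_mult: "\<omega> \<in> forms C k \<Longrightarrow> \<nu> \<in> forms C l \<Longrightarrow> \<omega> * \<nu> \<in> forms C (k + l)"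
    and diff_linear: "clinear (diff C)"
    and diff_forms: "\<omega> \<in> forms C k \<Longrightarrow> diff C \<omega> \<in> forms C (Suc k)"
    and diff_diff: "diff C (diff C \<omega>) = 0"
    and leibniz: "\<omega> \<in> forms C k \<Longrightarrow> diff C (\<omega> * \<nu>) = diff C \<omega> * \<nu> + (-1) ^ k * \<omega> * diff C \<nu>"
    and generated: "dg_subalgebra C = UNIV"
    and star_conj_linear: "conj_linear (star C)"
    and star_star: "star C (star C \<omega>) = \<omega>"
    and star_forms: "\<omega> \<in> forms C k \<Longrightarrow> star C \<omega> \<in> forms C k"
    and star_diff: "star C (diff C \<omega>) = diff C (star C \<omega>)"
    and star_mult: "\<omega> \<in> forms C k \<Longrightarrow> \<nu> \<in> forms C l \<Longrightarrow>
        star C (\<omega> * \<nu>) = (-1) ^ (k * l) * star C \<nu> * star C \<omega>"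
    and coact_comodule: "left_comodule H (coact C)"
    and coact_forms: "\<omega> \<in> forms C k \<Longrightarrow> coact C \<omega> \<in> tensor_subspace (forms C k)"
    and coact_mult: "coact C (\<omega> * \<nu>) = tensor_mult (*) (coact C \<omega>) (coact C \<nu>)"
    and coact_one: "coact C 1 = 1 \<otimes> 1"
    and coact_diff: "coact C (diff C \<omega>) = tensor_map id (diff C) (coact C \<omega>)"
    and coact_star: "coact C (star C \<omega>) = tensor_map (hstar H) (star C) (coact C \<omega>)"

record (overloaded) ('a::complex_algebra_1, 'w::complex_algebra_1) complex_calculus = "('a, 'w) calculus" +
  biforms :: "nat \<times> nat \<Rightarrow> 'w set"

definition bidegree_part ::
    "('a::complex_algebra_1, 'w::complex_algebra_1, 'z) complex_calculus_scheme \<Rightarrow> nat \<times> nat \<Rightarrow> 'w \<Rightarrow> 'w"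
  where "bidegree_part C = component (biforms C)"

definition del :: "('a::complex_algebra_1, 'w::complex_algebra_1, 'z) complex_calculus_scheme \<Rightarrow> 'w \<Rightarrow> 'w"
  where "del C \<omega> = (\<Sum>(a, b) | bidegree_part C (a, b) \<omega> \<noteq> 0.
    bidegree_part C (a + 1, b) (diff C (bidegree_part C (a, b) \<omega>)))"

definition delbar :: "('a::complex_algebra_1, 'w::complex_algebra_1, 'z) complex_calculus_scheme \<Rightarrow> 'w \<Rightarrow> 'w"
  where "delbar C \<omega> = (\<Sum>(a, b) | bidegree_part C (a, b) \<omega> \<noteq> 0.
    bidegree_part C (a, b + 1) (diff C (bidegree_part C (a, b) \<omega>)))"

text \<open>
  That the decomposition is one of bimodules over the base follows from \<open>biforms_mult\<close>, because
  \<open>biforms_sum\<close> for degree zero identifies the base with the forms of bidegree \<open>(0, 0)\<close>.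
\<close>

locale complex_structure = star_calculus H C
  for H :: "('a::complex_algebra_1, 'h) hopf_scheme"
    and C :: "('a, 'w::complex_algebra_1, 'z) complex_calculus_scheme" +
  assumes biforms_sum: "internal_direct_sum {(a, b). a + b = k} (biforms C) (forms C k)"
    and biforms_mult: "\<omega> \<in> biforms C (a, b) \<Longrightarrow> \<nu> \<in> biforms C (a', b') \<Longrightarrow>
        \<omega> * \<nu> \<in> biforms C (a + a', b + b')"
    and biforms_coact: "\<omega> \<in> biforms C (a, b) \<Longrightarrow> coact C \<omega> \<in> tensor_subspace (biforms C (a, b))"
    and biforms_star: "star C ` biforms C (a, b) = biforms C (b, a)"
    and diff_del_delbar: "diff C \<omega> = del C \<omega> + delbar C \<omega>"


section \<open>Kaehler structures\<close>

text \<open>The total dimension of the calculus is twice \<open>half_dim\<close>.\<close>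

record (overloaded) ('a::complex_algebra_1, 'w::complex_algebra_1) kahler = "('a, 'w) complex_calculus" +
  half_dim :: nat
  kform :: 'w

definition lefschetz :: "('a::complex_algebra_1, 'w::complex_algebra_1, 'z) kahler_scheme \<Rightarrow> 'w \<Rightarrow> 'w"
  where "lefschetz K \<omega> = kform K * \<omega>"

locale kahler_structure = complex_structure H K
  for H :: "('a::complex_algebra_1, 'h) hopf_scheme"
    and K :: "('a, 'w::complex_algebra_1, 'z) kahler_scheme" +
  assumes top_forms: "forms K (2 * half_dim K) \<noteq> {0}"
    and forms_above_top: "k > 2 * half_dim K \<Longrightarrow> forms K k = {0}"
    and kform_bidegree: "kform K \<in> biforms K (1, 1)"
    and kform_closed: "diff K (kform K) = 0"
    and kform_central: "kform K * \<omega> = \<omega> * kform K"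
    and kform_real: "star K (kform K) = kform K"
    and kform_coinvariant: "coact K (kform K) = 1 \<otimes> kform K"
    and hard_lefschetz: "k < half_dim K \<Longrightarrow>
        bij_betw (lefschetz K ^^ (half_dim K - k)) (forms K k) (forms K (2 * half_dim K - k))"

definition primitive :: "('a::complex_algebra_1, 'w::complex_algebra_1, 'z) kahler_scheme \<Rightarrow> nat \<Rightarrow> 'w set"
  where "primitive K k = (if k \<le> half_dim K
    then {\<alpha> \<in> forms K k. (lefschetz K ^^ (half_dim K - k + 1)) \<alpha> = 0} else {0})"

definition hodge :: "('a::complex_algebra_1, 'w::complex_algebra_1, 'z) kahler_scheme \<Rightarrow> 'w \<Rightarrow> 'w"
  where "hodge K = (THE T. clinear T \<and>
    (\<forall>a b j \<alpha>. \<alpha> \<in> primitive K (a + b) \<inter> biforms K (a, b) \<longrightarrow> j + (a + b) \<le> half_dim K \<longrightarrow>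
      T ((lefschetz K ^^ j) \<alpha>) =
        ((-1) ^ ((a + b) * (a + b + 1) div 2) * \<i> powi (int a - int b)
          * (fact j / fact (half_dim K - j - (a + b))))
        *\<^sub>C (lefschetz K ^^ (half_dim K - j - (a + b))) \<alpha>))"

definition vol :: "('a::complex_algebra_1, 'w::complex_algebra_1, 'z) kahler_scheme \<Rightarrow> 'w \<Rightarrow> 'w"
  where "vol K \<omega> = hodge K (component (forms K) (2 * half_dim K) \<omega>)"

definition dual_lefschetz :: "('a::complex_algebra_1, 'w::complex_algebra_1, 'z) kahler_scheme \<Rightarrow> 'w \<Rightarrow> 'w"
  where "dual_lefschetz K = inv (hodge K) \<circ> lefschetz K \<circ> hodge K"

definition positive_cone :: "('a::complex_algebra_1, 'w::complex_algebra_1, 'z) calculus_scheme \<Rightarrow> 'w set"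
  where "positive_cone C = {x. x \<noteq> 0 \<and> (\<exists>(N::nat) (c :: nat \<Rightarrow> real) m.
    (\<forall>i<N. 0 \<le> c i \<and> m i \<in> base C) \<and> x = (\<Sum>i<N. complex_of_real (c i) *\<^sub>C (m i * star C (m i))))}"

definition positive_definite :: "('a::complex_algebra_1, 'w::complex_algebra_1, 'z) kahler_scheme \<Rightarrow> bool"
  where "positive_definite K \<longleftrightarrow>
    (\<forall>\<omega>. \<omega> \<noteq> 0 \<longrightarrow> vol K (\<omega> * hodge K (star K \<omega>)) \<in> positive_cone K)"

text \<open>A state is a functional on the base; its values on other forms are irrelevant.\<close>

definition is_state :: "('a::complex_algebra_1, 'w::complex_algebra_1, 'z) calculus_scheme \<Rightarrow> ('w \<Rightarrow> complex) \<Rightarrow> bool"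
  where "is_state C \<phi> \<longleftrightarrow>
    (\<forall>x\<in>base C. \<forall>y\<in>base C. \<phi> (x + y) = \<phi> x + \<phi> y) \<and>
    (\<forall>c. \<forall>x\<in>base C. \<phi> (c *\<^sub>C x) = c * \<phi> x) \<and>
    \<phi> 1 = 1 \<and>
    (\<forall>x\<in>positive_cone C. \<exists>r>0. \<phi> x = complex_of_real r)"

definition closed_integral :: "('a::complex_algebra_1, 'w::complex_algebra_1, 'z) kahler_scheme \<Rightarrow> ('w \<Rightarrow> complex) \<Rightarrow> bool"
  where "closed_integral K \<phi> \<longleftrightarrow>
    (\<forall>k \<omega>. k + 1 = 2 * half_dim K \<longrightarrow> \<omega> \<in> forms K k \<longrightarrow> \<phi> (vol K (diff K \<omega>)) = 0)"


section \<open>Vector bundles\<close>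

text \<open>
  The module is the whole type \<open>'f\<close>.  The types \<open>'t\<close> and \<open>'s\<close> with \<open>tens\<close> and \<open>dtens\<close> are models
  of the tensor products over the base of all forms with the module, and of the dual module with
  all forms.  A Hermitian structure \<open>h\<close>, defined on the conjugate module, is encoded by the
  conjugate linear map \<open>herm E\<close> sending \<open>f\<close> to the value of \<open>h\<close> at the conjugate of \<open>f\<close>.
  Only \<open>lact E m\<close> for \<open>m\<close> in the base is meaningful.
\<close>

record (overloaded) ('a, 'w, 'f, 't, 's) bundle_data =
  lact :: "'w::complex_algebra_1 \<Rightarrow> 'f::complex_vector \<Rightarrow> 'f"
  fcoact :: "'f \<Rightarrow> 'a::complex_algebra_1 \<otimes> 'f"
  tens :: "'w \<Rightarrow> 'f \<Rightarrow> 't::complex_vector"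
  dtens :: "('f \<Rightarrow> 'w) \<Rightarrow> 'w \<Rightarrow> 's::complex_vector"
  dbar :: "'f \<Rightarrow> 't"
  herm :: "'f \<Rightarrow> 'f \<Rightarrow> 'w"

text \<open>A module is finitely generated projective if it is a retract of a free module of finite rank.\<close>

definition free_module :: "'w::zero set \<Rightarrow> nat \<Rightarrow> (nat \<Rightarrow> 'w) set"
  where "free_module M N = {v. (\<forall>i<N. v i \<in> M) \<and> (\<forall>i\<ge>N. v i = 0)}"

definition fg_projective :: "'w::ring_1 set \<Rightarrow> ('w \<Rightarrow> 'f::ab_group_add \<Rightarrow> 'f) \<Rightarrow> bool"
  where "fg_projective M act \<longleftrightarrow> (\<exists>N s r.
    (\<forall>f. s f \<in> free_module M N) \<and>
    (\<forall>f g. s (f + g) = s f + s g) \<and>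
    (\<forall>m\<in>M. \<forall>f. s (act m f) = (\<lambda>i. m * s f i)) \<and>
    (\<forall>v\<in>free_module M N. \<forall>w\<in>free_module M N. r (v + w) = r v + r w) \<and>
    (\<forall>m\<in>M. \<forall>v\<in>free_module M N. r (\<lambda>i. m * v i) = act m (r v)) \<and>
    (\<forall>f. r (s f) = f))"

definition dual_module ::
    "('a::complex_algebra_1, 'w::complex_algebra_1, 'z) calculus_scheme
      \<Rightarrow> ('a, 'w, 'f::complex_vector, 't::complex_vector, 's::complex_vector) bundle_data \<Rightarrow> ('f \<Rightarrow> 'w) set"
  where "dual_module C E = {\<phi>. (\<forall>f. \<phi> f \<in> base C) \<and> additive \<phi> \<and>
    (\<forall>m\<in>base C. \<forall>f. \<phi> (lact E m f) = m * \<phi> f)}"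

text \<open>
  In \<open>fcoact_lact\<close> the module action is precomposed with the projection onto the base in order to
  have a bilinear map on all forms; both sides only involve its restriction to the base.
\<close>

locale vector_bundle = star_calculus H C
  for H :: "('a::complex_algebra_1, 'h) hopf_scheme"
    and C :: "('a, 'w::complex_algebra_1, 'z) calculus_scheme" +
  fixes E :: "('a, 'w, 'f::complex_vector, 't::complex_vector, 's::complex_vector) bundle_data"
  assumes lact_add_right: "m \<in> base C \<Longrightarrow> lact E m (f + g) = lact E m f + lact E m g"
    and lact_add_left: "m \<in> base C \<Longrightarrow> m' \<in> base C \<Longrightarrow> lact E (m + m') f = lact E m f + lact E m' f"
    and lact_mult: "m \<in> base C \<Longrightarrow> m' \<in> base C \<Longrightarrow> lact E (m * m') f = lact E m (lact E m' f)"
    and lact_scalar: "lact E (c *\<^sub>C 1) f = c *\<^sub>C f"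
    and projective: "fg_projective (base C) (lact E)"
    and fcoact_comodule: "left_comodule H (fcoact E)"
    and fcoact_lact: "m \<in> base C \<Longrightarrow> fcoact E (lact E m f) =
        tensor_mult (\<lambda>x. lact E (component (forms C) 0 x)) (coact C m) (fcoact E f)"
    and tens: "is_tensor_product UNIV UNIV (base C) (*) (lact E) (tens E)"
    and dtens: "is_tensor_product (dual_module C E) UNIV (base C) (\<lambda>\<phi> m f. \<phi> f * m) (*) (dtens E)"

definition lift_tens ::
    "('a::complex_algebra_1, 'w::complex_algebra_1, 'f::complex_vector, 't::complex_vector, 's::complex_vector) bundle_data
      \<Rightarrow> ('w \<Rightarrow> 'f \<Rightarrow> 'x::complex_vector) \<Rightarrow> 't \<Rightarrow> 'x"
  where "lift_tens E = tensor_lift UNIV UNIV (tens E)"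

definition forms_tensor ::
    "('a::complex_algebra_1, 'w::complex_algebra_1, 'f::complex_vector, 't::complex_vector, 's::complex_vector) bundle_data
      \<Rightarrow> 'w set \<Rightarrow> 't set"
  where "forms_tensor E V = cspan {tens E \<omega> f | \<omega> f. \<omega> \<in> V}"

definition map_tens ::
    "('a::complex_algebra_1, 'w::complex_algebra_1, 'f::complex_vector, 't::complex_vector, 's::complex_vector) bundle_data
      \<Rightarrow> ('w \<Rightarrow> 'w) \<Rightarrow> 't \<Rightarrow> 't"
  where "map_tens E T = lift_tens E (\<lambda>\<omega> f. tens E (T \<omega>) f)"

abbreviation wedge_left ::
    "('a::complex_algebra_1, 'w::complex_algebra_1, 'f::complex_vector, 't::complex_vector, 's::complex_vector) bundle_data
      \<Rightarrow> 'w \<Rightarrow> 't \<Rightarrow> 't"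
  where "wedge_left E \<omega> \<equiv> map_tens E ((*) \<omega>)"

definition tens_coact ::
    "('a::complex_algebra_1, 'w::complex_algebra_1, 'z) calculus_scheme
      \<Rightarrow> ('a, 'w, 'f::complex_vector, 't::complex_vector, 's::complex_vector) bundle_data \<Rightarrow> 't \<Rightarrow> 'a \<otimes> 't"
  where "tens_coact C E = lift_tens E (\<lambda>\<omega> f. tensor_mult (tens E) (coact C \<omega>) (fcoact E f))"

text \<open>\<open>D (\<omega> \<otimes> f) = \<delta> \<omega> \<otimes> f + (-1)\<^bsup>|\<omega>|\<^esup> \<omega> \<and> D f\<close>\<close>

definition leibniz_extension ::
    "('a::complex_algebra_1, 'w::complex_algebra_1, 'z) calculus_scheme
      \<Rightarrow> ('a, 'w, 'f::complex_vector, 't::complex_vector, 's::complex_vector) bundle_data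
      \<Rightarrow> ('w \<Rightarrow> 'w) \<Rightarrow> ('f \<Rightarrow> 't) \<Rightarrow> 't \<Rightarrow> 't"
  where "leibniz_extension C E \<delta> D = (THE T. additive T \<and>
    (\<forall>k. \<forall>\<omega>\<in>forms C k. \<forall>f. T (tens E \<omega> f) = tens E (\<delta> \<omega>) f + (-1) ^ k *\<^sub>C wedge_left E \<omega> (D f)))"

definition delbar_ext ::
    "('a::complex_algebra_1, 'w::complex_algebra_1, 'z) complex_calculus_scheme
      \<Rightarrow> ('a, 'w, 'f::complex_vector, 't::complex_vector, 's::complex_vector) bundle_data \<Rightarrow> 't \<Rightarrow> 't"
  where "delbar_ext C E = leibniz_extension C E (delbar C) (dbar E)"

text \<open>
  The coaction on the dual module, in Sweedler notation
  \<open>\<phi>(-1) \<otimes> \<phi>(0)(f) = S(f(-1)) \<phi>(f(0))(-1) \<otimes> \<phi>(f(0))(0)\<close> for all \<open>f\<close>.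
\<close>

definition dual_coact ::
    "('a::complex_algebra_1, 'h) hopf_scheme \<Rightarrow> ('a, 'w::complex_algebra_1, 'z) calculus_scheme
      \<Rightarrow> ('a, 'w, 'f::complex_vector, 't::complex_vector, 's::complex_vector) bundle_data \<Rightarrow> ('f \<Rightarrow> 'w) \<Rightarrow> 'a \<otimes> ('f \<Rightarrow> 'w)"
  where "dual_coact H C E \<phi> = (THE u. u \<in> tensor_subspace (dual_module C E) \<and>
    (\<forall>f. tensor_map id (\<lambda>\<psi>. \<psi> f) u =
      lift2 (\<lambda>a g. tensor_map ((*) (antipode H a)) id (coact C (\<phi> g))) (fcoact E f)))"

locale hermitian_holomorphic_bundle = complex_structure H C + vector_bundle H C E
  for H :: "('a::complex_algebra_1, 'h) hopf_scheme"
    and C :: "('a, 'w::complex_algebra_1, 'z) complex_calculus_scheme"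
    and E :: "('a, 'w, 'f::complex_vector, 't::complex_vector, 's::complex_vector) bundle_data" +
  assumes dbar_linear: "clinear (dbar E)"
    and dbar_forms: "dbar E f \<in> forms_tensor E (biforms C (0, 1))"
    and dbar_comodule_map: "tens_coact C E (dbar E f) = tensor_map id (dbar E) (fcoact E f)"
    and dbar_leibniz: "m \<in> base C \<Longrightarrow>
        dbar E (lact E m f) = tens E (delbar C m) f + wedge_left E m (dbar E f)"
    and dbar_flat: "delbar_ext C E (delbar_ext C E x) = 0"
    and herm_bij: "bij_betw (herm E) UNIV (dual_module C E)"
    and herm_conj_linear: "conj_linear (herm E)"
    and herm_right_module_map: "m \<in> base C \<Longrightarrow> herm E (lact E (star C m) f) = (\<lambda>g. herm E f g * m)"
    and herm_comodule_map: "dual_coact H C E (herm E f) =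
        lift2 (\<lambda>a g. hstar H a \<otimes> herm E g) (fcoact E f)"
    and herm_hermitian: "herm E f g = star C (herm E g f)"

definition sesquilinear_pairing ::
    "('a::complex_algebra_1, 'w::complex_algebra_1, 'z) calculus_scheme
      \<Rightarrow> ('a, 'w, 'f::complex_vector, 't::complex_vector, 's::complex_vector) bundle_data \<Rightarrow> 't \<Rightarrow> 't \<Rightarrow> 'w"
  where "sesquilinear_pairing C E x y =
    lift_tens E (\<lambda>\<omega> f. lift_tens E (\<lambda>\<nu> g. \<omega> * herm E g f * star C \<nu>) y) x"

definition is_chern_connection ::
    "('a::complex_algebra_1, 'w::complex_algebra_1, 'z) complex_calculus_scheme
      \<Rightarrow> ('a, 'w, 'f::complex_vector, 't::complex_vector, 's::complex_vector) bundle_data \<Rightarrow> ('f \<Rightarrow> 't) \<Rightarrow> bool"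
  where "is_chern_connection C E nabla \<longleftrightarrow> clinear nabla \<and>
    (\<forall>f. nabla f \<in> forms_tensor E (forms C 1)) \<and>
    (\<forall>m\<in>base C. \<forall>f. nabla (lact E m f) = tens E (diff C m) f + wedge_left E m (nabla f)) \<and>
    (\<forall>f. tens_coact C E (nabla f) = tensor_map id nabla (fcoact E f)) \<and>
    (\<forall>f g. diff C (sesquilinear_pairing C E (tens E 1 f) (tens E 1 g)) =
      sesquilinear_pairing C E (nabla f) (tens E 1 g) + sesquilinear_pairing C E (tens E 1 f) (nabla g)) \<and>
    (\<forall>f. map_tens E (bidegree_part C (0, 1)) (nabla f) = dbar E f)"

definition del_ext ::
    "('a::complex_algebra_1, 'w::complex_algebra_1, 'z) complex_calculus_scheme
      \<Rightarrow> ('a, 'w, 'f::complex_vector, 't::complex_vector, 's::complex_vector) bundle_data \<Rightarrow> ('f \<Rightarrow> 't) \<Rightarrow> 't \<Rightarrow> 't"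
  where "del_ext C E nabla = leibniz_extension C E (del C) (\<lambda>f. map_tens E (bidegree_part C (1, 0)) (nabla f))"


section \<open>Lefschetz operators, metric and adjoints\<close>

definition L_bundle ::
    "('a::complex_algebra_1, 'w::complex_algebra_1, 'z) kahler_scheme
      \<Rightarrow> ('a, 'w, 'f::complex_vector, 't::complex_vector, 's::complex_vector) bundle_data \<Rightarrow> 't \<Rightarrow> 't"
  where "L_bundle K E = map_tens E (lefschetz K)"

definition Lambda_bundle ::
    "('a::complex_algebra_1, 'w::complex_algebra_1, 'z) kahler_scheme
      \<Rightarrow> ('a, 'w, 'f::complex_vector, 't::complex_vector, 's::complex_vector) bundle_data \<Rightarrow> 't \<Rightarrow> 't"
  where "Lambda_bundle K E = map_tens E (dual_lefschetz K)"

definition eval_wedge ::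
    "('a::complex_algebra_1, 'w::complex_algebra_1, 'z) calculus_scheme
      \<Rightarrow> ('a, 'w, 'f::complex_vector, 't::complex_vector, 's::complex_vector) bundle_data \<Rightarrow> 't \<Rightarrow> 's \<Rightarrow> 'w"
  where "eval_wedge C E x y =
    lift_tens E (\<lambda>\<omega> f. tensor_lift (dual_module C E) UNIV (dtens E) (\<lambda>\<phi> \<nu>. \<omega> * \<phi> f * \<nu>) y) x"

definition hodge_bar ::
    "('a::complex_algebra_1, 'w::complex_algebra_1, 'z) kahler_scheme
      \<Rightarrow> ('a, 'w, 'f::complex_vector, 't::complex_vector, 's::complex_vector) bundle_data \<Rightarrow> 't \<Rightarrow> 's"
  where "hodge_bar K E = lift_tens E (\<lambda>\<omega> f. dtens E (herm E f) (hodge K (star K \<omega>)))"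

definition bundle_metric ::
    "('a::complex_algebra_1, 'w::complex_algebra_1, 'z) kahler_scheme
      \<Rightarrow> ('a, 'w, 'f::complex_vector, 't::complex_vector, 's::complex_vector) bundle_data \<Rightarrow> 't \<Rightarrow> 't \<Rightarrow> 'w"
  where "bundle_metric K E x y = vol K (eval_wedge K E x (hodge_bar K E y))"

definition bundle_inner ::
    "('a::complex_algebra_1, 'w::complex_algebra_1, 'z) kahler_scheme
      \<Rightarrow> ('a, 'w, 'f::complex_vector, 't::complex_vector, 's::complex_vector) bundle_data
      \<Rightarrow> ('w \<Rightarrow> complex) \<Rightarrow> 't \<Rightarrow> 't \<Rightarrow> complex"
  where "bundle_inner K E \<phi> x y = \<phi> (bundle_metric K E x y)"

definition adjoint :: "('t \<Rightarrow> 't \<Rightarrow> complex) \<Rightarrow> ('t \<Rightarrow> 't) \<Rightarrow> 't \<Rightarrow> 't"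
  where "adjoint ip T = (THE S. \<forall>x y. ip (T x) y = ip x (S y))"

definition commutator :: "('t::ab_group_add \<Rightarrow> 't) \<Rightarrow> ('t \<Rightarrow> 't) \<Rightarrow> 't \<Rightarrow> 't"
  where "commutator S T = (\<lambda>x. S (T x) - T (S x))"

end

theory Submission
  imports Defs
begin

text \<open>
  The identities are a statement about representations of \<open>sl\<^sub>2\<close> on forms, transported to the bundle.

  On forms, every form is a sum of \<open>\<kappa>\<^sup>j \<and> \<alpha>\<close> with \<open>\<alpha>\<close> primitive, uniquely so.  The Hodge map is the
  composite of two commuting operators: an involution that maps \<open>\<kappa>\<^sup>j \<and> \<alpha>\<close> to a multiple of
  \<open>\<kappa>\<^sup>i \<and> \<alpha>\<close>, where \<open>i + j + |\<alpha>| = n\<close> (\<open>reflection\<close>), and multiplication by \<open>\<i>\<close> to the power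
  \<open>a - b\<close> in bidegree \<open>(a, b)\<close> (\<open>rotation\<close>).  Let \<open>D\<close> be any linear operator of degree one
  that commutes with \<open>L\<close>.  On a primitive form it has just two components,
  \<open>D \<alpha> = \<beta> + \<kappa> \<and> \<gamma>\<close> with \<open>\<beta>\<close>, \<open>\<gamma>\<close> primitive, and with this a direct calculation shows that
  conjugation by \<open>reflection\<close> turns \<open>D\<close>, up to the sign of the degree, into \<open>[\<Lambda>, D]\<close>, and that
  \<open>[L, [\<Lambda>, D]] = D\<close> (\<open>commutator_dual_lefschetz\<close>).  The rotation contributes the factor
  \<open>\<i>\<close> or \<open>- \<i>\<close>, according to whether \<open>D\<close> has bidegree \<open>(1, 0)\<close> or \<open>(0, 1)\<close>
  (\<open>kahler_identity\<close>).

  The calculation asks nothing of \<open>D\<close> beyond degree, bidegree and commutation with \<open>L\<close>.  So it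
  applies to the components of \<open>d\<close> and also to the operators \<open>\<omega> \<mapsto> (-1)\<^bsup>|\<omega>|\<^esup> \<omega> \<and> \<xi>\<close> with \<open>\<xi>\<close> a
  one-form of type \<open>(1, 0)\<close> or \<open>(0, 1)\<close>.  For a fixed section \<open>f\<close>, the twisted
  operator sends \<open>\<omega> \<otimes> f\<close> to a finite sum of \<open>D\<^sub>p \<omega> \<otimes> f\<^sub>p\<close> where each \<open>D\<^sub>p\<close> is of one of these
  kinds, whereas \<open>L\<close>, \<open>\<Lambda>\<close> and the Hodge map act on the first leg only.  Hence the identities pass to
  the bundle term by term (\<open>kahler_identity_tens\<close>), with no local frame.

  What remains is to recognise the conjugates by the Hodge map as adjoints.  The metric is
  the integral of the sesquilinear pairing of \<open>x\<close> with the Hodge dual of \<open>y\<close>.  The Chern connection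
  \<open>D' + D''\<close>, with \<open>D''\<close> the holomorphic structure, gives
  \<open>\<partial> h(x, z) = h(D' x, z) + (-1)\<^bsup>|x|\<^esup> h(x, D'' z)\<close>, and the integral of the left hand side vanishes:
  top forms have bidegree \<open>(n, n)\<close>, so a closed integral kills the images of the two components of
  \<open>d\<close> separately.  Therefore minus the Hodge conjugate of \<open>D''\<close> has the defining property of the
  adjoint of \<open>D'\<close>, and vice versa (\<open>adjoint_from_pairing\<close>).  Adjoints are unique because the metric is
  nondegenerate: the integral separates forms as the calculus is positive definite, and \<open>h\<close> separates
  elements of the tensor product as it is an isomorphism and the bundle is projective.
\<close>

section \<open>Linear maps and direct sums\<close>

lemma clinearI:
  assumes "\<And>x y. f (x + y) = f x + f y" "\<And>c x. f (c *\<^sub>C x) = c *\<^sub>C f x"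
  shows "clinear f"
  by unfold_locales (simp_all add: assms)

lemma clinearD:
  assumes "clinear f"
  shows clinear_add: "f (x + y) = f x + f y" and clinear_scale: "f (c *\<^sub>C x) = c *\<^sub>C f x"
proof -
  interpret Vector_Spaces.linear scaleC scaleC f by (rule assms)
  show "f (x + y) = f x + f y" "f (c *\<^sub>C x) = c *\<^sub>C f x" by (simp_all add: add scale)
qed

lemma clinear_additive: "clinear f \<Longrightarrow> additive f"
  by (simp add: additive_def clinear_add)

lemma clinear_compose: "clinear f \<Longrightarrow> clinear g \<Longrightarrow> clinear (\<lambda>x. f (g x))"
  by (rule clinearI) (simp_all add: clinear_add clinear_scale)

lemma additive_sum_list: "additive f \<Longrightarrow> f (sum_list xs) = sum_list (map f xs)"
  by (induction xs) (simp_all add: additive.zero additive.add)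

lemma scaleC_zero_right [simp]: "c *\<^sub>C 0 = (0 :: 'v::complex_vector)"
  by (rule complex_vector.scale_zero_right)

lemma scaleC_zero_left [simp]: "0 *\<^sub>C (x :: 'v::complex_vector) = 0"
  by (rule complex_vector.scale_zero_left)

lemma scaleC_minus_left: "(- c) *\<^sub>C (x :: 'v::complex_vector) = - (c *\<^sub>C x)"
  by (rule complex_vector.scale_minus_left)

lemma csubspaceD:
  assumes "csubspace V"
  shows csubspace_0: "0 \<in> V" and csubspace_add: "x \<in> V \<Longrightarrow> y \<in> V \<Longrightarrow> x + y \<in> V"
    and csubspace_scale: "x \<in> V \<Longrightarrow> c *\<^sub>C x \<in> V" and csubspace_diff: "x \<in> V \<Longrightarrow> y \<in> V \<Longrightarrow> x - y \<in> V"
    and csubspace_sum: "(\<And>i. i \<in> J \<Longrightarrow> v i \<in> V) \<Longrightarrow> sum v J \<in> V"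
  by (rule complex_vector.subspace_0[OF assms] complex_vector.subspace_add[OF assms]
      complex_vector.subspace_scale[OF assms] complex_vector.subspace_diff[OF assms]
      complex_vector.subspace_sum[OF assms]; assumption)+

lemma is_decomposition_sum:
  assumes "is_decomposition I V x c" "finite J" "{i. c i \<noteq> 0} \<subseteq> J"
  shows "x = sum c J"
  using assms by (auto simp: is_decomposition_def intro: sum.mono_neutral_left)

lemma is_decompositionI:
  assumes "finite J" "J \<subseteq> I" "\<And>i. i \<in> I \<Longrightarrow> c i \<in> V i" "\<And>i. i \<notin> J \<Longrightarrow> c i = 0" "x = sum c J"
  shows "is_decomposition I V x c"
proof -
  have "{i. c i \<noteq> 0} \<subseteq> J" using assms(4) by auto
  then have "finite {i. c i \<noteq> 0}" "sum c J = (\<Sum>i | c i \<noteq> 0. c i)"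
    using assms(1) finite_subset by (auto intro: sum.mono_neutral_right)
  then show ?thesis using assms by (auto simp: is_decomposition_def)
qed

lemma is_decomposition_add:
  assumes V: "\<And>i. csubspace (V i)" and c: "is_decomposition UNIV V x c" and c': "is_decomposition UNIV V y c'"
  shows "is_decomposition UNIV V (x + y) (\<lambda>i. c i + c' i)"
proof (rule is_decompositionI[of "{i. c i \<noteq> 0} \<union> {i. c' i \<noteq> 0}"])
  let ?J = "{i. c i \<noteq> 0} \<union> {i. c' i \<noteq> 0}"
  show fin: "finite ?J" using c c' by (simp add: is_decomposition_def)
  show "x + y = (\<Sum>i\<in>?J. c i + c' i)"
    using is_decomposition_sum[OF c fin] is_decomposition_sum[OF c' fin] by (simp add: sum.distrib)
  show "c i + c' i \<in> V i" for i
    by (rule csubspace_add[OF V]) (use c c' in \<open>auto simp: is_decomposition_def\<close>)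
qed auto

lemma internal_direct_sum_independent:
  assumes "internal_direct_sum I V X" "finite J" "J \<subseteq> I" "\<And>i. i \<in> J \<Longrightarrow> v i \<in> V i"
    "sum v J = 0" "i \<in> J"
  shows "v i = 0"
proof -
  have sub: "csubspace X" "csubspace (V i)" if "i \<in> I" for i
    using assms(1) that by (auto simp: internal_direct_sum_def)
  have "is_decomposition I V 0 (\<lambda>i. if i \<in> J then v i else 0)"
    by (rule is_decompositionI[of J]) (use assms csubspace_0[OF sub(2)] in auto)
  moreover have "is_decomposition I V 0 (\<lambda>i. 0)"
    by (rule is_decompositionI[of "{}"]) (use csubspace_0[OF sub(2)] in auto)
  moreover have "\<exists>!c. is_decomposition I V 0 c"
    using assms(1,3,6) sub csubspace_0 unfolding internal_direct_sum_def by blast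
  ultimately have "(\<lambda>i. if i \<in> J then v i else 0) = (\<lambda>i. 0)" by blast
  from fun_cong[OF this, of i] show ?thesis using assms(6) by simp
qed

text \<open>
  Independence of the summands is easier to check than uniqueness of decompositions when forms are
  decomposed in two stages, first by degree and then by bidegree.
\<close>

lemma internal_direct_sumI:
  assumes V: "\<And>i. csubspace (V i)"
    and ex: "\<And>x. \<exists>c. is_decomposition UNIV V x c"
    and ind: "\<And>J v i. finite J \<Longrightarrow> (\<And>i. v i \<in> V i) \<Longrightarrow> sum v J = 0 \<Longrightarrow> i \<in> J \<Longrightarrow> v i = 0"
  shows "internal_direct_sum UNIV V UNIV"
proof -
  have "c = c'" if c: "is_decomposition UNIV V x c" and c': "is_decomposition UNIV V x c'" for x c c'
  proof
    fix i
    let ?J = "insert i ({i. c i \<noteq> 0} \<union> {i. c' i \<noteq> 0})"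
    have fin: "finite ?J" using c c' by (auto simp: is_decomposition_def)
    have "x = sum c ?J" "x = sum c' ?J"
      by (rule is_decomposition_sum[OF c fin], blast) (rule is_decomposition_sum[OF c' fin], blast)
    then have "(\<Sum>i\<in>?J. c i - c' i) = 0" by (simp add: sum_subtractf)
    moreover have "c i - c' i \<in> V i" for i
      using c c' csubspace_diff[OF V] by (auto simp: is_decomposition_def)
    ultimately have "c i - c' i = 0"
      using ind[OF fin, of "\<lambda>i. c i - c' i" i] by blast
    then show "c i = c' i" by simp
  qed
  then show ?thesis
    unfolding internal_direct_sum_def using V ex by (auto simp: complex_vector.subspace_UNIV)
qed

locale direct_sum =
  fixes V :: "'i \<Rightarrow> 'v::complex_vector set"
  assumes internal: "internal_direct_sum UNIV V UNIV"
begin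

lemma subspace: "csubspace (V i)"
  using internal by (simp add: internal_direct_sum_def)

lemma decomposition: "is_decomposition UNIV V x (\<lambda>i. component V i x)"
proof -
  have "\<exists>!c. is_decomposition UNIV V x c"
    using internal by (simp add: internal_direct_sum_def)
  then have "is_decomposition UNIV V x (THE c. is_decomposition UNIV V x c)" by (rule theI')
  then show ?thesis by (simp add: component_def)
qed

lemma component_eqI:
  assumes "is_decomposition UNIV V x c"
  shows "component V i x = c i"
proof -
  have "\<exists>!c. is_decomposition UNIV V x c"
    using internal by (simp add: internal_direct_sum_def)
  then have "c' = c" if "is_decomposition UNIV V x c'" for c'
    using assms that by blast
  then have "(THE c. is_decomposition UNIV V x c) = c"
    using assms by blast
  then show ?thesis by (simp add: component_def)
qed

lemma component_mem: "component V i x \<in> V i"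
  using decomposition[of x] unfolding is_decomposition_def by blast

lemma finite_support: "finite {i. component V i x \<noteq> 0}"
  using decomposition[of x] unfolding is_decomposition_def by blast

lemma component_sum: "finite J \<Longrightarrow> {i. component V i x \<noteq> 0} \<subseteq> J \<Longrightarrow> (\<Sum>i\<in>J. component V i x) = x"
  by (rule is_decomposition_sum[OF decomposition, symmetric])

lemma component_on: "x \<in> V i \<Longrightarrow> component V j x = (if j = i then x else 0)"
  by (rule component_eqI, rule is_decompositionI[of "{i}"]) (auto simp: csubspace_0[OF subspace])

lemma component_linear: "clinear (component V i)"
proof (rule clinearI)
  fix x y c
  let ?J = "{i. component V i x \<noteq> 0}"
  have x: "x = (\<Sum>i\<in>?J. component V i x)"
    by (rule component_sum[symmetric]) (simp_all add: finite_support)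
  show "component V i (x + y) = component V i x + component V i y"
    by (rule component_eqI, rule is_decomposition_add[OF subspace decomposition decomposition])
  show "component V i (c *\<^sub>C x) = c *\<^sub>C component V i x"
  proof (rule component_eqI, rule is_decompositionI[OF finite_support[of x]])
    show "c *\<^sub>C x = (\<Sum>i\<in>?J. c *\<^sub>C component V i x)"
      unfolding complex_vector.scale_sum_right[symmetric] using x by simp
  qed (auto intro: csubspace_scale[OF subspace] component_mem)
qed

lemma homogeneous_induct [case_names homogeneous add]:
  assumes "\<And>i x. x \<in> V i \<Longrightarrow> P x" "\<And>x y. P x \<Longrightarrow> P y \<Longrightarrow> P (x + y)"
  shows "P x"
proof -
  have "P (sum v J)" if "finite J" "\<And>i. v i \<in> V i" for v J
    using that(1) by induction (auto intro: assms that(2) csubspace_0[OF subspace])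
  from this[OF finite_support[of x], of "\<lambda>i. component V i x"] component_mem show ?thesis
    by (simp add: component_sum[OF finite_support order_refl])
qed

text \<open>
  Operators that are prescribed summand by summand: the sign of the degree, the rotation in the Hodge
  map, and the two components of the differential are all of this form.
\<close>

definition glue :: "('i \<Rightarrow> 'v \<Rightarrow> 'u::complex_vector) \<Rightarrow> 'v \<Rightarrow> 'u"
  where "glue F x = (\<Sum>i | component V i x \<noteq> 0. F i (component V i x))"

context
  fixes F :: "'i \<Rightarrow> 'v \<Rightarrow> 'u::complex_vector"
  assumes F: "\<And>i. clinear (F i)"
begin

lemma F0: "F i 0 = 0"
  using clinear_scale[OF F, of i 0 0] by simp

lemma glue_superset:
  assumes "finite J" "{i. component V i x \<noteq> 0} \<subseteq> J"
  shows "glue F x = (\<Sum>i\<in>J. F i (component V i x))"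
  unfolding glue_def by (rule sum.mono_neutral_left) (use assms F0 in auto)

lemma glue_on: "x \<in> V i \<Longrightarrow> glue F x = F i x"
  by (subst glue_superset[of "{i}"]) (auto simp: component_on)

lemma glue_linear: "clinear (glue F)"
proof (rule clinearI)
  fix x y c
  let ?J = "{i. component V i x \<noteq> 0} \<union> {i. component V i y \<noteq> 0}"
  have fin: "finite ?J" by (simp add: finite_support)
  show "glue F (x + y) = glue F x + glue F y"
    by (subst (1 2 3) glue_superset[of ?J])
       (auto simp: finite_support clinear_add[OF component_linear] clinear_add[OF F] sum.distrib)
  show "glue F (c *\<^sub>C x) = c *\<^sub>C glue F x"
    by (subst (1 2) glue_superset[of ?J])
       (auto simp: finite_support clinear_scale[OF component_linear] clinear_scale[OF F]
         complex_vector.scale_sum_right)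
qed

end

end

text \<open>
  The existence principle behind the Hodge map: there \<open>V i\<close> consists of primitive forms and
  \<open>m i\<close> is a power of the Lefschetz operator.  Powers of that operator have kernels,
  but these meet the relevant \<open>V i\<close> only in zero.
\<close>

lemma linear_map_on_direct_sum:
  fixes m :: "'i \<Rightarrow> 'v::complex_vector \<Rightarrow> 'u::complex_vector" and g :: "'i \<Rightarrow> 'v \<Rightarrow> 'z::complex_vector"
  assumes I: "finite I" and V: "\<And>i. i \<in> I \<Longrightarrow> csubspace (V i)"
    and m: "\<And>i. i \<in> I \<Longrightarrow> clinear (m i)" and g: "\<And>i. i \<in> I \<Longrightarrow> clinear (g i)"
    and ex: "\<And>x. \<exists>v. (\<forall>i\<in>I. v i \<in> V i) \<and> x = (\<Sum>i\<in>I. m i (v i))"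
    and ind: "\<And>v i. (\<And>i. i \<in> I \<Longrightarrow> v i \<in> V i) \<Longrightarrow> (\<Sum>i\<in>I. m i (v i)) = 0 \<Longrightarrow> i \<in> I \<Longrightarrow> v i = 0"
  shows "\<exists>T. clinear T \<and> (\<forall>i\<in>I. \<forall>v\<in>V i. T (m i v) = g i v)"
proof -
  obtain v where vV: "\<And>x i. i \<in> I \<Longrightarrow> v x i \<in> V i" and v: "\<And>x. x = (\<Sum>i\<in>I. m i (v x i))"
    using ex by metis
  have uniq: "v x i = w i" if "\<And>i. i \<in> I \<Longrightarrow> w i \<in> V i" "x = (\<Sum>i\<in>I. m i (w i))" "i \<in> I" for x w i
  proof -
    have "(\<Sum>i\<in>I. m i (v x i - w i)) = (\<Sum>i\<in>I. m i (v x i)) - (\<Sum>i\<in>I. m i (w i))"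
      unfolding sum_subtractf[symmetric] by (rule sum.cong) (simp_all add: additive.diff clinear_additive m)
    also have "\<dots> = 0" using v[of x] that(2) by simp
    finally have "v x i - w i = 0"
      using ind[of "\<lambda>i. v x i - w i" i] that vV V csubspace_diff by blast
    then show ?thesis by simp
  qed
  define T where "T x = (\<Sum>i\<in>I. g i (v x i))" for x
  have "clinear T"
  proof (rule clinearI)
    fix x y c
    have "v (x + y) i = v x i + v y i" if "i \<in> I" for i
      by (rule uniq[OF _ _ that])
         (use vV csubspace_add[OF V] v[of x] v[of y] in
           \<open>auto simp: clinear_add[OF m] sum.distrib cong: sum.cong\<close>)
    then show "T (x + y) = T x + T y"
      by (simp add: T_def clinear_add[OF g] sum.distrib cong: sum.cong)
    have "v (c *\<^sub>C x) i = c *\<^sub>C v x i" if "i \<in> I" for i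
      by (rule uniq[OF _ _ that])
         (use vV csubspace_scale[OF V] v[of x] in
           \<open>auto simp: clinear_scale[OF m] complex_vector.scale_sum_right[symmetric] cong: sum.cong\<close>)
    then show "T (c *\<^sub>C x) = c *\<^sub>C T x"
      by (simp add: T_def clinear_scale[OF g] complex_vector.scale_sum_right cong: sum.cong)
  qed
  moreover have "T (m i w) = g i w" if i: "i \<in> I" and w: "w \<in> V i" for i w
  proof -
    have 0: "m j 0 = 0" "g j 0 = 0" if "j \<in> I" for j
      using additive.zero clinear_additive m g that by blast+
    have "v (m i w) j = (if j = i then w else 0)" if "j \<in> I" for j
    proof (rule uniq[OF _ _ that])
      have "(\<Sum>j\<in>I. m j (if j = i then w else 0)) = (\<Sum>j\<in>I. if j = i then m i w else 0)"
        by (rule sum.cong) (auto simp: 0)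
      then show "m i w = (\<Sum>j\<in>I. m j (if j = i then w else 0))" using I i by simp
    qed (use w V csubspace_0 in auto)
    then have "T (m i w) = (\<Sum>j\<in>I. if j = i then g i w else 0)"
      unfolding T_def by (intro sum.cong) (auto simp: 0)
    then show ?thesis using I i by simp
  qed
  ultimately show ?thesis by blast
qed

section \<open>The sign of the degree\<close>

lemma minus_one_power_mult: "(-1) ^ k * (x :: 'w::complex_algebra_1) = (-1) ^ k *\<^sub>C x"
  by (cases "even k") (simp_all add: scaleC_one scaleC_minus_left)

lemma conj_linearD:
  assumes "conj_linear f"
  shows conj_linear_add: "f (x + y) = f x + f y" and conj_linear_scale: "f (c *\<^sub>C x) = cnj c *\<^sub>C f x"
    and conj_linear_additive: "additive f"
  using assms by (auto simp: conj_linear_def additive.add)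

lemma mult_linear_left: "clinear (\<lambda>x::'w::complex_algebra_1. x * y)"
  by (rule clinearI) (simp_all add: distrib_right mult_scaleC_left)

lemma mult_linear_right: "clinear (\<lambda>y::'w::complex_algebra_1. x * y)"
  by (rule clinearI) (simp_all add: distrib_left mult_scaleC_right)

lemma scaleC_linear: "clinear (\<lambda>x::'v::complex_vector. c *\<^sub>C x)"
  by (rule clinearI) (simp_all add: scaleC_add_right scaleC_scaleC mult.commute)

context star_calculus
begin

sublocale deg: direct_sum "forms C"
  by unfold_locales (rule grading)

lemmas star_add = conj_linear_add[OF star_conj_linear]
  and star_scale = conj_linear_scale[OF star_conj_linear]
  and star_zero = additive.zero[OF conj_linear_additive[OF star_conj_linear]]
  and diff_add = clinear_add[OF diff_linear]

text \<open>
  Signs \<open>(-1)\<^bsup>|\<omega>|\<^esup>\<close> are expressed by this operator, so that graded rules hold for all forms and not only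
  for homogeneous ones.
\<close>

definition sgn_deg :: "'w \<Rightarrow> 'w"
  where "sgn_deg = deg.glue (\<lambda>k \<omega>. (-1) ^ k *\<^sub>C \<omega>)"

lemma sgn_linear: "clinear sgn_deg"
  unfolding sgn_deg_def by (rule deg.glue_linear) (rule scaleC_linear)

lemmas sgn_add = clinear_add[OF sgn_linear] and sgn_scale = clinear_scale[OF sgn_linear]

lemma sgn_on: "\<omega> \<in> forms C k \<Longrightarrow> sgn_deg \<omega> = (-1) ^ k *\<^sub>C \<omega>"
  unfolding sgn_deg_def by (subst deg.glue_on) (auto intro: scaleC_linear)

lemma sgn_forms: "\<omega> \<in> forms C k \<Longrightarrow> sgn_deg \<omega> \<in> forms C k"
  by (simp add: sgn_on csubspace_scale[OF deg.subspace])

lemma sgn_base: "m \<in> base C \<Longrightarrow> sgn_deg m = m"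
  by (simp add: sgn_on scaleC_one)

lemma sgn_sgn: "sgn_deg (sgn_deg \<omega>) = \<omega>"
proof (induction \<omega> rule: deg.homogeneous_induct)
  case (homogeneous k \<omega>)
  then show ?case
    by (simp add: sgn_on sgn_scale scaleC_scaleC scaleC_one flip: power_add)
qed (simp add: sgn_add)

lemma sgn_mult: "sgn_deg (\<omega> * \<nu>) = sgn_deg \<omega> * sgn_deg \<nu>"
proof (induction \<omega> rule: deg.homogeneous_induct)
  case (homogeneous k \<omega>)
  show ?case
  proof (induction \<nu> rule: deg.homogeneous_induct)
    case (homogeneous l \<nu>)
    then show ?case using \<open>\<omega> \<in> forms C k\<close>
      by (simp add: sgn_on[OF forms_mult] sgn_on mult_scaleC_left mult_scaleC_right scaleC_scaleC power_add)
  qed (simp add: sgn_add distrib_left)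
qed (simp add: sgn_add distrib_right)

lemma diff_mult: "diff C (\<omega> * \<nu>) = diff C \<omega> * \<nu> + sgn_deg \<omega> * diff C \<nu>"
proof (induction \<omega> rule: deg.homogeneous_induct)
  case (homogeneous k \<omega>)
  then show ?case by (simp add: leibniz sgn_on minus_one_power_mult mult_scaleC_left mult.assoc)
qed (simp add: sgn_add distrib_right diff_add)

lemma star_one: "star C 1 = 1"
proof -
  have "star C 1 * 1 = star C (1 * star C 1)"
    using star_mult[OF one_base star_forms[OF one_base]] by (simp add: star_star)
  then show ?thesis by (simp add: star_star)
qed

lemma star_mult_base_left: "m \<in> base C \<Longrightarrow> star C (m * \<omega>) = star C \<omega> * star C m"
  by (induction \<omega> rule: deg.homogeneous_induct)
     (use star_mult[of m 0] in \<open>auto simp: star_add distrib_left distrib_right\<close>)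

lemma star_mult_base_right: "m \<in> base C \<Longrightarrow> star C (\<omega> * m) = star C m * star C \<omega>"
  using star_mult_base_left[of "star C m" "star C \<omega>"] star_forms by (metis star_star)

end

section \<open>The components of the differential\<close>

context complex_structure
begin

lemma biforms_subspace: "csubspace (biforms C p)"
  using biforms_sum[of "fst p + snd p"] unfolding internal_direct_sum_def by (cases p) auto

lemma biforms_forms: "\<omega> \<in> biforms C (a, b) \<Longrightarrow> \<omega> \<in> forms C (a + b)"
  using biforms_sum[of "a + b"] unfolding internal_direct_sum_def by auto

lemma forms_biforms_induct [consumes 1, case_names biforms add]:
  assumes "\<omega> \<in> forms C k" "\<And>a b \<omega>. a + b = k \<Longrightarrow> \<omega> \<in> biforms C (a, b) \<Longrightarrow> P \<omega>"
    "\<And>\<omega> \<nu>. P \<omega> \<Longrightarrow> P \<nu> \<Longrightarrow> P (\<omega> + \<nu>)"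
  shows "P \<omega>"
proof -
  obtain c where c: "is_decomposition {(a, b). a + b = k} (biforms C) \<omega> c"
    using biforms_sum[of k] assms(1) unfolding internal_direct_sum_def by blast
  have P0: "P 0" by (rule assms(2)[of 0 k]) (simp_all add: csubspace_0[OF biforms_subspace])
  have cP: "P (c p)" for p
  proof (cases p)
    case (Pair a b)
    then show ?thesis using c P0 assms(2)[of a b "c p"] unfolding is_decomposition_def
      by (cases "a + b = k") auto
  qed
  have "P (sum c J)" if "finite J" for J
    using that by induction (simp_all add: P0 cP assms(3))
  then show ?thesis using c unfolding is_decomposition_def by metis
qed

lemma biforms_direct_sum: "internal_direct_sum UNIV (biforms C) UNIV"
proof (rule internal_direct_sumI)
  show "csubspace (biforms C p)" for p by (rule biforms_subspace)
  show "\<exists>c. is_decomposition UNIV (biforms C) \<omega> c" for \<omega>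
  proof (induction \<omega> rule: deg.homogeneous_induct)
    case (homogeneous k \<omega>)
    then show ?case
    proof (induction rule: forms_biforms_induct)
      case (biforms a b \<omega>)
      have "is_decomposition UNIV (biforms C) \<omega> (\<lambda>p. if p = (a, b) then \<omega> else 0)"
        by (rule is_decompositionI[of "{(a, b)}"]) (use biforms csubspace_0[OF biforms_subspace] in auto)
      then show ?case by blast
    next
      case (add \<omega> \<nu>)
      then show ?case using is_decomposition_add[of "biforms C", OF biforms_subspace] by blast
    qed
  next
    case (add \<omega> \<nu>)
    then show ?case using is_decomposition_add[of "biforms C", OF biforms_subspace] by blast
  qed
  show "v p = 0" if J: "finite J" and v: "\<And>p. v p \<in> biforms C p" and 0: "sum v J = 0" and p: "p \<in> J"
    for J v p
  proof -
    define t where "t p = fst p + snd p" for p :: "nat \<times> nat"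
    have "v q \<in> forms C k" if "t q = k" for q k
      using that v biforms_forms[of "v q" "fst q" "snd q"] by (simp add: t_def)
    then have v': "(\<Sum>q\<in>{q \<in> J. t q = k}. v q) \<in> forms C k" for k
      by (intro csubspace_sum[OF deg.subspace]) blast
    have "(\<Sum>k\<in>t ` J. \<Sum>q\<in>{q \<in> J. t q = k}. v q) = 0"
      using sum.image_gen[OF J, of v t] 0 by simp
    then have "(\<Sum>q\<in>{q \<in> J. t q = t p}. v q) = 0"
      by (rule internal_direct_sum_independent[OF grading, rotated 3])
         (use J p v' in auto)
    then show ?thesis
      by (rule internal_direct_sum_independent[OF biforms_sum[of "t p"], rotated 3])
         (use J p v in \<open>auto simp: t_def\<close>)
  qed
qed

sublocale bideg: direct_sum "biforms C"
  by unfold_locales (rule biforms_direct_sum)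

lemma bideg_disjoint: "\<omega> \<in> biforms C p \<Longrightarrow> \<omega> \<in> biforms C q \<Longrightarrow> p \<noteq> q \<Longrightarrow> \<omega> = 0"
  using bideg.component_on by metis

lemma base_biforms: "m \<in> base C \<Longrightarrow> m \<in> biforms C (0, 0)"
  by (induction rule: forms_biforms_induct) (auto simp: csubspace_add[OF biforms_subspace])

lemma biforms_mult_base:
  assumes "m \<in> base C" "\<omega> \<in> biforms C p"
  shows "m * \<omega> \<in> biforms C p" and "\<omega> * m \<in> biforms C p"
  using biforms_mult[OF base_biforms[OF assms(1)], of \<omega> "fst p" "snd p"]
    biforms_mult[OF _ base_biforms[OF assms(1)], of \<omega> "fst p" "snd p"] assms(2) by auto

lemma star_biforms: "\<omega> \<in> biforms C (a, b) \<Longrightarrow> star C \<omega> \<in> biforms C (b, a)"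
  using biforms_star by blast

lemma component_biforms_mult_base:
  assumes "m \<in> base C"
  shows "component (biforms C) p (\<omega> * m) = component (biforms C) p \<omega> * m"
proof (induction \<omega> rule: bideg.homogeneous_induct)
  case (homogeneous q \<omega>)
  then show ?case
    using biforms_mult_base(2)[OF assms homogeneous] by (simp add: bideg.component_on)
qed (simp add: distrib_right clinear_add[OF bideg.component_linear])

lemma del_glue: "del C = bideg.glue (\<lambda>(a, b) \<omega>. component (biforms C) (a + 1, b) (diff C \<omega>))"
  by (auto simp: fun_eq_iff del_def bidegree_part_def bideg.glue_def intro!: sum.cong)

lemma delbar_glue: "delbar C = bideg.glue (\<lambda>(a, b) \<omega>. component (biforms C) (a, b + 1) (diff C \<omega>))"
  by (auto simp: fun_eq_iff delbar_def bidegree_part_def bideg.glue_def intro!: sum.cong)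

lemma component_diff_linear: "clinear (\<lambda>\<omega>. component (biforms C) p (diff C \<omega>))"
  by (rule clinear_compose[OF bideg.component_linear diff_linear])

lemma del_linear: "clinear (del C)"
  unfolding del_glue by (rule bideg.glue_linear) (auto split: prod.split intro: component_diff_linear)

lemma delbar_linear: "clinear (delbar C)"
  unfolding delbar_glue by (rule bideg.glue_linear) (auto split: prod.split intro: component_diff_linear)

lemmas del_add = clinear_add[OF del_linear] and delbar_add = clinear_add[OF delbar_linear]

lemma del_biforms: "\<omega> \<in> biforms C (a, b) \<Longrightarrow> del C \<omega> \<in> biforms C (a + 1, b)"
  unfolding del_glue
  by (subst bideg.glue_on) (auto split: prod.split intro: component_diff_linear bideg.component_mem)

lemma delbar_biforms: "\<omega> \<in> biforms C (a, b) \<Longrightarrow> delbar C \<omega> \<in> biforms C (a, b + 1)"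
  unfolding delbar_glue
  by (subst bideg.glue_on) (auto split: prod.split intro: component_diff_linear bideg.component_mem)

lemma sgn_biforms: "\<omega> \<in> biforms C (a, b) \<Longrightarrow> sgn_deg \<omega> \<in> biforms C (a, b)"
  by (simp add: sgn_on[OF biforms_forms] csubspace_scale[OF biforms_subspace])

text \<open>
  Comparison of bidegrees: this separates an equation for \<open>d\<close> into one for each of its components.
\<close>

lemma bideg_split:
  assumes "x + y = x' + y'" "x \<in> biforms C p" "x' \<in> biforms C p" "y \<in> biforms C q" "y' \<in> biforms C q" "p \<noteq> q"
  shows "x = x'" "y = y'"
proof -
  have "x - x' = y' - y" using assms(1) by (simp add: algebra_simps)
  moreover have "x - x' \<in> biforms C p" "y' - y \<in> biforms C q"
    using assms csubspace_diff[OF biforms_subspace] by auto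
  ultimately have "x - x' = 0" using assms(6) bideg_disjoint by metis
  then show "x = x'" "y = y'" using assms(1) by auto
qed

text \<open>
  The Leibniz rule for \<open>d\<close>, separated by bidegree.
\<close>

lemma del_mult: "del C (\<omega> * \<nu>) = del C \<omega> * \<nu> + sgn_deg \<omega> * del C \<nu>"
proof (induction \<omega> rule: bideg.homogeneous_induct)
  case (homogeneous p \<omega>)
  then obtain a b where \<omega>: "\<omega> \<in> biforms C (a, b)" by (cases p) auto
  show ?case
  proof (induction \<nu> rule: bideg.homogeneous_induct)
    case (homogeneous q \<nu>)
    then obtain a' b' where \<nu>: "\<nu> \<in> biforms C (a', b')" by (cases q) auto
    show ?case
    proof (rule bideg_split(1))
      show "del C (\<omega> * \<nu>) + delbar C (\<omega> * \<nu>) =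
          (del C \<omega> * \<nu> + sgn_deg \<omega> * del C \<nu>) + (delbar C \<omega> * \<nu> + sgn_deg \<omega> * delbar C \<nu>)"
        using diff_mult[of \<omega> \<nu>] by (simp add: diff_del_delbar algebra_simps)
      show "del C (\<omega> * \<nu>) \<in> biforms C (a + a' + 1, b + b')"
        "delbar C (\<omega> * \<nu>) \<in> biforms C (a + a', b + b' + 1)"
        using del_biforms[OF biforms_mult[OF \<omega> \<nu>]] delbar_biforms[OF biforms_mult[OF \<omega> \<nu>]] by simp_all
      show "del C \<omega> * \<nu> + sgn_deg \<omega> * del C \<nu> \<in> biforms C (a + a' + 1, b + b')"
        using biforms_mult[OF del_biforms[OF \<omega>] \<nu>] biforms_mult[OF sgn_biforms[OF \<omega>] del_biforms[OF \<nu>]]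
        by (auto intro!: csubspace_add[OF biforms_subspace])
      show "delbar C \<omega> * \<nu> + sgn_deg \<omega> * delbar C \<nu> \<in> biforms C (a + a', b + b' + 1)"
        using biforms_mult[OF delbar_biforms[OF \<omega>] \<nu>] biforms_mult[OF sgn_biforms[OF \<omega>] delbar_biforms[OF \<nu>]]
        by (auto intro!: csubspace_add[OF biforms_subspace])
    qed simp
  qed (simp add: distrib_left del_add)
qed (simp add: distrib_right del_add sgn_add)

lemma delbar_mult: "delbar C (\<omega> * \<nu>) = delbar C \<omega> * \<nu> + sgn_deg \<omega> * delbar C \<nu>"
proof -
  have "del C (\<omega> * \<nu>) + delbar C (\<omega> * \<nu>) =
      (del C \<omega> * \<nu> + sgn_deg \<omega> * del C \<nu>) + (delbar C \<omega> * \<nu> + sgn_deg \<omega> * delbar C \<nu>)"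
    using diff_mult[of \<omega> \<nu>] by (simp add: diff_del_delbar algebra_simps)
  then show ?thesis by (simp add: del_mult)
qed

lemma star_del: "star C (del C \<omega>) = delbar C (star C \<omega>)"
proof (induction \<omega> rule: bideg.homogeneous_induct)
  case (homogeneous p \<omega>)
  then obtain a b where \<omega>: "\<omega> \<in> biforms C (a, b)" by (cases p) auto
  show ?case
  proof (rule bideg_split(1))
    show "star C (del C \<omega>) + star C (delbar C \<omega>) = delbar C (star C \<omega>) + del C (star C \<omega>)"
      using star_diff[of \<omega>] by (simp add: diff_del_delbar star_add add.commute)
    show "star C (del C \<omega>) \<in> biforms C (b, a + 1)" "star C (delbar C \<omega>) \<in> biforms C (b + 1, a)"
      "delbar C (star C \<omega>) \<in> biforms C (b, a + 1)" "del C (star C \<omega>) \<in> biforms C (b + 1, a)"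
      using \<omega> by (auto intro!: star_biforms del_biforms[simplified] delbar_biforms[simplified])
  qed simp
qed (simp add: star_add del_add delbar_add)

lemma star_delbar: "star C (delbar C \<omega>) = del C (star C \<omega>)"
  using star_del[of "star C \<omega>"] by (metis star_star)

end

section \<open>The Lefschetz decomposition\<close>

context kahler_structure
begin

lemma lefschetz_funpow: "(lefschetz K ^^ j) \<omega> = kform K ^ j * \<omega>"
  by (induction j) (simp_all add: lefschetz_def mult.assoc)

lemma kform_power_biforms: "\<omega> \<in> biforms K (a, b) \<Longrightarrow> kform K ^ j * \<omega> \<in> biforms K (a + j, b + j)"
proof (induction j)
  case (Suc j)
  then show ?case using biforms_mult[OF kform_bidegree, of "kform K ^ j * \<omega>"] by (simp add: mult.assoc)
qed simp

lemma kform_power_forms: "\<omega> \<in> forms K k \<Longrightarrow> kform K ^ j * \<omega> \<in> forms K (k + 2 * j)"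
proof (induction j)
  case (Suc j)
  then show ?case using forms_mult[OF biforms_forms[OF kform_bidegree], of "kform K ^ j * \<omega>"]
    by (simp add: mult.assoc)
qed simp

lemma lefschetz_injective:
  assumes "\<omega> \<in> forms K k" "i + k = half_dim K" "kform K ^ i * \<omega> = 0"
  shows "\<omega> = 0"
proof (cases i)
  case (Suc j)
  then have "bij_betw (lefschetz K ^^ i) (forms K k) (forms K (2 * half_dim K - k))"
    using hard_lefschetz[of k] assms(2) by (simp flip: assms(2))
  then have "inj_on (\<lambda>\<omega>. kform K ^ i * \<omega>) (forms K k)"
    by (simp add: bij_betw_def lefschetz_funpow cong: inj_on_cong)
  then show ?thesis
    using assms(1,3) csubspace_0[OF deg.subspace, of k] by (auto dest: inj_onD[of _ _ \<omega> 0])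
qed (use assms in simp)

lemma lefschetz_surjective:
  assumes "\<eta> \<in> forms K (k + 2 * i)" "i + k = half_dim K"
  obtains \<omega> where "\<omega> \<in> forms K k" "kform K ^ i * \<omega> = \<eta>"
proof (cases i)
  case 0
  then show ?thesis using that[of \<eta>] assms by simp
next
  case (Suc j)
  then have "bij_betw (lefschetz K ^^ i) (forms K k) (forms K (k + 2 * i))"
    using hard_lefschetz[of k] assms(2) by (simp flip: assms(2) add: algebra_simps)
  then have "\<eta> \<in> (lefschetz K ^^ i) ` forms K k" using assms(1) by (simp add: bij_betw_def)
  then show ?thesis using that by (auto simp: lefschetz_funpow)
qed

lemma primitive_iff:
  assumes "i + k = half_dim K"
  shows "\<alpha> \<in> primitive K k \<longleftrightarrow> \<alpha> \<in> forms K k \<and> kform K ^ Suc i * \<alpha> = 0"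
proof -
  have "half_dim K - k = i" "k \<le> half_dim K" using assms by simp_all
  then show ?thesis by (simp add: primitive_def lefschetz_funpow lefschetz_def mult.assoc)
qed

lemma primitive_subspace: "csubspace (primitive K k)"
proof (cases "k \<le> half_dim K")
  case True
  then have i: "half_dim K - k + k = half_dim K" by simp
  show ?thesis
    by (rule complex_vector.subspaceI)
       (simp_all add: primitive_iff[OF i] csubspace_0[OF deg.subspace] csubspace_add[OF deg.subspace]
         csubspace_scale[OF deg.subspace] distrib_left mult_scaleC_right del: power_Suc)
qed (simp add: primitive_def complex_vector.subspace_0)

text \<open>
  The two components of \<open>\<omega> = D \<theta>\<close> when \<open>\<theta>\<close> is primitive of degree \<open>k\<close> and \<open>D\<close> is an operator of degree
  one that commutes with the Lefschetz operator.  Hard Lefschetz gives the form \<open>\<eta>\<close> with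
  \<open>\<kappa>\<^bsup>i+1\<^esup> \<and> \<eta> = \<kappa>\<^sup>i \<and> \<omega>\<close>; then both \<open>\<eta>\<close> and \<open>\<omega> - \<kappa> \<and> \<eta>\<close> are primitive.  At the two ends
  of the range one of the components is zero: \<open>\<alpha>\<close> when \<open>\<omega>\<close> lies above the middle degree, and \<open>\<beta>\<close>
  when \<open>k = 0\<close>.
\<close>

lemma primitive_step:
  assumes "\<omega> \<in> forms K (Suc k)" "i + k = half_dim K" "kform K ^ Suc i * \<omega> = 0"
  obtains \<alpha> \<beta> where "\<omega> = \<alpha> + kform K * \<beta>"
    "if i = 0 then \<alpha> = 0 else \<alpha> \<in> primitive K (Suc k)"
    "if k = 0 then \<beta> = 0 else \<beta> \<in> primitive K (k - 1)"
proof (cases "k = 0")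
  case True
  have "\<omega> \<in> primitive K (Suc k)" if "i = Suc i'" for i'
  proof -
    have "kform K ^ i * \<omega> \<in> forms K (Suc (2 * half_dim K))"
      using kform_power_forms[OF assms(1), of i] assms(2) True by simp
    then have "kform K ^ i * \<omega> = 0" using forms_above_top by auto
    then show ?thesis using primitive_iff[of i' "Suc k"] assms that by simp
  qed
  moreover have "\<omega> = 0" if "i = 0"
    using that forms_above_top[of "Suc k"] assms True by simp
  ultimately show ?thesis using that[of \<omega> 0] True by (cases i) simp_all
next
  case False
  then obtain k' where k: "k = Suc k'" by (cases k) auto
  have "kform K ^ i * \<omega> \<in> forms K (k' + 2 * Suc i)"
    using kform_power_forms[OF assms(1), of i] k by simp
  then obtain \<eta> where \<eta>: "\<eta> \<in> forms K k'" "kform K ^ Suc i * \<eta> = kform K ^ i * \<omega>"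
    using lefschetz_surjective[of _ k' "Suc i"] assms(2) k by auto
  have "kform K ^ Suc (Suc i) * \<eta> = kform K * (kform K ^ Suc i * \<eta>)" by (simp add: mult.assoc)
  also have "\<dots> = 0" using assms(3) unfolding \<eta>(2) by (simp add: mult.assoc)
  finally have \<eta>': "\<eta> \<in> primitive K k'" using primitive_iff[of "Suc i" k'] assms(2) k \<eta>(1) by simp
  have 0: "kform K ^ i * (\<omega> - kform K * \<eta>) = 0"
    using \<eta>(2) by (simp add: right_diff_distrib power_commutes mult.assoc flip: mult.assoc[of "kform K ^ i"])
  have "\<omega> - kform K * \<eta> \<in> primitive K (Suc k)" if "i = Suc i'" for i'
    using primitive_iff[of i' "Suc k"] that 0 assms k kform_power_forms[OF \<eta>(1), of 1]
    by (simp add: csubspace_diff[OF deg.subspace])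
  moreover have "\<omega> - kform K * \<eta> = 0" if "i = 0" using that 0 by simp
  ultimately show ?thesis using that[of "\<omega> - kform K * \<eta>" \<eta>] k \<eta>' by (cases i) simp_all
qed

text \<open>
  Existence of the Lefschetz decomposition, as an induction rule.  The exponents satisfy
  \<open>j + i + k = n\<close> to avoid subtraction of natural numbers.  Up to the middle degree, hard Lefschetz
  splits off a primitive form, leaving a multiple of \<open>\<kappa>\<close>; above the middle, every form is
  \<open>\<kappa>\<^sup>j\<close> times one below.
\<close>

lemma lefschetz_induct [case_names primitive add]:
  assumes prim: "\<And>i j k \<alpha>. j + i + k = half_dim K \<Longrightarrow> \<alpha> \<in> primitive K k \<Longrightarrow> P (kform K ^ j * \<alpha>)"
    and add: "\<And>\<omega> \<nu>. P \<omega> \<Longrightarrow> P \<nu> \<Longrightarrow> P (\<omega> + \<nu>)"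
  shows "P \<omega>"
proof -
  have P0: "P 0" using prim[of 0 "half_dim K" 0 0] csubspace_0[OF primitive_subspace] by simp
  have low: "P (kform K ^ j * \<omega>)" if "\<omega> \<in> forms K k" "i + k = half_dim K" for i j k \<omega>
    using that
  proof (induction k arbitrary: \<omega> i j rule: less_induct)
    case (less k)
    have prim': "P (kform K ^ j * \<alpha>)" if "\<alpha> \<in> primitive K k" for \<alpha> j
    proof (cases "j \<le> i")
      case True
      then show ?thesis using prim[of j "i - j" k] less.prems that by simp
    next
      case False
      define j' where "j' = j - Suc i"
      have "j = j' + Suc i" using False by (simp add: j'_def)
      then have "kform K ^ j * \<alpha> = kform K ^ j' * (kform K ^ Suc i * \<alpha>)"
        by (simp only: power_add mult.assoc)
      also have "\<dots> = 0" using primitive_iff[OF less.prems(2)] that by simp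
      finally show ?thesis using P0 by simp
    qed
    have *: "kform K ^ Suc i * \<omega> \<in> forms K (k + 2 * Suc i)"
      by (rule kform_power_forms) (rule less.prems)
    show ?case
    proof (cases "k < 2")
      case True
      then have "kform K ^ Suc i * \<omega> = 0" using * forms_above_top[of "k + 2 * Suc i"] less.prems(2) by simp
      then show ?thesis using primitive_iff[OF less.prems(2)] less.prems by (intro prim') simp
    next
      case False
      define k' where "k' = k - 2"
      have k: "k = k' + 2" using False by (simp add: k'_def)
      obtain \<eta> where \<eta>: "\<eta> \<in> forms K k'" "kform K ^ Suc (Suc i) * \<eta> = kform K ^ Suc i * \<omega>"
        using lefschetz_surjective[of "kform K ^ Suc i * \<omega>" k' "Suc (Suc i)"] * less.prems(2) k
        by (auto simp del: power_Suc)
      have "kform K ^ Suc i * (kform K * \<eta>) = kform K ^ Suc (Suc i) * \<eta>"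
        by (simp add: power_commutes mult.assoc flip: mult.assoc[of "kform K ^ i"])
      then have "kform K ^ Suc i * (\<omega> - kform K * \<eta>) = 0"
        using \<eta>(2) by (simp only: right_diff_distrib diff_self)
      then have "\<omega> - kform K * \<eta> \<in> primitive K k"
        using primitive_iff[OF less.prems(2)] less.prems(1) kform_power_forms[OF \<eta>(1), of 1] k
        by (simp add: csubspace_diff[OF deg.subspace])
      then have "P (kform K ^ j * (\<omega> - kform K * \<eta>) + kform K ^ Suc j * \<eta>)"
        by (intro add prim' less.IH[of k' _ "i + 2"]) (use k \<eta>(1) less.prems(2) in auto)
      moreover have "kform K ^ j * (\<omega> - kform K * \<eta>) + kform K ^ Suc j * \<eta> = kform K ^ j * \<omega>"
        by (simp add: right_diff_distrib power_commutes mult.assoc flip: mult.assoc[of "kform K ^ j"])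
      ultimately show ?thesis by simp
    qed
  qed
  show ?thesis
  proof (induction \<omega> rule: deg.homogeneous_induct)
    case (homogeneous k \<omega>)
    consider "k \<le> half_dim K" | "half_dim K < k" "k \<le> 2 * half_dim K" | "2 * half_dim K < k" by linarith
    then show ?case
    proof cases
      case 1
      then show ?thesis using low[OF homogeneous, of "half_dim K - k" 0] by simp
    next
      case 2
      define i where "i = k - half_dim K"
      have "(half_dim K - i) + 2 * i = k" using 2 by (simp add: i_def)
      then have "\<omega> \<in> forms K ((half_dim K - i) + 2 * i)" using homogeneous by simp
      then obtain \<eta> where "\<eta> \<in> forms K (half_dim K - i)" "kform K ^ i * \<eta> = \<omega>"
        using lefschetz_surjective[of \<omega> "half_dim K - i" i] 2 by (auto simp: i_def)
      then show ?thesis using low[of \<eta> "half_dim K - i" i i] 2 by (simp add: i_def)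
    next
      case 3
      then show ?thesis using forms_above_top homogeneous P0 by auto
    qed
  qed (rule add)
qed

text \<open>
  Uniqueness of the Lefschetz decomposition.  In a vanishing sum of fixed degree let \<open>J\<close> be the largest
  exponent of \<open>\<kappa>\<close> with a nonzero coefficient.  Multiplication by the power of \<open>\<kappa>\<close> that is just
  short of annihilating the term with \<open>J\<close> annihilates all others, so hard Lefschetz makes that coefficient zero.
\<close>

lemma lefschetz_independent:
  assumes v: "\<And>k j. j + k \<le> half_dim K \<Longrightarrow> v (k, j) \<in> primitive K k"
    and 0: "(\<Sum>(k, j)\<in>{(k, j). j + k \<le> half_dim K}. kform K ^ j * v (k, j)) = 0"
    and kj: "j + k \<le> half_dim K"
  shows "v (k, j) = 0"
proof (rule ccontr)
  assume nz: "v (k, j) \<noteq> 0"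
  let ?I = "{(k, j). j + k \<le> half_dim K}"
  have "finite ({..half_dim K} \<times> {..half_dim K})" by simp
  then have fin: "finite ?I" by (rule rev_finite_subset) auto
  have prim: "v (k, j) \<in> forms K k" if "j + k \<le> half_dim K" for k j
    using v[OF that] that by (simp add: primitive_def)
  define t where "t p = fst p + 2 * snd p" for p :: "nat \<times> nat"
  define w where "w p = kform K ^ snd p * v p" for p
  define d where "d = t (k, j)"
  define F where "F = {p \<in> ?I. t p = d}"
  have finF: "finite F" using fin by (simp add: F_def)
  have wdeg: "w p \<in> forms K e" if "p \<in> ?I" "t p = e" for p e
    using that kform_power_forms[OF prim] by (cases p) (auto simp: w_def t_def)
  have "(\<Sum>e\<in>t ` ?I. \<Sum>p\<in>{p \<in> ?I. t p = e}. w p) = 0"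
    using sum.image_gen[OF fin, of w t] 0 by (simp add: w_def case_prod_unfold)
  then have F0: "sum w F = 0"
    unfolding F_def
  proof (rule internal_direct_sum_independent[OF grading, rotated 3])
    show "(\<Sum>p\<in>{p \<in> ?I. t p = e}. w p) \<in> forms K e" for e
      by (rule csubspace_sum[OF deg.subspace]) (use wdeg in blast)
    show "d \<in> t ` ?I" using kj by (auto simp: d_def)
  qed (use fin in auto)
  define J where "J = Max {j. \<exists>k. (k, j) \<in> F \<and> v (k, j) \<noteq> 0}"
  have finJ: "finite {j. \<exists>k. (k, j) \<in> F \<and> v (k, j) \<noteq> 0}"
    by (rule finite_subset[OF _ finite_imageI[OF finF, of snd]]) force
  have "(k, j) \<in> F" using kj by (simp add: F_def d_def)
  then have "J \<in> {j. \<exists>k. (k, j) \<in> F \<and> v (k, j) \<noteq> 0}"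
    unfolding J_def by (intro Max_in[OF finJ]) (use nz in blast)
  then obtain k0 where k0: "(k0, J) \<in> F" "v (k0, J) \<noteq> 0" by blast
  have Jmax: "j \<le> J" if "(k, j) \<in> F" "v (k, j) \<noteq> 0" for k j
    unfolding J_def by (rule Max_ge[OF finJ]) (use that in blast)
  define i where "i = half_dim K - (J + k0)"
  have i: "i + J + k0 = half_dim K" using k0(1) by (simp add: F_def i_def)
  have "kform K ^ i * w p = (if p = (k0, J) then kform K ^ (i + J) * v p else 0)" if pF: "p \<in> F" for p
  proof (cases p)
    case (Pair k j)
    have deg: "k + 2 * j = k0 + 2 * J" "j + k \<le> half_dim K" using that k0(1) Pair by (auto simp: F_def t_def)
    consider "v p = 0" | "j = J" | "j < J" using Jmax[of k j] pF Pair by (cases "v p = 0") (auto simp: le_less)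
    then show ?thesis
    proof cases
      case 3
      define l where "l = half_dim K - k"
      have l: "l + k = half_dim K" using deg by (simp add: l_def)
      define r where "r = i + j - Suc l"
      have "i + j = r + Suc l" using 3 deg i l by (simp add: r_def)
      then have "kform K ^ i * w p = kform K ^ r * (kform K ^ Suc l * v p)"
        using Pair by (simp only: w_def snd_conv mult.assoc[symmetric] power_add[symmetric])
      also have "\<dots> = 0" using v[OF deg(2)] primitive_iff[OF l] Pair by simp
      finally show ?thesis using 3 Pair by simp
    next
      case 1
      then show ?thesis using Pair by (auto simp: w_def)
    qed (use Pair deg in \<open>simp add: w_def power_add mult.assoc\<close>)
  qed
  then have "(\<Sum>p\<in>F. kform K ^ i * w p) = (\<Sum>p\<in>F. if p = (k0, J) then kform K ^ (i + J) * v p else 0)"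
    by (rule sum.cong[OF refl])
  then have "kform K ^ (i + J) * v (k0, J) = 0"
    using F0 k0(1) finF by (simp flip: sum_distrib_left)
  then have "v (k0, J) = 0"
    using lefschetz_injective[OF prim, of J k0 "i + J"] i by simp
  then show False using k0(2) by simp
qed

section \<open>The Hodge map\<close>

definition refl_sign :: "nat \<Rightarrow> complex"
  where "refl_sign k = (-1) ^ (k * (k + 1) div 2)"

text \<open>
  The part of the Hodge map that depends on degrees only.  In the language of \<open>sl\<^sub>2\<close> it is, up to
  signs, the action of the nontrivial element of the Weyl group.
\<close>

definition reflection :: "'w \<Rightarrow> 'w"
  where "reflection = (SOME T. clinear T \<and> (\<forall>i j k. \<forall>\<alpha>\<in>primitive K k. j + i + k = half_dim K \<longrightarrow>
    T (kform K ^ j * \<alpha>) = (refl_sign k * (fact j / fact i)) *\<^sub>C (kform K ^ i * \<alpha>)))"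

lemma reflection:
  shows reflection_linear: "clinear reflection"
    and reflection_primitive: "j + i + k = half_dim K \<Longrightarrow> \<alpha> \<in> primitive K k \<Longrightarrow>
      reflection (kform K ^ j * \<alpha>) = (refl_sign k * (fact j / fact i)) *\<^sub>C (kform K ^ i * \<alpha>)"
proof -
  let ?I = "{(k, j). j + k \<le> half_dim K}"
  have fin: "finite ?I"
    by (rule finite_subset[of _ "{..half_dim K} \<times> {..half_dim K}"]) auto
  have "\<exists>T. clinear T \<and> (\<forall>p\<in>?I. \<forall>\<alpha>\<in>primitive K (fst p). T (kform K ^ snd p * \<alpha>) =
      (refl_sign (fst p) * (fact (snd p) / fact (half_dim K - snd p - fst p))) *\<^sub>C
        (kform K ^ (half_dim K - snd p - fst p) * \<alpha>))"
  proof (rule linear_map_on_direct_sum[OF fin])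
    show "\<exists>v. (\<forall>p\<in>?I. v p \<in> primitive K (fst p)) \<and> \<omega> = (\<Sum>p\<in>?I. kform K ^ snd p * v p)" for \<omega>
    proof (induction \<omega> rule: lefschetz_induct)
      case (primitive i j k \<alpha>)
      let ?v = "\<lambda>p. if p = (k, j) then \<alpha> else 0"
      have "(\<Sum>p\<in>?I. kform K ^ snd p * ?v p) = (\<Sum>p\<in>?I. if p = (k, j) then kform K ^ j * \<alpha> else 0)"
        by (rule sum.cong) auto
      also have "\<dots> = kform K ^ j * \<alpha>" using fin primitive by simp
      finally show ?case
        using primitive csubspace_0[OF primitive_subspace] by (intro exI[of _ ?v]) auto
    next
      case (add \<omega> \<nu>)
      then obtain v v' where "\<forall>p\<in>?I. v p \<in> primitive K (fst p)" "\<omega> = (\<Sum>p\<in>?I. kform K ^ snd p * v p)"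
        "\<forall>p\<in>?I. v' p \<in> primitive K (fst p)" "\<nu> = (\<Sum>p\<in>?I. kform K ^ snd p * v' p)" by blast
      then show ?case
        by (intro exI[of _ "\<lambda>p. v p + v' p"])
           (auto simp: csubspace_add[OF primitive_subspace] distrib_left sum.distrib)
    qed
    show "v p = 0" if "\<And>p. p \<in> ?I \<Longrightarrow> v p \<in> primitive K (fst p)"
      "(\<Sum>p\<in>?I. kform K ^ snd p * v p) = 0" "p \<in> ?I" for v p
      using lefschetz_independent[of v "snd p" "fst p"] that by (auto simp: case_prod_unfold)
  qed (auto intro: primitive_subspace mult_linear_right clinear_compose[OF scaleC_linear])
  then obtain T where T: "clinear T" "\<And>p \<alpha>. p \<in> ?I \<Longrightarrow> \<alpha> \<in> primitive K (fst p) \<Longrightarrow> T (kform K ^ snd p * \<alpha>) =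
      (refl_sign (fst p) * (fact (snd p) / fact (half_dim K - snd p - fst p))) *\<^sub>C
        (kform K ^ (half_dim K - snd p - fst p) * \<alpha>)" by blast
  have "T (kform K ^ j * \<alpha>) = (refl_sign k * (fact j / fact i)) *\<^sub>C (kform K ^ i * \<alpha>)"
    if "\<alpha> \<in> primitive K k" "j + i + k = half_dim K" for i j k \<alpha>
  proof -
    have "half_dim K - j - k = i" using that(2) by simp
    then show ?thesis using T(2)[of "(k, j)" \<alpha>] that by simp
  qed
  then have "\<exists>T. clinear T \<and> (\<forall>i j k. \<forall>\<alpha>\<in>primitive K k. j + i + k = half_dim K \<longrightarrow>
      T (kform K ^ j * \<alpha>) = (refl_sign k * (fact j / fact i)) *\<^sub>C (kform K ^ i * \<alpha>))"
    using T(1) by blast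
  from someI_ex[OF this] show "clinear reflection"
    "j + i + k = half_dim K \<Longrightarrow> \<alpha> \<in> primitive K k \<Longrightarrow>
      reflection (kform K ^ j * \<alpha>) = (refl_sign k * (fact j / fact i)) *\<^sub>C (kform K ^ i * \<alpha>)"
    unfolding reflection_def by blast+
qed

lemmas reflection_add = clinear_add[OF reflection_linear]
  and reflection_scale = clinear_scale[OF reflection_linear]
  and reflection_zero = additive.zero[OF clinear_additive[OF reflection_linear]]

lemma refl_sign_square: "refl_sign k * refl_sign k = 1"
  by (simp add: refl_sign_def flip: power_mult_distrib)

lemma reflection_reflection: "reflection (reflection \<omega>) = \<omega>"
proof (induction \<omega> rule: lefschetz_induct)
  case (primitive i j k \<alpha>)
  have "refl_sign k * (fact j / fact i) * (refl_sign k * (fact i / fact j)) = 1"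
    using refl_sign_square[of k] by (simp add: field_simps)
  then show ?case
    using primitive reflection_primitive[of j i k \<alpha>] reflection_primitive[of i j k \<alpha>]
    by (simp add: reflection_scale scaleC_scaleC scaleC_one add.commute add.left_commute)
qed (simp add: reflection_add)

text \<open>
  Multiplications by base elements, the star and the rotation all commute with the reflection, for one
  reason: they map primitive forms to primitive forms of the same degree.  Homogeneity for real
  scalars is enough as the coefficients are real, which lets the star in.
\<close>

lemma reflection_commute:
  assumes X: "additive X" "\<And>r \<omega>. X (complex_of_real r *\<^sub>C \<omega>) = complex_of_real r *\<^sub>C X \<omega>"
    "\<And>k \<omega>. \<omega> \<in> forms K k \<Longrightarrow> X \<omega> \<in> forms K k" "\<And>\<omega>. X (kform K * \<omega>) = kform K * X \<omega>"
  shows "reflection (X \<omega>) = X (reflection \<omega>)"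
proof (induction \<omega> rule: lefschetz_induct)
  case (primitive i j k \<alpha>)
  have pow: "X (kform K ^ j * \<omega>) = kform K ^ j * X \<omega>" for j \<omega>
    by (induction j) (simp_all add: mult.assoc X(4))
  have k: "(j + i) + k = half_dim K" using primitive by simp
  have "X \<alpha> \<in> primitive K k"
    using primitive(2) X(3) pow[of "Suc (j + i)" \<alpha>] additive.zero[OF X(1)]
    unfolding primitive_iff[OF k] by simp
  moreover have "refl_sign k * (fact j / fact i) = complex_of_real ((-1) ^ (k * (k + 1) div 2) * (fact j / fact i))"
    by (simp add: refl_sign_def)
  ultimately show ?case
    by (simp only: pow reflection_primitive[OF primitive(1)] reflection_primitive[OF primitive(1,2)] X(2))
qed (simp add: reflection_add additive.add[OF X(1)])

definition rotation :: "'w \<Rightarrow> 'w"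
  where "rotation = bideg.glue (\<lambda>(a, b) \<omega>. (\<i> powi (int a - int b)) *\<^sub>C \<omega>)"

lemma rotation_linear: "clinear rotation"
  unfolding rotation_def by (rule bideg.glue_linear) (auto split: prod.split intro: scaleC_linear)

lemma rotation_on: "\<omega> \<in> biforms K (a, b) \<Longrightarrow> rotation \<omega> = (\<i> powi (int a - int b)) *\<^sub>C \<omega>"
  unfolding rotation_def by (subst bideg.glue_on) (auto split: prod.split intro: scaleC_linear)

lemmas rotation_add = clinear_add[OF rotation_linear]
  and rotation_scale = clinear_scale[OF rotation_linear]

lemma rotation_commute:
  assumes "clinear X" "\<And>p \<omega>. \<omega> \<in> biforms K p \<Longrightarrow> X \<omega> \<in> biforms K p"
  shows "rotation (X \<omega>) = X (rotation \<omega>)"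
proof (induction \<omega> rule: bideg.homogeneous_induct)
  case (homogeneous p \<omega>)
  then show ?case using assms(2)[of \<omega> p] by (cases p) (simp add: rotation_on clinear_scale[OF assms(1)])
qed (simp add: rotation_add clinear_add[OF assms(1)])

lemma rotation_kform: "rotation (kform K * \<omega>) = kform K * rotation \<omega>"
proof (induction \<omega> rule: bideg.homogeneous_induct)
  case (homogeneous p \<omega>)
  obtain a b where "p = (a, b)" by (cases p)
  then show ?case using homogeneous rotation_on[OF kform_power_biforms[of \<omega> a b 1]]
    by (simp add: rotation_on mult_scaleC_right)
qed (simp add: distrib_left rotation_add)

lemma i_powi_square: "\<i> powi m * \<i> powi m = (-1) powi m"
  by (simp flip: power_int_mult_distrib)

lemma minus_one_powi_diff: "(-1 :: complex) powi (int a - int b) = (-1) ^ (a + b)"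
  by (simp add: power_int_diff power_add power_int_of_nat divide_inverse flip: power_inverse)

lemma rotation_rotation: "rotation (rotation \<omega>) = sgn_deg \<omega>"
proof (induction \<omega> rule: bideg.homogeneous_induct)
  case (homogeneous p \<omega>)
  then show ?case
    by (cases p) (simp add: rotation_on rotation_scale scaleC_scaleC sgn_on[OF biforms_forms]
        i_powi_square minus_one_powi_diff)
qed (simp add: rotation_add sgn_add)

lemma rotation_forms: "\<omega> \<in> forms K k \<Longrightarrow> rotation \<omega> \<in> forms K k"
proof (induction rule: forms_biforms_induct)
  case (biforms a b \<omega>)
  then show ?case
    using csubspace_scale[OF deg.subspace biforms_forms[of \<omega> a b]] by (auto simp: rotation_on)
qed (simp add: rotation_add csubspace_add[OF deg.subspace])

lemma rotation_star: "rotation (star K \<omega>) = star K (rotation \<omega>)"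
proof (induction \<omega> rule: bideg.homogeneous_induct)
  case (homogeneous p \<omega>)
  obtain a b where p: "p = (a, b)" by (cases p)
  have "cnj (\<i> powi (int a - int b)) = (inverse \<i>) powi (int a - int b)"
    by (simp add: complex_cnj_power_int)
  also have "\<dots> = \<i> powi (int b - int a)"
    by (metis minus_diff_eq power_int_inverse power_int_minus)
  finally show ?case
    using homogeneous star_biforms[of \<omega> a b] p by (simp add: rotation_on star_scale)
qed (simp add: rotation_add star_add)

lemma rotation_reflection: "rotation (reflection \<omega>) = reflection (rotation \<omega>)"
  by (rule reflection_commute[symmetric])
     (simp_all add: clinear_additive rotation_linear rotation_scale rotation_forms rotation_kform)

lemma kform_forms: "kform K \<in> forms K 2"
  using biforms_forms[OF kform_bidegree] by (simp add: numeral_2_eq_2)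

lemma sgn_kform: "sgn_deg (kform K * \<omega>) = kform K * sgn_deg \<omega>"
  by (simp add: sgn_mult sgn_on[OF kform_forms] scaleC_one)

lemma sgn_reflection: "sgn_deg (reflection \<omega>) = reflection (sgn_deg \<omega>)"
  by (rule reflection_commute[symmetric])
     (simp_all add: clinear_additive sgn_linear sgn_scale sgn_forms sgn_kform)

lemma component_kform_power: "component (biforms K) (a + j, b + j) (kform K ^ j * \<omega>) =
    kform K ^ j * component (biforms K) (a, b) \<omega>"
proof (induction \<omega> rule: bideg.homogeneous_induct)
  case (homogeneous p \<omega>)
  then show ?case
    using kform_power_biforms[of \<omega> "fst p" "snd p" j] by (cases p) (auto simp: bideg.component_on)
qed (simp add: distrib_left clinear_add[OF bideg.component_linear])

lemma component_biforms_forms: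
  "\<omega> \<in> forms K k \<Longrightarrow> component (biforms K) (a, b) \<omega> \<in> forms K k \<and>
    (a + b \<noteq> k \<longrightarrow> component (biforms K) (a, b) \<omega> = 0)"
proof (induction rule: forms_biforms_induct)
  case (biforms a' b' \<omega>)
  then show ?case
    using biforms_forms[of \<omega> a' b'] csubspace_0[OF deg.subspace] by (auto simp: bideg.component_on)
qed (simp add: clinear_add[OF bideg.component_linear] csubspace_add[OF deg.subspace])

text \<open>
  The bidegree components of a primitive form are primitive, because \<open>\<kappa>\<close> is bihomogeneous.
\<close>

lemma lefschetz_bideg_induct [case_names primitive add]:
  assumes prim: "\<And>i j a b \<alpha>. j + i + (a + b) = half_dim K \<Longrightarrow> \<alpha> \<in> primitive K (a + b) \<Longrightarrow>
      \<alpha> \<in> biforms K (a, b) \<Longrightarrow> P (kform K ^ j * \<alpha>)"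
    and add: "\<And>\<omega> \<nu>. P \<omega> \<Longrightarrow> P \<nu> \<Longrightarrow> P (\<omega> + \<nu>)"
  shows "P \<omega>"
proof (induction \<omega> rule: lefschetz_induct)
  case (primitive i j k \<alpha>)
  let ?c = "\<lambda>p. component (biforms K) p \<alpha>"
  have P0: "P 0" using prim[of 0 "half_dim K" 0 0 0] csubspace_0[OF primitive_subspace]
      csubspace_0[OF biforms_subspace] by simp
  have k: "(j + i) + k = half_dim K" using primitive by simp
  have c: "P (kform K ^ j * ?c p)" for p
  proof (cases p)
    case (Pair a b)
    have \<alpha>: "\<alpha> \<in> forms K k" "kform K ^ Suc (j + i) * \<alpha> = 0" using primitive(2) primitive_iff[OF k] by auto
    then have "kform K ^ Suc (j + i) * ?c (a, b) = 0"
      using component_kform_power[of a "Suc (j + i)" b \<alpha>] additive.zero[OF clinear_additive[OF bideg.component_linear]]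
      by simp
    then have "?c (a, b) \<in> primitive K k"
      using component_biforms_forms[OF \<alpha>(1)] primitive_iff[OF k] by blast
    then show ?thesis
      using component_biforms_forms[OF \<alpha>(1), of a b] bideg.component_mem[of "(a, b)" \<alpha>]
        prim[of j i a b "?c (a, b)"] k P0 Pair by (cases "a + b = k") (auto simp: algebra_simps)
  qed
  have "P (\<Sum>p\<in>S. kform K ^ j * ?c p)" if "finite S" for S
    using that by induction (auto intro: P0 add c)
  from this[OF bideg.finite_support[of \<alpha>]]
  show ?case by (simp add: bideg.component_sum[OF bideg.finite_support order_refl] flip: sum_distrib_left)
qed (rule add)

text \<open>
  The reflection carries the real coefficients of the Hodge map, and the rotation its powers of
  \<open>\<i>\<close>; the rotation commutes with \<open>L\<close> since \<open>\<kappa>\<close> has bidegree \<open>(1, 1)\<close>.  Uniqueness holds as the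
  defining values are those on a spanning set.
\<close>

lemma hodge_eq: "hodge K = (\<lambda>\<omega>. reflection (rotation \<omega>))"
proof -
  let ?spec = "\<lambda>T. clinear T \<and>
    (\<forall>a b j \<alpha>. \<alpha> \<in> primitive K (a + b) \<inter> biforms K (a, b) \<longrightarrow> j + (a + b) \<le> half_dim K \<longrightarrow>
      T ((lefschetz K ^^ j) \<alpha>) =
        ((-1) ^ ((a + b) * (a + b + 1) div 2) * \<i> powi (int a - int b)
          * (fact j / fact (half_dim K - j - (a + b))))
        *\<^sub>C (lefschetz K ^^ (half_dim K - j - (a + b))) \<alpha>)"
  have rot: "rotation (kform K ^ j * \<alpha>) = kform K ^ j * rotation \<alpha>" for j \<alpha>
    by (induction j) (simp_all add: mult.assoc rotation_kform)
  have *: "?spec (\<lambda>\<omega>. reflection (rotation \<omega>))"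
  proof (intro conjI allI impI)
    show "clinear (\<lambda>\<omega>. reflection (rotation \<omega>))"
      by (rule clinear_compose[OF reflection_linear rotation_linear])
    fix a b j \<alpha>
    assume \<alpha>: "\<alpha> \<in> primitive K (a + b) \<inter> biforms K (a, b)" and j: "j + (a + b) \<le> half_dim K"
    then have "j + (half_dim K - j - (a + b)) + (a + b) = half_dim K" by simp
    moreover have "rotation \<alpha> = (\<i> powi (int a - int b)) *\<^sub>C \<alpha>" using \<alpha> by (simp add: rotation_on)
    ultimately show "reflection (rotation ((lefschetz K ^^ j) \<alpha>)) =
        ((-1) ^ ((a + b) * (a + b + 1) div 2) * \<i> powi (int a - int b)
          * (fact j / fact (half_dim K - j - (a + b))))
        *\<^sub>C (lefschetz K ^^ (half_dim K - j - (a + b))) \<alpha>"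
      using reflection_primitive[of j "half_dim K - j - (a + b)" "a + b" \<alpha>] \<alpha>
      by (simp add: lefschetz_funpow rot mult_scaleC_right reflection_scale scaleC_scaleC
          refl_sign_def mult_ac)
  qed
  have "T = T'" if T: "?spec T" and T': "?spec T'" for T T'
  proof
    fix \<omega>
    show "T \<omega> = T' \<omega>"
    proof (induction \<omega> rule: lefschetz_bideg_induct)
      case (primitive i j a b \<alpha>)
      then have "\<alpha> \<in> primitive K (a + b) \<inter> biforms K (a, b)" "j + (a + b) \<le> half_dim K" by auto
      then have "T ((lefschetz K ^^ j) \<alpha>) = T' ((lefschetz K ^^ j) \<alpha>)"
        using T[THEN conjunct2, rule_format] T'[THEN conjunct2, rule_format] by presburger
      then show ?case by (simp add: lefschetz_funpow)
    next
      case (add \<omega> \<nu>)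
      then show ?case using T T' clinear_add by metis
    qed
  qed
  then show ?thesis unfolding hodge_def using * by (intro the_equality) blast+
qed

lemma hodge_linear: "clinear (hodge K)"
  unfolding hodge_eq by (rule clinear_compose[OF reflection_linear rotation_linear])

lemmas hodge_add = clinear_add[OF hodge_linear]
  and hodge_zero = additive.zero[OF clinear_additive[OF hodge_linear]]

lemma hodge_hodge: "hodge K (hodge K \<omega>) = sgn_deg \<omega>"
  by (simp add: hodge_eq rotation_reflection reflection_reflection rotation_rotation)

lemma hodge_star: "hodge K (star K \<omega>) = star K (hodge K \<omega>)"
proof -
  have "star K (kform K * \<nu>) = kform K * star K \<nu>" for \<nu>
  proof (induction \<nu> rule: deg.homogeneous_induct)
    case (homogeneous k \<nu>)
    then show ?case
      using star_mult[OF kform_forms homogeneous] kform_central[of "star K \<nu>"] by (simp add: kform_real)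
  qed (simp add: distrib_left star_add)
  then have "reflection (star K \<nu>) = star K (reflection \<nu>)" for \<nu>
    by (intro reflection_commute) (simp_all add: conj_linear_additive[OF star_conj_linear] star_scale star_forms)
  then show ?thesis by (simp add: hodge_eq rotation_star)
qed

lemma reflection_mult_base:
  assumes "m \<in> base K"
  shows "reflection (m * \<omega>) = m * reflection \<omega>" "reflection (\<omega> * m) = reflection \<omega> * m"
proof -
  show "reflection (m * \<omega>) = m * reflection \<omega>"
  proof (rule reflection_commute)
    show "m * (kform K * \<nu>) = kform K * (m * \<nu>)" for \<nu>
      using kform_central[of m] by (metis mult.assoc)
  qed (use forms_mult[OF assms] in \<open>auto simp: clinear_additive mult_linear_right mult_scaleC_right\<close>)
  show "reflection (\<omega> * m) = reflection \<omega> * m"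
    by (rule reflection_commute)
       (use forms_mult[OF _ assms] in \<open>auto simp: clinear_additive mult_linear_left mult_scaleC_left mult.assoc\<close>)
qed

lemma hodge_mult_base:
  assumes "m \<in> base K"
  shows "hodge K (m * \<omega>) = m * hodge K \<omega>" "hodge K (\<omega> * m) = hodge K \<omega> * m"
  by (simp_all add: hodge_eq reflection_mult_base[OF assms]
      rotation_commute[where X = "\<lambda>\<omega>. m * \<omega>"] rotation_commute[where X = "\<lambda>\<omega>. \<omega> * m"]
      mult_linear_left mult_linear_right biforms_mult_base[OF assms])

text \<open>
  The rotation commutes with \<open>L\<close>, so it cancels from \<open>\<Lambda>\<close>.
\<close>

lemma dual_lefschetz_eq: "dual_lefschetz K \<omega> = reflection (kform K * reflection \<omega>)"
proof -
  have "inj (hodge K)" by (rule injI) (metis hodge_hodge sgn_sgn)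
  then have "inv (hodge K) (hodge K (reflection (kform K * reflection \<omega>))) = reflection (kform K * reflection \<omega>)"
    by (rule inv_f_f)
  then show ?thesis
    by (simp add: dual_lefschetz_def lefschetz_def hodge_eq rotation_reflection reflection_reflection rotation_kform)
qed

lemma dual_lefschetz_linear: "clinear (dual_lefschetz K)"
  by (rule clinearI)
     (simp_all add: dual_lefschetz_eq reflection_add reflection_scale distrib_left mult_scaleC_right)

text \<open>
  With this formula \<open>L\<close> and \<open>\<Lambda>\<close> act as in the standard irreducible representation of \<open>sl\<^sub>2\<close>, the
  lowest weight vector being \<open>\<alpha>\<close>.  For \<open>j = 0\<close> the coefficient vanishes, so the truncated exponent
  is harmless.
\<close>

lemma dual_lefschetz_primitive:
  assumes "j + i + k = half_dim K" "\<alpha> \<in> primitive K k"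
  shows "dual_lefschetz K (kform K ^ j * \<alpha>) = (of_nat j * of_nat (Suc i)) *\<^sub>C (kform K ^ (j - 1) * \<alpha>)"
proof (cases j)
  case 0
  then have "kform K * (kform K ^ i * \<alpha>) = 0"
    using assms primitive_iff[of i k \<alpha>] by (simp add: mult.assoc)
  then show ?thesis
    unfolding dual_lefschetz_eq reflection_primitive[OF assms] using 0
    by (simp add: reflection_zero mult_scaleC_right)
next
  case (Suc j')
  have "reflection (kform K ^ Suc i * \<alpha>) = (refl_sign k * (fact (Suc i) / fact j')) *\<^sub>C (kform K ^ j' * \<alpha>)"
    by (rule reflection_primitive) (use assms Suc in auto)
  then have *: "reflection (kform K * (kform K ^ i * \<alpha>)) =
      (refl_sign k * (fact (Suc i) / fact j')) *\<^sub>C (kform K ^ j' * \<alpha>)"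
    by (simp add: mult.assoc)
  have **: "refl_sign k * (fact j / fact i) * (refl_sign k * (fact (Suc i) / fact j')) =
      of_nat j * of_nat (Suc i)"
    using refl_sign_square[of k] Suc by (simp add: field_simps)
  show ?thesis
    unfolding dual_lefschetz_eq reflection_primitive[OF assms] mult_scaleC_right reflection_scale
      * scaleC_scaleC ** using Suc by simp
qed

end

section \<open>The identities for operators on forms\<close>

context kahler_structure
begin

text \<open>
  The properties of an operator that its Kaehler identity rests on.  The last one replaces a condition on
  the bidegree: it holds with \<open>c = \<i>\<close> for operators of bidegree \<open>(1, 0)\<close> and with \<open>c = - \<i>\<close> for
  bidegree \<open>(0, 1)\<close>.
\<close>

definition kahler_operator :: "complex \<Rightarrow> ('w \<Rightarrow> 'w) \<Rightarrow> bool"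
  where "kahler_operator c D \<longleftrightarrow> clinear D \<and> (\<forall>\<omega>. D (kform K * \<omega>) = kform K * D \<omega>) \<and>
    (\<forall>k. \<forall>\<omega>\<in>forms K k. D \<omega> \<in> forms K (Suc k)) \<and>
    (\<forall>\<omega>. rotation (D (rotation \<omega>)) = c *\<^sub>C D (sgn_deg \<omega>))"

text \<open>
  The core of the proof.  The operator \<open>D\<close> enters only through the decomposition
  \<open>D \<alpha> = \<beta> + \<kappa> \<and> \<gamma>\<close> for primitive \<open>\<alpha>\<close>, where \<open>\<beta>\<close> has degree \<open>k + 1\<close> and \<open>\<gamma>\<close> degree \<open>k - 1\<close>.
  With \<open>j + i + k = n\<close>, each of the operators on the two sides of the first identity takes \<open>\<kappa>\<^sup>j \<and> \<alpha>\<close> to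
  \<open>- j \<kappa>\<^bsup>j-1\<^esup> \<and> \<beta> + (i + 1) \<kappa>\<^sup>j \<and> \<gamma>\<close>, and the second one follows from this formula for \<open>j\<close> and
  \<open>j + 1\<close>.
\<close>

lemma commutator_dual_lefschetz:
  assumes D: "clinear D" "\<And>\<omega>. D (kform K * \<omega>) = kform K * D \<omega>"
    "\<And>k \<omega>. \<omega> \<in> forms K k \<Longrightarrow> D \<omega> \<in> forms K (Suc k)"
  defines "DL \<equiv> \<lambda>\<omega>. reflection (D (reflection (sgn_deg \<omega>)))"
  shows "DL \<omega> = dual_lefschetz K (D \<omega>) - D (dual_lefschetz K \<omega>)"
    and "kform K * DL \<omega> - DL (kform K * \<omega>) = D \<omega>"
proof -
  note D_add = clinear_add[OF D(1)] and D_scale = clinear_scale[OF D(1)]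
    and D_zero = additive.zero[OF clinear_additive[OF D(1)]]
    and \<Lambda>_add = clinear_add[OF dual_lefschetz_linear]
    and \<Lambda>_zero = additive.zero[OF clinear_additive[OF dual_lefschetz_linear]]
  have D_pow: "D (kform K ^ j * \<omega>) = kform K ^ j * D \<omega>" for j \<omega>
    by (induction j) (simp_all add: mult.assoc D(2))
  have DL_add: "DL (\<omega> + \<nu>) = DL \<omega> + DL \<nu>" for \<omega> \<nu>
    by (simp add: DL_def sgn_add reflection_add D_add)
  have DL_zero: "DL 0 = 0" using DL_add[of 0 0] by simp
  have sgn_pow: "sgn_deg (kform K ^ j * \<omega>) = kform K ^ j * sgn_deg \<omega>" for j \<omega>
    by (induction j) (simp_all add: mult.assoc sgn_kform)
  have "DL \<omega> = dual_lefschetz K (D \<omega>) - D (dual_lefschetz K \<omega>) \<and>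
      kform K * DL \<omega> - DL (kform K * \<omega>) = D \<omega>"
  proof (induction \<omega> rule: lefschetz_induct)
    case (primitive i j k \<alpha>)
    have k: "(j + i) + k = half_dim K" using primitive(1) by simp
    have \<alpha>: "\<alpha> \<in> forms K k" "kform K ^ Suc (j + i) * \<alpha> = 0"
      using primitive(2) primitive_iff[OF k] by auto
    have "kform K ^ Suc (j + i) * D \<alpha> = 0"
      using \<alpha>(2) D_pow[of "Suc (j + i)" \<alpha>] D_zero by simp
    then obtain \<beta> \<gamma> where D\<alpha>: "D \<alpha> = \<beta> + kform K * \<gamma>"
      and \<beta>: "if j + i = 0 then \<beta> = 0 else \<beta> \<in> primitive K (Suc k)"
      and \<gamma>: "if k = 0 then \<gamma> = 0 else \<gamma> \<in> primitive K (k - 1)"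
      using primitive_step[OF D(3)[OF \<alpha>(1)] k] by metis
    \<comment> \<open>Since \<open>\<beta>\<close> has degree one more than \<open>\<alpha>\<close>, one power of \<open>\<kappa>\<close> less annihilates it; this settles the boundary cases.\<close>
    have \<beta>0: "kform K ^ l * \<beta> = 0" if "j + i \<le> l" for l
    proof (cases "j + i")
      case 0
      then show ?thesis using \<beta> by simp
    next
      case (Suc r)
      then have "kform K ^ (j + i) * \<beta> = 0" using \<beta> primitive_iff[of r "Suc k" \<beta>] k by simp
      moreover have "kform K ^ l * \<beta> = kform K ^ (l - (j + i)) * (kform K ^ (j + i) * \<beta>)"
        using that by (simp flip: mult.assoc power_add)
      ultimately show ?thesis by simp
    qed
    have refl\<beta>: "reflection (kform K ^ i' * \<beta>) =
        (refl_sign (Suc k) * (of_nat j' * (fact i' / fact j'))) *\<^sub>C (kform K ^ (j' - 1) * \<beta>)"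
      if "j' + i' = j + i" for i' j'
    proof (cases j')
      case 0
      then show ?thesis using that \<beta>0[of i'] by (simp add: reflection_zero)
    next
      case (Suc r)
      then have "\<beta> \<in> primitive K (Suc k)" using \<beta> that by (auto split: if_splits)
      then have "reflection (kform K ^ i' * \<beta>) = (refl_sign (Suc k) * (fact i' / fact r)) *\<^sub>C (kform K ^ r * \<beta>)"
        by (rule reflection_primitive[rotated]) (use that Suc k in simp)
      moreover have "of_nat j' * (fact i' / fact j') = (fact i' / fact r :: complex)"
        using Suc by (simp add: field_simps del: of_nat_Suc)
      ultimately show ?thesis using Suc by simp
    qed
    have refl\<gamma>: "reflection (kform K ^ Suc i' * \<gamma>) =
        (refl_sign (k - 1) * (of_nat (Suc i') * (fact i' / fact j'))) *\<^sub>C (kform K ^ j' * \<gamma>)"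
      if "j' + i' = j + i" for i' j'
    proof (cases k)
      case 0
      then show ?thesis using \<gamma> by (simp add: reflection_zero)
    next
      case (Suc r)
      then have "reflection (kform K ^ Suc i' * \<gamma>) =
          (refl_sign (k - 1) * (fact (Suc i') / fact j')) *\<^sub>C (kform K ^ j' * \<gamma>)"
        using \<gamma> that k by (intro reflection_primitive) auto
      then show ?thesis by (simp add: del: of_nat_Suc)
    qed
    \<comment> \<open>These two signs are the reason for the quadratic exponent in the Hodge map.\<close>
    have sign\<beta>: "(-1) ^ k * refl_sign k * refl_sign (Suc k) = -1"
    proof -
      have "k * (k + 1) div 2 + Suc k * (Suc k + 1) div 2 = Suc k * Suc k"
        by (subst div_add[symmetric]) (auto simp: algebra_simps)
      then have "(-1) ^ k * refl_sign k * refl_sign (Suc k) = (-1) ^ (k + Suc k * Suc k)"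
        by (simp only: refl_sign_def mult.assoc power_add[symmetric] add.assoc)
      then show ?thesis by (simp add: power_add minus_one_power_iff)
    qed
    have sign\<gamma>: "(-1) ^ k * refl_sign k * refl_sign (k - 1) = 1" if k0: "k \<noteq> 0"
    proof -
      obtain r where r: "k = Suc r" using k0 by (cases k) auto
      have "k * (k + 1) div 2 + r * (r + 1) div 2 = Suc r * Suc r"
        unfolding r by (subst div_add[symmetric]) (auto simp: algebra_simps)
      then have "(-1) ^ k * refl_sign k * refl_sign r = (-1) ^ (k + Suc r * Suc r)"
        by (simp only: refl_sign_def mult.assoc power_add[symmetric] add.assoc)
      then show ?thesis by (simp add: r power_add minus_one_power_iff)
    qed
    have DL: "DL (kform K ^ j' * \<alpha>) =
        (- of_nat j') *\<^sub>C (kform K ^ (j' - 1) * \<beta>) + of_nat (Suc i') *\<^sub>C (kform K ^ j' * \<gamma>)"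
      if ij: "j' + i' = j + i" for i' j'
    proof -
      have jik: "j' + i' + k = half_dim K" using ij k by simp
      have c\<beta>: "(-1) ^ k * (refl_sign k * (fact j' / fact i')) *
          (refl_sign (Suc k) * (of_nat j' * (fact i' / fact j'))) = - of_nat j'"
        using sign\<beta> by (simp add: field_simps)
      have c\<gamma>: "((-1) ^ k * (refl_sign k * (fact j' / fact i')) *
          (refl_sign (k - 1) * (of_nat (Suc i') * (fact i' / fact j')))) *\<^sub>C (kform K ^ j' * \<gamma>) =
          of_nat (Suc i') *\<^sub>C (kform K ^ j' * \<gamma>)"
      proof (cases "k = 0")
        case False
        then have "(-1) ^ k * (refl_sign k * (fact j' / fact i')) *
          (refl_sign (k - 1) * (of_nat (Suc i') * (fact i' / fact j'))) = of_nat (Suc i')"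
          using sign\<gamma> by (simp add: field_simps del: of_nat_Suc)
        then show ?thesis by simp
      qed (use \<gamma> in simp)
      have "kform K ^ i' * D \<alpha> = kform K ^ i' * \<beta> + kform K ^ Suc i' * \<gamma>"
        by (simp add: D\<alpha> distrib_left power_commutes flip: mult.assoc)
      then have "DL (kform K ^ j' * \<alpha>) =
          ((-1) ^ k * (refl_sign k * (fact j' / fact i'))) *\<^sub>C
            (reflection (kform K ^ i' * \<beta>) + reflection (kform K ^ Suc i' * \<gamma>))"
        by (simp add: DL_def sgn_pow sgn_on[OF \<alpha>(1)] mult_scaleC_right reflection_scale D_scale
            reflection_primitive[OF jik primitive(2)] scaleC_scaleC D_pow reflection_add)
      then show ?thesis
        unfolding refl\<beta>[OF ij] refl\<gamma>[OF ij] scaleC_add_right scaleC_scaleC c\<beta> c\<gamma> by simp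
    qed
    have "kform K ^ j * D \<alpha> = kform K ^ j * \<beta> + kform K ^ Suc j * \<gamma>"
      by (simp add: D\<alpha> distrib_left power_commutes flip: mult.assoc)
    then have Dj: "D (kform K ^ j * \<alpha>) = kform K ^ j * \<beta> + kform K ^ Suc j * \<gamma>"
      by (simp add: D_pow)
    have \<Lambda>\<beta>: "dual_lefschetz K (kform K ^ j * \<beta>) = (of_nat j * of_nat i) *\<^sub>C (kform K ^ (j - 1) * \<beta>)"
    proof (cases i)
      case 0
      then show ?thesis using \<beta>0[of j] by (simp add: \<Lambda>_zero)
    next
      case (Suc r)
      then show ?thesis using \<beta> k by (simp only: Suc, intro dual_lefschetz_primitive) auto
    qed
    have \<Lambda>\<gamma>: "dual_lefschetz K (kform K ^ Suc j * \<gamma>) = (of_nat (Suc j) * of_nat (Suc i)) *\<^sub>C (kform K ^ j * \<gamma>)"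
    proof (cases k)
      case 0
      then show ?thesis using \<gamma> by (simp add: \<Lambda>_zero)
    next
      case (Suc r)
      then have "\<gamma> \<in> primitive K (k - 1)" "Suc j + i + (k - 1) = half_dim K" using \<gamma> k by auto
      from dual_lefschetz_primitive[OF this(2,1)] show ?thesis by simp
    qed
    have D\<Lambda>: "D (dual_lefschetz K (kform K ^ j * \<alpha>)) =
        (of_nat j * of_nat (Suc i)) *\<^sub>C (kform K ^ (j - 1) * \<beta> + kform K ^ j * \<gamma>)"
    proof (cases j)
      case 0
      then show ?thesis using dual_lefschetz_primitive[OF primitive] by (simp add: D_zero)
    next
      case (Suc r)
      then have "kform K ^ (j - 1) * D \<alpha> = kform K ^ (j - 1) * \<beta> + kform K ^ j * \<gamma>"
        by (simp add: D\<alpha> distrib_left power_commutes flip: mult.assoc)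
      then show ?thesis
        unfolding dual_lefschetz_primitive[OF primitive] D_scale D_pow by simp
    qed
    have "dual_lefschetz K (D (kform K ^ j * \<alpha>)) - D (dual_lefschetz K (kform K ^ j * \<alpha>)) =
        (of_nat j * of_nat i - of_nat j * of_nat (Suc i)) *\<^sub>C (kform K ^ (j - 1) * \<beta>) +
        (of_nat (Suc j) * of_nat (Suc i) - of_nat j * of_nat (Suc i)) *\<^sub>C (kform K ^ j * \<gamma>)"
      unfolding Dj \<Lambda>_add \<Lambda>\<beta> \<Lambda>\<gamma> D\<Lambda> by (simp add: algebra_simps scaleC_add_right complex_vector.scale_left_diff_distrib)
    also have "\<dots> = DL (kform K ^ j * \<alpha>)"
      by (simp add: DL[OF refl] algebra_simps)
    finally have 1: "DL (kform K ^ j * \<alpha>) =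
        dual_lefschetz K (D (kform K ^ j * \<alpha>)) - D (dual_lefschetz K (kform K ^ j * \<alpha>))" by simp
    have DLS: "DL (kform K ^ Suc j * \<alpha>) =
        (- of_nat (Suc j)) *\<^sub>C (kform K ^ j * \<beta>) + of_nat i *\<^sub>C (kform K ^ Suc j * \<gamma>)"
    proof (cases i)
      case 0
      then show ?thesis using \<alpha>(2) \<beta>0[of j] by (simp add: DL_zero)
    next
      case (Suc r)
      then show ?thesis using DL[of "Suc j" r] by simp
    qed
    have L\<beta>: "of_nat j *\<^sub>C (kform K * (kform K ^ (j - 1) * \<beta>)) = of_nat j *\<^sub>C (kform K ^ j * \<beta>)"
      by (cases j) (simp_all add: mult.assoc)
    have "kform K * DL (kform K ^ j * \<alpha>) =
        (- of_nat j) *\<^sub>C (kform K ^ j * \<beta>) + of_nat (Suc i) *\<^sub>C (kform K ^ Suc j * \<gamma>)"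
      unfolding DL[OF refl] distrib_left mult_scaleC_right scaleC_minus_left mult_minus_right L\<beta>
      by (simp add: mult.assoc del: of_nat_Suc)
    then have "kform K * DL (kform K ^ j * \<alpha>) - DL (kform K ^ Suc j * \<alpha>) =
        (- of_nat j - - of_nat (Suc j)) *\<^sub>C (kform K ^ j * \<beta>) +
        (of_nat (Suc i) - of_nat i) *\<^sub>C (kform K ^ Suc j * \<gamma>)"
      unfolding DLS complex_vector.scale_left_diff_distrib by (simp add: algebra_simps)
    also have "\<dots> = D (kform K ^ j * \<alpha>)" by (simp add: Dj scaleC_one)
    finally show ?case using 1 by (simp add: mult.assoc)
  next
    case (add \<omega> \<nu>)
    then show ?case by (simp add: DL_add D_add \<Lambda>_add distrib_left algebra_simps)
  qed
  then show "DL \<omega> = dual_lefschetz K (D \<omega>) - D (dual_lefschetz K \<omega>)"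
    and "kform K * DL \<omega> - DL (kform K * \<omega>) = D \<omega>" by auto
qed

text \<open>
  Conjugation by the rotation is multiplication by \<open>c\<close> and the sign of the degree; the latter is just the
  sign that \<open>commutator_dual_lefschetz\<close> requires.
\<close>

lemma kahler_identity:
  assumes "kahler_operator c D"
  shows "hodge K (D (hodge K \<omega>)) = c *\<^sub>C (dual_lefschetz K (D \<omega>) - D (dual_lefschetz K \<omega>))"
    and "kform K * hodge K (D (hodge K \<omega>)) - hodge K (D (hodge K (kform K * \<omega>))) = c *\<^sub>C D \<omega>"
proof -
  have D: "clinear D" "\<And>\<omega>. D (kform K * \<omega>) = kform K * D \<omega>"
    "\<And>k \<omega>. \<omega> \<in> forms K k \<Longrightarrow> D \<omega> \<in> forms K (Suc k)"
    "\<And>\<omega>. rotation (D (rotation \<omega>)) = c *\<^sub>C D (sgn_deg \<omega>)"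
    using assms unfolding kahler_operator_def by auto
  have *: "hodge K (D (hodge K \<omega>)) = c *\<^sub>C reflection (D (reflection (sgn_deg \<omega>)))" for \<omega>
    using D(4)[of "reflection \<omega>"]
    by (simp add: hodge_eq reflection_scale sgn_reflection flip: rotation_reflection)
       (simp add: rotation_reflection reflection_scale)
  show "hodge K (D (hodge K \<omega>)) = c *\<^sub>C (dual_lefschetz K (D \<omega>) - D (dual_lefschetz K \<omega>))"
    unfolding * by (simp add: commutator_dual_lefschetz(1)[of D, OF D(1-3)])
  show "kform K * hodge K (D (hodge K \<omega>)) - hodge K (D (hodge K (kform K * \<omega>))) = c *\<^sub>C D \<omega>"
    unfolding * mult_scaleC_right complex_vector.scale_right_diff_distrib[symmetric]
    by (simp add: commutator_dual_lefschetz(2)[of D, OF D(1-3)])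
qed

text \<open>
  On forms of bidegree \<open>(a, b)\<close> the two rotations contribute \<open>\<i>\<close> to the powers \<open>a - b\<close> and
  \<open>(a + r) - (b + s)\<close>; the part that depends on the form is \<open>(-1)\<close> to the power \<open>a - b\<close>, the sign of the
  degree.
\<close>

lemma kahler_operatorI:
  assumes D: "clinear D" "\<And>\<omega>. D (kform K * \<omega>) = kform K * D \<omega>"
    and bi: "\<And>a b \<omega>. \<omega> \<in> biforms K (a, b) \<Longrightarrow> D \<omega> \<in> biforms K (a + r, b + s)"
    and rs: "r + s = 1"
  shows "kahler_operator (\<i> powi (int r - int s)) D"
  unfolding kahler_operator_def
proof (intro conjI allI ballI)
  show "D \<omega> \<in> forms K (Suc k)" if "\<omega> \<in> forms K k" for k \<omega>
    using that
  proof (induction rule: forms_biforms_induct)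
    case (biforms a b \<omega>)
    have "(a + r) + (b + s) = Suc k" using biforms(1) rs by simp
    then show ?case using biforms_forms[OF bi[OF biforms(2)]] by simp
  qed (simp add: clinear_add[OF D(1)] csubspace_add[OF deg.subspace])
  show "rotation (D (rotation \<omega>)) = (\<i> powi (int r - int s)) *\<^sub>C D (sgn_deg \<omega>)" for \<omega>
  proof (induction \<omega> rule: bideg.homogeneous_induct)
    case (homogeneous p \<omega>)
    obtain a b where p: "p = (a, b)" by (cases p)
    have e: "int (a + r) - int (b + s) = (int r - int s) + (int a - int b)" by simp
    have "\<i> powi (int a - int b) * \<i> powi (int (a + r) - int (b + s)) = \<i> powi (int r - int s) * (-1) ^ (a + b)"
      unfolding e by (subst power_int_add) (simp_all add: i_powi_square minus_one_powi_diff mult.left_commute)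
    then show ?case
      using homogeneous rotation_on[OF bi[of \<omega> a b]] p
      by (simp add: rotation_on sgn_on[OF biforms_forms] clinear_scale[OF D(1)] rotation_scale scaleC_scaleC)
  qed (simp add: rotation_add sgn_add clinear_add[OF D(1)] scaleC_add_right)
qed (use D in auto)

lemma del_kform: "del K (kform K) = 0" and delbar_kform: "delbar K (kform K) = 0"
proof -
  have "del K (kform K) + delbar K (kform K) = 0 + 0"
    using kform_closed by (simp add: diff_del_delbar)
  from bideg_split[OF this del_biforms[OF kform_bidegree] csubspace_0[OF biforms_subspace]
      delbar_biforms[OF kform_bidegree] csubspace_0[OF biforms_subspace]]
  show "del K (kform K) = 0" "delbar K (kform K) = 0" by auto
qed

lemma kahler_operator_del: "kahler_operator \<i> (del K)"
  using kahler_operatorI[of "del K" 1 0] del_linear del_biforms sgn_kform[of 1]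
  by (simp add: del_mult del_kform sgn_base one_base)

lemma kahler_operator_delbar: "kahler_operator (- \<i>) (delbar K)"
  using kahler_operatorI[of "delbar K" 0 1] delbar_linear delbar_biforms sgn_kform[of 1]
  by (simp add: delbar_mult delbar_kform sgn_base one_base)

text \<open>
  Multiplication by a one-form from the right commutes with \<open>L\<close>, a multiplication from the left.  These
  operators make up the connection part of a twisted differential.
\<close>

lemma kahler_operator_mult:
  assumes "\<xi> \<in> biforms K (r, s)" "r + s = 1"
  shows "kahler_operator (\<i> powi (int r - int s)) (\<lambda>\<omega>. sgn_deg \<omega> * \<xi>)"
proof (rule kahler_operatorI[OF _ _ _ assms(2)])
  show "clinear (\<lambda>\<omega>. sgn_deg \<omega> * \<xi>)" by (rule clinear_compose[OF mult_linear_left sgn_linear])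
  show "sgn_deg \<omega> * \<xi> \<in> biforms K (a + r, b + s)" if "\<omega> \<in> biforms K (a, b)" for a b \<omega>
    by (rule biforms_mult[OF sgn_biforms[OF that] assms(1)])
qed (simp add: sgn_kform mult.assoc)

section \<open>The integral\<close>

lemma vol_linear: "clinear (vol K)"
  unfolding vol_def[abs_def] by (rule clinear_compose[OF hodge_linear deg.component_linear])

lemmas vol_add = clinear_add[OF vol_linear] and vol_scale = clinear_scale[OF vol_linear]

lemma vol_lower: "\<omega> \<in> forms K k \<Longrightarrow> k \<noteq> 2 * half_dim K \<Longrightarrow> vol K \<omega> = 0"
  by (simp add: vol_def deg.component_on hodge_zero)

lemma top_form:
  assumes "\<omega> \<in> forms K (2 * half_dim K)"
  obtains m where "m \<in> base K" "\<omega> = kform K ^ half_dim K * m"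
  using lefschetz_surjective[of \<omega> 0 "half_dim K"] assms by auto

lemma vol_base: "vol K \<omega> \<in> base K"
proof -
  let ?n = "half_dim K"
  obtain m where m: "m \<in> base K" and \<omega>: "component (forms K) (2 * ?n) \<omega> = kform K ^ ?n * m"
    using top_form[OF deg.component_mem] by blast
  have "kform K ^ Suc ?n * m \<in> forms K (2 + 2 * ?n)"
    using kform_power_forms[OF m, of "Suc ?n"] by simp
  then have "m \<in> primitive K 0" using m primitive_iff[of ?n 0] forms_above_top by auto
  then have "reflection (kform K ^ ?n * m) = (refl_sign 0 * (fact ?n / fact 0)) *\<^sub>C (kform K ^ 0 * m)"
    by (rule reflection_primitive[rotated]) simp
  moreover have "rotation (kform K ^ ?n * m) = kform K ^ ?n * m"
    using rotation_on[OF kform_power_biforms[OF base_biforms[OF m]]] by (simp add: scaleC_one)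
  ultimately show ?thesis
    unfolding vol_def hodge_eq \<omega> using csubspace_scale[OF deg.subspace m] by simp
qed

text \<open>By hard Lefschetz, top forms are multiples of \<open>\<kappa>\<^sup>n\<close> by elements of the base.\<close>

lemma top_forms_biforms: "\<omega> \<in> forms K (2 * half_dim K) \<Longrightarrow> \<omega> \<in> biforms K (half_dim K, half_dim K)"
  using kform_power_biforms[OF base_biforms, of _ "half_dim K"] by (elim top_form) simp

lemma state_add: "is_state K \<phi> \<Longrightarrow> x \<in> base K \<Longrightarrow> y \<in> base K \<Longrightarrow> \<phi> (x + y) = \<phi> x + \<phi> y"
  unfolding is_state_def by blast

lemma state_zero: "is_state K \<phi> \<Longrightarrow> \<phi> 0 = 0"
  using state_add[of \<phi> 0 0] csubspace_0[OF deg.subspace] by simp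

lemma state_vol_additive: "is_state K \<phi> \<Longrightarrow> additive (\<lambda>\<omega>. \<phi> (vol K \<omega>))"
  by (rule additive.intro) (simp add: vol_add state_add vol_base)

text \<open>
  A bihomogeneous form whose image under one component of \<open>d\<close> is a nonzero top form is annihilated by the other
  component, because all top forms have bidegree \<open>(n, n)\<close>.
\<close>

lemma integral_partial:
  assumes "is_state K \<phi>" "closed_integral K \<phi>"
  shows "\<phi> (vol K (del K \<omega>)) = 0" "\<phi> (vol K (delbar K \<omega>)) = 0"
proof -
  interpret I: additive "\<lambda>\<omega>. \<phi> (vol K \<omega>)" by (rule state_vol_additive[OF assms(1)])
  have off: "\<nu> = 0" if "\<nu> \<in> biforms K (a, b)" "a + b = 2 * half_dim K" "a \<noteq> half_dim K" for \<nu> a b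
    using top_forms_biforms[of \<nu>] biforms_forms[OF that(1)] that bideg_disjoint[of \<nu> "(a, b)"] by auto
  have "\<phi> (vol K (del K \<omega>)) = 0 \<and> \<phi> (vol K (delbar K \<omega>)) = 0"
  proof (induction \<omega> rule: bideg.homogeneous_induct)
    case (homogeneous p \<omega>)
    obtain a b where p: "p = (a, b)" by (cases p)
    have \<omega>: "\<omega> \<in> biforms K (a, b)" using homogeneous p by simp
    note dels = del_biforms[OF \<omega>] delbar_biforms[OF \<omega>]
    show ?case
    proof (cases "a + b + 1 = 2 * half_dim K")
      case True
      then have 0: "\<phi> (vol K (diff K \<omega>)) = 0"
        using assms(2) biforms_forms[OF \<omega>] unfolding closed_integral_def by blast
      have "del K \<omega> = 0 \<or> delbar K \<omega> = 0"
        using off[OF dels(1)] off[OF dels(2)] True by linarith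
      then show ?thesis using 0 I.zero by (auto simp: diff_del_delbar)
    next
      case False
      have "del K \<omega> \<in> forms K (a + b + 1)" "delbar K \<omega> \<in> forms K (a + b + 1)"
        using dels[THEN biforms_forms] by simp_all
      then show ?thesis using vol_lower[OF _ False] state_zero[OF assms(1)] by simp
    qed
  qed (simp add: del_add delbar_add I.add)
  then show "\<phi> (vol K (del K \<omega>)) = 0" "\<phi> (vol K (delbar K \<omega>)) = 0" by auto
qed

text \<open>
  Every form is the Hodge dual of some \<open>\<omega>\<^sup>*\<close>, and pairing with \<open>\<omega>\<close> gives its positive square norm.
\<close>

lemma integral_nondegenerate:
  assumes "positive_definite K" "is_state K \<phi>" "\<And>\<omega>. \<phi> (vol K (\<omega> * \<eta>)) = 0"
  shows "\<eta> = 0"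
proof -
  define \<omega> where "\<omega> = star K (hodge K (sgn_deg \<eta>))"
  have \<eta>: "hodge K (star K \<omega>) = \<eta>" by (simp add: \<omega>_def star_star hodge_hodge sgn_sgn)
  have "\<omega> = 0"
  proof (rule ccontr)
    assume "\<omega> \<noteq> 0"
    then have "vol K (\<omega> * hodge K (star K \<omega>)) \<in> positive_cone K"
      using assms(1) unfolding positive_definite_def by blast
    then obtain r where "r > 0" "\<phi> (vol K (\<omega> * \<eta>)) = complex_of_real r"
      using assms(2) \<eta> unfolding is_state_def by metis
    then show False using assms(3)[of \<omega>] by simp
  qed
  then show ?thesis using \<eta> by (simp add: star_zero hodge_zero)
qed

end

section \<open>Operators on forms with values in a module\<close>

lemma tensor_lift_eq:
  fixes B :: "'x::complex_vector \<Rightarrow> 'y::complex_vector \<Rightarrow> 'z::complex_vector"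
  assumes "is_tensor_product X Y R ra la t"
    and "\<And>x x' y. x \<in> X \<Longrightarrow> x' \<in> X \<Longrightarrow> y \<in> Y \<Longrightarrow> B (x + x') y = B x y + B x' y"
    and "\<And>x y y'. x \<in> X \<Longrightarrow> y \<in> Y \<Longrightarrow> y' \<in> Y \<Longrightarrow> B x (y + y') = B x y + B x y'"
    and "\<And>x r y. x \<in> X \<Longrightarrow> r \<in> R \<Longrightarrow> y \<in> Y \<Longrightarrow> B (ra x r) y = B x (la r y)"
  shows "additive (tensor_lift X Y t B)"
    and "x \<in> X \<Longrightarrow> y \<in> Y \<Longrightarrow> tensor_lift X Y t B (t x y) = B x y"
proof -
  have "\<exists>!T. additive T \<and> (\<forall>x\<in>X. \<forall>y\<in>Y. T (t x y) = B x y)"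
    by (rule tensor_lift_unique_existence[OF assms(1)]) (fact assms(2-4))+
  then have "additive (tensor_lift X Y t B) \<and> (\<forall>x\<in>X. \<forall>y\<in>Y. tensor_lift X Y t B (t x y) = B x y)"
    unfolding tensor_lift_def by (rule theI')
  then show "additive (tensor_lift X Y t B)"
    and "x \<in> X \<Longrightarrow> y \<in> Y \<Longrightarrow> tensor_lift X Y t B (t x y) = B x y" by auto
qed

lemma tensor_product_relations:
  assumes "is_tensor_product X Y R ra la t" "u \<in> tensor_relations X Y R ra la"
  shows "frag_eval t u = 0"
  using assms unfolding is_tensor_product_def by auto

lemma tensor_product_induct [consumes 1, case_names zero tensor diff]:
  assumes t: "is_tensor_product X Y R ra la t"
    and "P 0" "\<And>x y. x \<in> X \<Longrightarrow> y \<in> Y \<Longrightarrow> P (t x y)" "\<And>s s'. P s \<Longrightarrow> P s' \<Longrightarrow> P (s - s')"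
  shows "P s"
proof -
  have "s \<in> frag_eval t ` {u. Poly_Mapping.keys u \<subseteq> X \<times> Y}"
    using t unfolding is_tensor_product_def by simp
  then obtain u where u: "Poly_Mapping.keys u \<subseteq> X \<times> Y" and s: "s = frag_eval t u" by blast
  have "P (frag_eval t u)"
    using u by (induction u rule: frag_induction) (auto simp: assms frag_eval_diff)
  then show ?thesis by (simp add: s)
qed

context vector_bundle
begin

lemma tens_add_left: "tens E (\<omega> + \<omega>') f = tens E \<omega> f + tens E \<omega>' f"
  and tens_add_right: "tens E \<omega> (f + f') = tens E \<omega> f + tens E \<omega> f'"
  and tens_balanced: "m \<in> base C \<Longrightarrow> tens E (\<omega> * m) f = tens E \<omega> (lact E m f)"
proof -
  note rel = tensor_product_relations[OF tens]
  show "tens E (\<omega> + \<omega>') f = tens E \<omega> f + tens E \<omega>' f"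
    using rel[OF tensor_relations.add_left[of \<omega> UNIV \<omega>' f UNIV]] by (simp add: frag_eval_diff frag_eval_add diff_diff_eq)
  show "tens E \<omega> (f + f') = tens E \<omega> f + tens E \<omega> f'"
    using rel[OF tensor_relations.add_right[of \<omega> UNIV f UNIV f']] by (simp add: frag_eval_diff frag_eval_add diff_diff_eq)
  show "tens E (\<omega> * m) f = tens E \<omega> (lact E m f)" if "m \<in> base C"
    using rel[OF tensor_relations.balanced[of \<omega> UNIV m "base C" f UNIV]] that by (simp add: frag_eval_diff)
qed

lemma tens_scale: "tens E (c *\<^sub>C \<omega>) f = c *\<^sub>C tens E \<omega> f"
  using tens unfolding is_tensor_product_def by simp

lemma tens_linear: "clinear (\<lambda>\<omega>. tens E \<omega> f)"
  by (rule clinearI) (simp_all add: tens_add_left tens_scale)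

lemmas tens_zero = additive.zero[OF clinear_additive[OF tens_linear]]
  and tens_minus = additive.minus[OF clinear_additive[OF tens_linear]]
  and tens_diff = additive.diff[OF clinear_additive[OF tens_linear]]

text \<open>
  Negatives are covered by the first case because \<open>-(\<omega> \<otimes> f) = (-\<omega>) \<otimes> f\<close>.
\<close>

lemma tens_induct [case_names tens add]:
  assumes "\<And>\<omega> f. P (tens E \<omega> f)" "\<And>x y. P x \<Longrightarrow> P y \<Longrightarrow> P (x + y)"
  shows "P x"
proof -
  have "P x \<and> P (- x)"
  proof (induction x rule: tensor_product_induct[OF tens, consumes 0, case_names zero tensor diff])
    case zero
    then show ?case using assms(1)[of 0 undefined] by (simp add: tens_zero)
  next
    case (tensor \<omega> f)
    then show ?case using assms(1)[of \<omega> f] assms(1)[of "- \<omega>" f] by (simp add: tens_minus)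
  next
    case (diff x y)
    then show ?case using assms(2)[of x "- y"] assms(2)[of "- x" y] by simp
  qed
  then show ?thesis by blast
qed

lemma lift_tens:
  assumes "\<And>\<omega> \<omega>' f. B (\<omega> + \<omega>') f = B \<omega> f + B \<omega>' f" "\<And>\<omega> f f'. B \<omega> (f + f') = B \<omega> f + B \<omega> f'"
    "\<And>\<omega> m f. m \<in> base C \<Longrightarrow> B (\<omega> * m) f = B \<omega> (lact E m f)"
  shows lift_tens_additive: "additive (lift_tens E B)"
    and lift_tens_tens: "lift_tens E B (tens E \<omega> f) = B \<omega> f"
  unfolding lift_tens_def using tensor_lift_eq[OF tens, of B] assms by simp_all

text \<open>
  Linearity over the base from the right is what lets an operator on forms act on the first leg of the
  tensor product.
\<close>

definition right_module_map :: "('w \<Rightarrow> 'w) \<Rightarrow> bool"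
  where "right_module_map A \<longleftrightarrow> clinear A \<and> (\<forall>m\<in>base C. \<forall>\<omega>. A (\<omega> * m) = A \<omega> * m)"

lemma right_module_map_mult: "right_module_map ((*) \<omega>)"
  by (simp add: right_module_map_def mult_linear_right mult.assoc)

lemma right_module_map_sgn: "right_module_map sgn_deg"
  by (simp add: right_module_map_def sgn_linear sgn_mult sgn_base)

lemma map_tens:
  assumes "right_module_map A"
  shows map_tens_additive: "additive (map_tens E A)"
    and map_tens_tens: "map_tens E A (tens E \<omega> f) = tens E (A \<omega>) f"
proof -
  have A: "A (\<omega> + \<omega>') = A \<omega> + A \<omega>'" "m \<in> base C \<Longrightarrow> A (\<omega> * m) = A \<omega> * m" for \<omega> \<omega>' m
    using assms by (simp_all add: right_module_map_def clinear_add)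
  show "additive (map_tens E A)" "map_tens E A (tens E \<omega> f) = tens E (A \<omega>) f"
    unfolding map_tens_def
    by (rule lift_tens_additive, simp_all add: A tens_add_left tens_add_right tens_balanced)
       (subst lift_tens_tens, simp_all add: A tens_add_left tens_add_right tens_balanced)
qed

lemmas map_tens_add = additive.add[OF map_tens_additive]

lemma map_tens_sgn_sgn: "map_tens E sgn_deg (map_tens E sgn_deg x) = x"
  by (induction x rule: tens_induct)
     (simp_all add: map_tens_tens right_module_map_sgn sgn_sgn map_tens_add)

lemmas wedge_tens = map_tens_tens[OF right_module_map_mult]
  and wedge_add = map_tens_add[OF right_module_map_mult]

lemma wedge_add_left: "wedge_left E (\<omega> + \<omega>') x = wedge_left E \<omega> x + wedge_left E \<omega>' x"
proof (induction x rule: tens_induct)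
  case (tens \<nu> f)
  show ?case unfolding wedge_tens by (simp add: distrib_right tens_add_left)
qed (simp only: wedge_add add_ac)

lemma wedge_scale_left: "wedge_left E (c *\<^sub>C \<omega>) x = c *\<^sub>C wedge_left E \<omega> x"
proof (induction x rule: tens_induct)
  case (tens \<nu> f)
  show ?case unfolding wedge_tens by (simp add: mult_scaleC_left tens_scale)
qed (simp only: wedge_add scaleC_add_right)

lemma wedge_mult: "wedge_left E (\<omega> * \<nu>) x = wedge_left E \<omega> (wedge_left E \<nu> x)"
proof (induction x rule: tens_induct)
  case (tens \<eta> f)
  show ?case unfolding wedge_tens by (simp add: mult.assoc)
qed (simp only: wedge_add)

text \<open>
  The two components of the differential, and with them the two parts of a connection, are treated
  alike from here on; \<open>\<delta>\<close> stands for either component and \<open>D\<close> for the corresponding part.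
\<close>

definition sgn_derivation :: "('w \<Rightarrow> 'w) \<Rightarrow> bool"
  where "sgn_derivation \<delta> \<longleftrightarrow> clinear \<delta> \<and> (\<forall>\<omega> \<nu>. \<delta> (\<omega> * \<nu>) = \<delta> \<omega> * \<nu> + sgn_deg \<omega> * \<delta> \<nu>)"

definition connection_along :: "('w \<Rightarrow> 'w) \<Rightarrow> ('f \<Rightarrow> 't) \<Rightarrow> bool"
  where "connection_along \<delta> D \<longleftrightarrow> sgn_derivation \<delta> \<and> additive D \<and>
    (\<forall>m\<in>base C. \<forall>f. D (lact E m f) = tens E (\<delta> m) f + wedge_left E m (D f))"

text \<open>
  The connection is not linear over the base, but the failures of the two summands to be balanced
  cancel.
\<close>

lemma leibniz_extension:
  assumes "connection_along \<delta> D"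
  shows leibniz_extension_additive: "additive (leibniz_extension C E \<delta> D)"
    and leibniz_extension_tens: "leibniz_extension C E \<delta> D (tens E \<omega> f) =
      tens E (\<delta> \<omega>) f + wedge_left E (sgn_deg \<omega>) (D f)"
proof -
  have \<delta>: "\<delta> (\<omega> + \<nu>) = \<delta> \<omega> + \<delta> \<nu>" "\<delta> (\<omega> * \<nu>) = \<delta> \<omega> * \<nu> + sgn_deg \<omega> * \<delta> \<nu>"
    and D: "D (f + g) = D f + D g" "m \<in> base C \<Longrightarrow> D (lact E m f) = tens E (\<delta> m) f + wedge_left E m (D f)"
    for \<omega> \<nu> m f g
    using assms unfolding connection_along_def sgn_derivation_def
    by (blast intro: clinear_add additive.add)+
  let ?B = "\<lambda>\<omega> f. tens E (\<delta> \<omega>) f + wedge_left E (sgn_deg \<omega>) (D f)"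
  let ?spec = "\<lambda>T. additive T \<and> (\<forall>k. \<forall>\<omega>\<in>forms C k. \<forall>f.
    T (tens E \<omega> f) = tens E (\<delta> \<omega>) f + (-1) ^ k *\<^sub>C wedge_left E \<omega> (D f))"
  have B: "?B (\<omega> + \<omega>') f = ?B \<omega> f + ?B \<omega>' f" "?B \<omega> (f + f') = ?B \<omega> f + ?B \<omega> f'"
    "m \<in> base C \<Longrightarrow> ?B (\<omega> * m) f = ?B \<omega> (lact E m f)" for \<omega> \<omega>' f f' m
    by (simp_all add: \<delta> D tens_add_left tens_add_right sgn_add wedge_add_left wedge_add
        sgn_mult sgn_base tens_balanced wedge_tens wedge_mult algebra_simps)
  have L: "additive (lift_tens E ?B)" "lift_tens E ?B (tens E \<omega> f) = ?B \<omega> f" for \<omega> f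
    using lift_tens[of ?B, OF B] by blast+
  have spec: "?spec (lift_tens E ?B)"
    using L by (auto simp: sgn_on wedge_scale_left)
  have uniq: "T = lift_tens E ?B" if T: "?spec T" for T
  proof
    fix x
    have T_add: "T (x + y) = T x + T y" for x y using T by (blast intro: additive.add)
    have "T (tens E \<omega> f) = ?B \<omega> f" for \<omega> f
    proof (induction \<omega> rule: deg.homogeneous_induct)
      case (homogeneous k \<omega>)
      then show ?case using T by (simp add: sgn_on wedge_scale_left)
    next
      case (add \<omega> \<omega>')
      then show ?case unfolding B(1) tens_add_left T_add by simp
    qed
    then show "T x = lift_tens E ?B x"
      by (induction x rule: tens_induct) (simp_all add: L(2) T_add additive.add[OF L(1)])
  qed
  have "leibniz_extension C E \<delta> D = lift_tens E ?B"
    unfolding leibniz_extension_def by (rule the_equality) (rule spec, rule uniq)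
  then show "additive (leibniz_extension C E \<delta> D)" "leibniz_extension C E \<delta> D (tens E \<omega> f) = ?B \<omega> f"
    using L by simp_all
qed

lemma forms_tensor_sum_list:
  assumes "x \<in> forms_tensor E V" "csubspace V"
  obtains xs where "x = sum_list (map (\<lambda>p. tens E (fst p) (snd p)) xs)" "\<And>p. p \<in> set xs \<Longrightarrow> fst p \<in> V"
proof -
  have "\<exists>xs. x = sum_list (map (\<lambda>p. tens E (fst p) (snd p)) xs) \<and> (\<forall>p\<in>set xs. fst p \<in> V)"
    using assms(1) unfolding forms_tensor_def
  proof (induction rule: complex_vector.span_induct_alt)
    case base
    show ?case by (rule exI[of _ "[]"]) simp
  next
    case (step c y x)
    then obtain \<omega> f xs where "\<omega> \<in> V" "y = tens E \<omega> f" "\<forall>p\<in>set xs. fst p \<in> V"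
      "x = sum_list (map (\<lambda>p. tens E (fst p) (snd p)) xs)" by blast
    then show ?case
      by (intro exI[of _ "(c *\<^sub>C \<omega>, f) # xs"]) (simp add: tens_scale csubspace_scale[OF assms(2)])
  qed
  then show ?thesis using that by blast
qed

lemma forms_tensor_induct [consumes 2, case_names tens add]:
  assumes "x \<in> forms_tensor E V" "csubspace V"
    "\<And>\<omega> f. \<omega> \<in> V \<Longrightarrow> P (tens E \<omega> f)" "\<And>x y. P x \<Longrightarrow> P y \<Longrightarrow> P (x + y)"
  shows "P x"
proof -
  obtain xs where x: "x = sum_list (map (\<lambda>p. tens E (fst p) (snd p)) xs)" "\<And>p. p \<in> set xs \<Longrightarrow> fst p \<in> V"
    using forms_tensor_sum_list[OF assms(1,2)] by metis
  have "P 0" using assms(3)[OF csubspace_0[OF assms(2)], of undefined] by (simp add: tens_zero)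
  have "P (sum_list (map (\<lambda>p. tens E (fst p) (snd p)) xs))"
    using x(2) by (induction xs) (auto intro: assms(3,4) \<open>P 0\<close>)
  then show ?thesis by (simp add: x(1))
qed

text \<open>
  The coordinates of a retract of a free module, with the images of the standard basis.
\<close>

lemma dual_basis:
  obtains N \<psi> e where "\<And>i. i < N \<Longrightarrow> \<psi> i \<in> dual_module C E" "\<And>f. f = (\<Sum>i<(N::nat). lact E (\<psi> i f) (e i))"
proof -
  obtain N s r where *: "\<forall>f. s f \<in> free_module (base C) N" "\<forall>f g. s (f + g) = s f + s g"
      "\<forall>m\<in>base C. \<forall>f. s (lact E m f) = (\<lambda>i. m * s f i)"
      "\<forall>v\<in>free_module (base C) N. \<forall>w\<in>free_module (base C) N. r (v + w) = r v + r w"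
      "\<forall>m\<in>base C. \<forall>v\<in>free_module (base C) N. r (\<lambda>i. m * v i) = lact E m (r v)"
      "\<forall>f. r (s f) = f"
    using projective unfolding fg_projective_def by (elim exE conjE)
  note s = *(1,2)[rule_format] *(3)[rule_format] and r = *(4,5)[rule_format] and rs = *(6)[rule_format]
  have base0: "0 \<in> base C" by (rule csubspace_0[OF deg.subspace])
  define e where "e i = r (\<lambda>j. if j = i then 1 else 0)" for i :: nat
  have "r (\<lambda>j. if j < M then v j else 0) = (\<Sum>i<M. lact E (v i) (e i))"
    if v: "v \<in> free_module (base C) N" and "M \<le> N" for v M
    using that(2)
  proof (induction M)
    case 0
    have "(\<lambda>j. 0) \<in> free_module (base C) N" by (simp add: free_module_def base0)
    from r(1)[OF this this] show ?case by (simp add: plus_fun_def)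
  next
    case (Suc M)
    have vM: "v M \<in> base C" using v Suc.prems by (simp add: free_module_def)
    have mem: "(\<lambda>j. if j < M then v j else 0) \<in> free_module (base C) N"
      "(\<lambda>j. if j = M then 1 else 0) \<in> free_module (base C) N"
      "(\<lambda>j. v M * (if j = M then 1 else 0)) \<in> free_module (base C) N"
      using v Suc.prems vM by (auto simp: free_module_def base0 one_base)
    have "(\<lambda>j. if j < Suc M then v j else 0) =
        (\<lambda>j. if j < M then v j else 0) + (\<lambda>j. v M * (if j = M then 1 else 0))"
      by (auto simp: fun_eq_iff less_Suc_eq)
    then show ?case
      using Suc by (simp only: r(1)[OF mem(1,3)] r(2)[OF vM mem(2)]) (simp add: e_def)
  qed
  from this[OF s(1) order_refl]
  have "r (\<lambda>j. if j < N then s f j else 0) = (\<Sum>i<N. lact E (s f i) (e i))" for f .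
  moreover have "(\<lambda>j. if j < N then s f j else 0) = s f" for f
    using s(1)[of f] by (auto simp: free_module_def fun_eq_iff)
  ultimately have "f = (\<Sum>i<N. lact E (s f i) (e i))" for f using rs by simp
  moreover have "(\<lambda>f. s f i) \<in> dual_module C E" if "i < N" for i
    using s that by (simp add: dual_module_def additive_def free_module_def)
  ultimately show ?thesis using that[of N "\<lambda>i f. s f i" e] by blast
qed

text \<open>
  Expanding the second leg in a dual basis recovers \<open>x\<close> from its contractions.
\<close>

lemma dual_separates:
  assumes "\<And>\<psi>. \<psi> \<in> dual_module C E \<Longrightarrow> lift_tens E (\<lambda>\<omega> f. \<omega> * \<psi> f) x = 0"
  shows "x = 0"
proof -
  obtain N \<psi> e where \<psi>: "\<And>i. i < N \<Longrightarrow> \<psi> i \<in> dual_module C E"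
    and f: "\<And>f. f = (\<Sum>i<(N::nat). lact E (\<psi> i f) (e i))" using dual_basis by metis
  have lift: "additive (lift_tens E (\<lambda>\<omega> f. \<omega> * \<psi> i f))"
    "lift_tens E (\<lambda>\<omega> f. \<omega> * \<psi> i f) (tens E \<omega> g) = \<omega> * \<psi> i g" if "i < N" for i \<omega> g
    using \<psi>[OF that]
    by (intro lift_tens; simp add: dual_module_def additive.add distrib_left distrib_right mult.assoc)+
  have "x = (\<Sum>i<N. tens E (lift_tens E (\<lambda>\<omega> f. \<omega> * \<psi> i f) x) (e i))"
  proof (induction x rule: tens_induct)
    case (tens \<omega> g)
    have add: "additive (tens E \<omega>)" by (simp add: additive_def tens_add_right)
    have "tens E \<omega> g = (\<Sum>i<N. tens E \<omega> (lact E (\<psi> i g) (e i)))"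
      by (subst f[of g]) (rule additive.sum[OF add])
    also have "\<dots> = (\<Sum>i<N. tens E (\<omega> * \<psi> i g) (e i))"
      using \<psi> by (intro sum.cong) (auto simp: dual_module_def tens_balanced)
    also have "\<dots> = (\<Sum>i<N. tens E (lift_tens E (\<lambda>\<omega> f. \<omega> * \<psi> i f) (tens E \<omega> g)) (e i))"
      by (intro sum.cong) (auto simp: lift)
    finally show ?case .
  next
    case (add x y)
    then show ?case
      by (simp add: additive.add[OF lift(1)] tens_add_left sum.distrib)
  qed
  then show ?thesis using \<psi> assms by (simp add: tens_zero)
qed

end

section \<open>The sesquilinear pairing and the Chern connection\<close>

context hermitian_holomorphic_bundle
begin

abbreviation pairing :: "'t \<Rightarrow> 't \<Rightarrow> 'w"
  where "pairing \<equiv> sesquilinear_pairing C E"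

lemma herm_dual: "herm E g \<in> dual_module C E"
  using herm_bij by (auto simp: bij_betw_def)

lemma herm_base: "herm E g f \<in> base C"
  and herm_add_right: "herm E g (f + f') = herm E g f + herm E g f'"
  and herm_lact_right: "m \<in> base C \<Longrightarrow> herm E g (lact E m f) = m * herm E g f"
  using herm_dual[of g] by (auto simp: dual_module_def additive.add)

lemma herm_add_left: "herm E (g + g') f = herm E g f + herm E g' f"
  using conj_linear_add[OF herm_conj_linear] by simp

lemma herm_lact_left: "m \<in> base C \<Longrightarrow> herm E (lact E m g) f = herm E g f * star C m"
  using herm_right_module_map[OF star_forms[of m 0], of g] by (simp add: star_star)

lemma pairing_inner_lift:
  shows "additive (lift_tens E (\<lambda>\<nu> g. \<omega> * herm E g f * star C \<nu>))"
    and "lift_tens E (\<lambda>\<nu> g. \<omega> * herm E g f * star C \<nu>) (tens E \<nu> g) = \<omega> * herm E g f * star C \<nu>"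
  by (intro lift_tens;
      simp add: star_add herm_add_left distrib_left distrib_right herm_lact_left star_mult_base_right mult.assoc)+

lemma pairing_tens_left:
  "additive (\<lambda>x. pairing x y)"
  "pairing (tens E \<omega> f) y = lift_tens E (\<lambda>\<nu> g. \<omega> * herm E g f * star C \<nu>) y"
proof -
  let ?B = "\<lambda>\<omega> f. lift_tens E (\<lambda>\<nu> g. \<omega> * herm E g f * star C \<nu>) y"
  have "?B (\<omega> + \<omega>') f = ?B \<omega> f + ?B \<omega>' f \<and> ?B \<omega> (f + f') = ?B \<omega> f + ?B \<omega> f' \<and>
      (m \<in> base C \<longrightarrow> ?B (\<omega> * m) f = ?B \<omega> (lact E m f))" for \<omega> \<omega>' f f' m
  proof (induction y rule: tens_induct)
    case (tens \<nu> g)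
    show ?case unfolding pairing_inner_lift
      by (simp add: herm_add_right herm_lact_right distrib_left distrib_right mult.assoc)
  next
    case (add x y)
    then show ?case unfolding additive.add[OF pairing_inner_lift(1)] by (auto simp only: add_ac)
  qed
  then show "additive (\<lambda>x. pairing x y)" "pairing (tens E \<omega> f) y = ?B \<omega> f"
    unfolding sesquilinear_pairing_def by (intro lift_tens; blast)+
qed

lemmas pairing_add_left = additive.add[OF pairing_tens_left(1)]

lemma pairing_tens: "pairing (tens E \<omega> f) (tens E \<nu> g) = \<omega> * herm E g f * star C \<nu>"
  by (simp add: pairing_tens_left pairing_inner_lift)

lemma pairing_add_right: "pairing x (y + z) = pairing x y + pairing x z"
  by (induction x rule: tens_induct)
     (simp_all add: pairing_tens_left(2) additive.add[OF pairing_inner_lift(1)] pairing_add_left)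

lemma pairing_wedge_left: "pairing (wedge_left E \<omega> x) y = \<omega> * pairing x y"
proof (induction x rule: tens_induct)
  case (tens \<nu> f)
  show ?case
    by (induction y rule: tens_induct)
       (simp_all add: wedge_tens pairing_tens pairing_add_right distrib_left mult.assoc)
qed (simp add: wedge_add pairing_add_left distrib_left)

lemma pairing_tens_left_one: "pairing (tens E \<omega> f) y = \<omega> * pairing (tens E 1 f) y"
  using pairing_wedge_left[of \<omega> "tens E 1 f" y] by (simp add: wedge_tens)

lemma pairing_tens_right_one: "pairing x (tens E \<nu> g) = pairing x (tens E 1 g) * star C \<nu>"
  by (induction x rule: tens_induct)
     (simp_all add: pairing_tens pairing_add_left distrib_right star_one)

lemma star_sgn: "star C (sgn_deg \<omega>) = sgn_deg (star C \<omega>)"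
proof (induction \<omega> rule: deg.homogeneous_induct)
  case (homogeneous k \<omega>)
  then show ?case by (simp add: sgn_on[of _ k] star_forms star_scale)
qed (simp add: sgn_add star_add)

lemma star_mult_one_form: "\<xi> \<in> forms C 1 \<Longrightarrow> star C (\<nu> * \<xi>) = star C \<xi> * star C (sgn_deg \<nu>)"
proof (induction \<nu> rule: deg.homogeneous_induct)
  case (homogeneous k \<nu>)
  then show ?case
    by (simp add: star_mult[of \<nu> k \<xi> 1] sgn_on star_scale mult_scaleC_right minus_one_power_mult mult_scaleC_left mult.assoc)
qed (simp add: distrib_right distrib_left star_add sgn_add)

lemma pairing_wedge_right:
  assumes "z \<in> forms_tensor E (forms C 1)"
  shows "pairing x (wedge_left E \<nu> z) = pairing x z * star C (sgn_deg \<nu>)"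
  using assms deg.subspace
proof (induction rule: forms_tensor_induct)
  case (tens \<xi> g)
  then show ?case
    by (simp add: wedge_tens pairing_tens_right_one[of _ "\<nu> * \<xi>"] pairing_tens_right_one[of _ \<xi>]
        star_mult_one_form mult.assoc)
qed (simp add: wedge_add pairing_add_right distrib_right)

text \<open>
  Integration by parts before integration.  On pure tensors the pairing is \<open>\<omega> h \<nu>\<^sup>*\<close>: the derivative
  of \<open>h\<close> is given by the two connections, and the star turns \<open>\<delta>\<close> into \<open>\<delta>'\<close>.  Both
  orders of the holomorphic structure and its conjugate are instances.
\<close>

lemma pairing_leibniz:
  assumes D: "connection_along \<delta> D" and D': "connection_along \<delta>' D'"
    and D'_forms: "\<And>g. D' g \<in> forms_tensor E (forms C 1)"
    and star: "\<And>\<nu>. \<delta> (star C \<nu>) = star C (\<delta>' \<nu>)"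
    and herm: "\<And>f g. \<delta> (herm E g f) = pairing (D f) (tens E 1 g) + pairing (tens E 1 f) (D' g)"
  shows "\<delta> (pairing x z) = pairing (leibniz_extension C E \<delta> D x) z +
    pairing (map_tens E sgn_deg x) (leibniz_extension C E \<delta>' D' z)"
proof -
  have \<delta>: "\<delta> (\<omega> + \<nu>) = \<delta> \<omega> + \<delta> \<nu>" "\<delta> (\<omega> * \<nu>) = \<delta> \<omega> * \<nu> + sgn_deg \<omega> * \<delta> \<nu>" for \<omega> \<nu>
    using D unfolding connection_along_def sgn_derivation_def by (blast intro: clinear_add)+
  note ext_add = additive.add[OF leibniz_extension_additive[OF D]]
    additive.add[OF leibniz_extension_additive[OF D']]
  show ?thesis
  proof (induction x rule: tens_induct)
    case (tens \<omega> f)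
    show ?case
    proof (induction z rule: tens_induct)
      case (tens \<nu> g)
      have 1: "\<delta> (pairing (tens E \<omega> f) (tens E \<nu> g)) =
          \<delta> \<omega> * herm E g f * star C \<nu> + sgn_deg \<omega> * \<delta> (herm E g f) * star C \<nu> +
          sgn_deg \<omega> * herm E g f * star C (\<delta>' \<nu>)"
        by (simp add: pairing_tens \<delta> sgn_mult sgn_base[OF herm_base] star algebra_simps)
      have 2: "pairing (leibniz_extension C E \<delta> D (tens E \<omega> f)) (tens E \<nu> g) =
          \<delta> \<omega> * herm E g f * star C \<nu> + sgn_deg \<omega> * pairing (D f) (tens E 1 g) * star C \<nu>"
        by (simp add: leibniz_extension_tens[OF D] pairing_add_left pairing_tens pairing_wedge_left
            pairing_tens_right_one[of "D f" \<nu>] mult.assoc)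
      have 3: "pairing (map_tens E sgn_deg (tens E \<omega> f)) (leibniz_extension C E \<delta>' D' (tens E \<nu> g)) =
          sgn_deg \<omega> * herm E g f * star C (\<delta>' \<nu>) + sgn_deg \<omega> * pairing (tens E 1 f) (D' g) * star C \<nu>"
        by (simp add: leibniz_extension_tens[OF D'] map_tens_tens right_module_map_sgn pairing_add_right
            pairing_tens pairing_wedge_right[OF D'_forms] sgn_sgn pairing_tens_left_one[of "sgn_deg \<omega>" f "D' g"])
      show ?case unfolding 1 2 3 by (simp add: herm algebra_simps)
    next
      case (add y z)
      then show ?case by (simp add: pairing_add_right \<delta>(1) ext_add algebra_simps)
    qed
  next
    case (add x y)
    then show ?case
      by (simp add: pairing_add_left \<delta>(1) ext_add map_tens_add[OF right_module_map_sgn] algebra_simps)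
  qed
qed

text \<open>
  Every element of the dual is \<open>herm E f\<close> for some \<open>f\<close>, so the pairings with all \<open>1 \<otimes> f\<close> are, up to
  the star, the contractions with all elements of the dual.
\<close>

lemma pairing_separates:
  assumes "\<And>f. pairing (tens E 1 f) z = 0"
  shows "z = 0"
proof (rule dual_separates)
  fix \<psi> assume "\<psi> \<in> dual_module C E"
  then obtain f where \<psi>: "\<psi> = herm E f" using herm_bij unfolding bij_betw_def by (metis imageE)
  have lift: "additive (lift_tens E (\<lambda>\<omega> g. \<omega> * herm E f g))"
    "lift_tens E (\<lambda>\<omega> g. \<omega> * herm E f g) (tens E \<omega> g) = \<omega> * herm E f g" for \<omega> g
    by (intro lift_tens;
        simp add: herm_add_right herm_lact_right distrib_left distrib_right mult.assoc)+
  have "lift_tens E (\<lambda>\<omega> g. \<omega> * herm E f g) z = star C (pairing (tens E 1 f) z)"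
  proof (induction z rule: tens_induct)
    case (tens \<nu> g)
    then show ?case
      by (simp add: lift pairing_tens star_mult_base_left[OF herm_base] star_star flip: herm_hermitian)
  qed (simp add: additive.add[OF lift(1)] pairing_add_right star_add)
  then show "lift_tens E (\<lambda>\<omega> f. \<omega> * \<psi> f) z = 0" by (simp add: \<psi> assms star_zero)
qed

lemma pairing_biforms:
  assumes "x \<in> forms_tensor E (biforms C (a, b))"
  shows "pairing x (tens E 1 g) \<in> biforms C (a, b)" and "pairing (tens E 1 g) x \<in> biforms C (b, a)"
proof -
  have "pairing x (tens E 1 g) \<in> biforms C (a, b) \<and> pairing (tens E 1 g) x \<in> biforms C (b, a)"
    using assms biforms_subspace
  proof (induction rule: forms_tensor_induct)
    case (tens \<xi> f)
    then show ?case
      using biforms_mult_base(2)[OF herm_base tens] biforms_mult_base(1)[OF herm_base star_biforms[OF tens]]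
      by (simp add: pairing_tens star_one)
  qed (simp add: pairing_add_left pairing_add_right csubspace_add[OF biforms_subspace])
  then show "pairing x (tens E 1 g) \<in> biforms C (a, b)" "pairing (tens E 1 g) x \<in> biforms C (b, a)" by auto
qed

lemma right_module_map_component: "right_module_map (component (biforms C) p)"
  by (simp add: right_module_map_def bideg.component_linear component_biforms_mult_base)

lemma forms_tensor_component: "map_tens E (component (biforms C) p) x \<in> forms_tensor E (biforms C p)"
proof (induction x rule: tens_induct)
  case (tens \<omega> f)
  then show ?case
    unfolding forms_tensor_def map_tens_tens[OF right_module_map_component]
    by (intro complex_vector.span_base) (blast intro: bideg.component_mem)
qed (simp add: map_tens_add[OF right_module_map_component] forms_tensor_def complex_vector.span_add)

lemma forms_tensor_mono: "V \<subseteq> W \<Longrightarrow> forms_tensor E V \<subseteq> forms_tensor E W"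
  unfolding forms_tensor_def by (rule complex_vector.span_mono) blast

lemma sgn_derivation_del: "sgn_derivation (del C)" and sgn_derivation_delbar: "sgn_derivation (delbar C)"
  by (simp_all add: sgn_derivation_def del_linear del_mult delbar_linear delbar_mult)

lemma connection_dbar: "connection_along (delbar C) (dbar E)"
  by (simp add: connection_along_def sgn_derivation_delbar clinear_additive dbar_linear dbar_leibniz)

context
  fixes nabla :: "'f \<Rightarrow> 't"
  assumes chern: "is_chern_connection C E nabla"
begin

definition del_nabla :: "'f \<Rightarrow> 't"
  where "del_nabla f = map_tens E (component (biforms C) (1, 0)) (nabla f)"

lemma del_nabla_forms: "del_nabla f \<in> forms_tensor E (biforms C (1, 0))"
  unfolding del_nabla_def by (rule forms_tensor_component)

lemma nabla_split: "nabla f = del_nabla f + dbar E f"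
proof -
  have "x = map_tens E (component (biforms C) (1, 0)) x + map_tens E (component (biforms C) (0, 1)) x"
    if "x \<in> forms_tensor E (forms C 1)" for x
    using that deg.subspace
  proof (induction rule: forms_tensor_induct)
    case (tens \<omega> f)
    have "\<omega> = component (biforms C) (1, 0) \<omega> + component (biforms C) (0, 1) \<omega>"
      using tens
    proof (induction rule: forms_biforms_induct)
      case (biforms a b \<omega>)
      then have "(a, b) = (1, 0) \<or> (a, b) = (0, 1)" by auto
      then show ?case using biforms by (auto simp: bideg.component_on)
    next
      case (add \<omega> \<nu>)
      then show ?case by (simp add: clinear_add[OF bideg.component_linear] algebra_simps)
    qed
    then show ?case
      by (simp add: map_tens_tens[OF right_module_map_component] flip: tens_add_left)
  next
    case (add x y)
    then show ?case by (simp add: map_tens_add[OF right_module_map_component] algebra_simps)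
  qed
  moreover have "nabla f \<in> forms_tensor E (forms C 1)"
    "map_tens E (component (biforms C) (0, 1)) (nabla f) = dbar E f"
    using chern by (auto simp: is_chern_connection_def bidegree_part_def)
  ultimately show ?thesis unfolding del_nabla_def by metis
qed

lemma connection_del_nabla: "connection_along (del C) del_nabla"
  unfolding connection_along_def
proof (intro conjI ballI allI)
  show "additive del_nabla"
    using chern unfolding is_chern_connection_def
    by (auto intro!: additive.intro simp: del_nabla_def clinear_add map_tens_add[OF right_module_map_component])
  fix m f assume m: "m \<in> base C"
  have "component (biforms C) (1, 0) (diff C m) = del C m"
    using del_biforms[OF base_biforms[OF m]] delbar_biforms[OF base_biforms[OF m]]
    by (simp add: diff_del_delbar clinear_add[OF bideg.component_linear] bideg.component_on)
  moreover have "component (biforms C) (1, 0) (m * \<omega>) = m * component (biforms C) (1, 0) \<omega>" for \<omega>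
  proof (induction \<omega> rule: bideg.homogeneous_induct)
    case (homogeneous q \<omega>)
    then show ?case using biforms_mult_base(1)[OF m homogeneous] by (simp add: bideg.component_on)
  qed (simp add: distrib_left clinear_add[OF bideg.component_linear])
  then have "map_tens E (component (biforms C) (1, 0)) (wedge_left E m x) =
      wedge_left E m (map_tens E (component (biforms C) (1, 0)) x)" for x
    by (induction x rule: tens_induct)
       (simp_all add: wedge_tens wedge_add map_tens_tens[OF right_module_map_component]
         map_tens_add[OF right_module_map_component])
  moreover have "nabla (lact E m f) = tens E (diff C m) f + wedge_left E m (nabla f)"
    using chern m unfolding is_chern_connection_def by blast
  ultimately show "del_nabla (lact E m f) = tens E (del C m) f + wedge_left E m (del_nabla f)"
    by (simp add: del_nabla_def map_tens_tens[OF right_module_map_component]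
        map_tens_add[OF right_module_map_component])
qed (rule sgn_derivation_del)

text \<open>
  Compatibility of the Chern connection with the metric, separated by bidegree.  The star in the second
  argument exchanges types, hence the pairing of each part with the other.
\<close>

lemma chern_metric:
  shows "del C (herm E g f) = pairing (del_nabla f) (tens E 1 g) + pairing (tens E 1 f) (dbar E g)"
    and "delbar C (herm E g f) = pairing (dbar E f) (tens E 1 g) + pairing (tens E 1 f) (del_nabla g)"
proof -
  have "diff C (pairing (tens E 1 f) (tens E 1 g)) = pairing (nabla f) (tens E 1 g) + pairing (tens E 1 f) (nabla g)"
    using chern unfolding is_chern_connection_def by blast
  then have eq: "del C (herm E g f) + delbar C (herm E g f) =
      (pairing (del_nabla f) (tens E 1 g) + pairing (tens E 1 f) (dbar E g)) +
      (pairing (dbar E f) (tens E 1 g) + pairing (tens E 1 f) (del_nabla g))"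
    by (simp add: pairing_tens star_one diff_del_delbar nabla_split pairing_add_left pairing_add_right algebra_simps)
  have h: "herm E g f \<in> biforms C (0, 0)" by (rule base_biforms[OF herm_base])
  have mem: "del C (herm E g f) \<in> biforms C (1, 0)" "delbar C (herm E g f) \<in> biforms C (0, 1)"
    using del_biforms[OF h] delbar_biforms[OF h] by simp_all
  note split = bideg_split[OF eq mem(1)
      csubspace_add[OF biforms_subspace pairing_biforms(1)[OF del_nabla_forms] pairing_biforms(2)[OF dbar_forms]]
      mem(2)
      csubspace_add[OF biforms_subspace pairing_biforms(1)[OF dbar_forms] pairing_biforms(2)[OF del_nabla_forms]]]
  show "del C (herm E g f) = pairing (del_nabla f) (tens E 1 g) + pairing (tens E 1 f) (dbar E g)"
    "delbar C (herm E g f) = pairing (dbar E f) (tens E 1 g) + pairing (tens E 1 f) (del_nabla g)"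
    by (rule split; simp)+
qed

lemma del_ext_eq: "del_ext C E nabla = leibniz_extension C E (del C) del_nabla"
  by (simp add: del_ext_def del_nabla_def[abs_def] bidegree_part_def)

lemma pairing_del_ext: "del C (pairing x z) =
    pairing (del_ext C E nabla x) z + pairing (map_tens E sgn_deg x) (delbar_ext C E z)"
  unfolding del_ext_eq delbar_ext_def
proof (rule pairing_leibniz[OF connection_del_nabla connection_dbar])
  show "dbar E g \<in> forms_tensor E (forms C 1)" for g
    using dbar_forms[of g] forms_tensor_mono[of "biforms C (0, 1)" "forms C 1"] biforms_forms[of _ 0 1] by auto
qed (simp_all add: star_delbar chern_metric)

lemma pairing_delbar_ext: "delbar C (pairing x z) =
    pairing (delbar_ext C E x) z + pairing (map_tens E sgn_deg x) (del_ext C E nabla z)"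
  unfolding del_ext_eq delbar_ext_def
proof (rule pairing_leibniz[OF connection_dbar connection_del_nabla])
  show "del_nabla g \<in> forms_tensor E (forms C 1)" for g
    using del_nabla_forms[of g] forms_tensor_mono[of "biforms C (1, 0)" "forms C 1"] biforms_forms[of _ 1 0] by auto
qed (simp_all add: star_del chern_metric)

end

end

section \<open>Adjoints and the identities on the bundle\<close>

lemma adjoint_eqI:
  fixes ip :: "'t::ab_group_add \<Rightarrow> 't \<Rightarrow> complex"
  assumes add: "\<And>x. additive (ip x)" and nondeg: "\<And>y. (\<And>x. ip x y = 0) \<Longrightarrow> y = 0"
    and S: "\<And>x y. ip (T x) y = ip x (S y)"
  shows "adjoint ip T = S"
  unfolding adjoint_def
proof (rule the_equality)
  show "S' = S" if S': "\<forall>x y. ip (T x) y = ip x (S' y)" for S'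
  proof
    fix y
    have "ip x (S' y - S y) = 0" for x
      using S[of x y] S' by (simp add: additive.diff[OF add])
    then have "S' y - S y = 0" by (rule nondeg)
    then show "S' y = S y" by simp
  qed
qed (use S in blast)

locale hermitian_kahler_bundle = kahler_structure H K + hermitian_holomorphic_bundle H K E
  for H :: "('a::complex_algebra_1, 'h) hopf_scheme"
    and K :: "('a, 'w::complex_algebra_1, 'z) kahler_scheme"
    and E :: "('a, 'w, 'f::complex_vector, 't::complex_vector, 's::complex_vector) bundle_data"
begin

abbreviation hodge_tens :: "'t \<Rightarrow> 't"
  where "hodge_tens \<equiv> map_tens E (hodge K)"

lemma right_module_map_hodge: "right_module_map (hodge K)"
  by (simp add: right_module_map_def hodge_linear hodge_mult_base)

lemma right_module_map_lefschetz: "right_module_map (lefschetz K)"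
  using right_module_map_mult[of "kform K"] by (simp add: lefschetz_def[abs_def])

lemma right_module_map_dual_lefschetz: "right_module_map (dual_lefschetz K)"
  by (simp add: right_module_map_def dual_lefschetz_linear dual_lefschetz_eq reflection_mult_base
      flip: mult.assoc)

lemmas hodge_tens_tens = map_tens_tens[OF right_module_map_hodge]
  and hodge_tens_add = map_tens_add[OF right_module_map_hodge]

lemma hodge_tens_hodge_tens: "hodge_tens (hodge_tens x) = map_tens E sgn_deg x"
  by (induction x rule: tens_induct)
     (simp_all add: hodge_tens_tens hodge_tens_add hodge_hodge map_tens_tens[OF right_module_map_sgn]
       map_tens_add[OF right_module_map_sgn])

text \<open>
  On pure tensors this is the compatibility of the Hodge map with the star.  It replaces the evaluation on
  the dual module by the pairing, for which there is a Leibniz rule.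
\<close>

lemma eval_wedge_hodge_bar: "eval_wedge K E x (hodge_bar K E y) = pairing x (hodge_tens y)"
proof -
  let ?ev = "\<lambda>\<omega> f. tensor_lift (dual_module K E) UNIV (dtens E) (\<lambda>\<psi> \<nu>. \<omega> * \<psi> f * \<nu>)"
  have dual: "\<psi> (f + g) = \<psi> f + \<psi> g" "m \<in> base K \<Longrightarrow> \<psi> (lact E m f) = m * \<psi> f"
    if "\<psi> \<in> dual_module K E" for \<psi> f g m
    using that by (auto simp: dual_module_def additive.add)
  have dtens_rel: "dtens E (\<lambda>f. \<psi> f * m) \<nu> = dtens E \<psi> (m * \<nu>)"
    "dtens E (\<psi> + \<psi>') \<nu> = dtens E \<psi> \<nu> + dtens E \<psi>' \<nu>"
    "dtens E \<psi> (\<nu> + \<nu>') = dtens E \<psi> \<nu> + dtens E \<psi> \<nu>'"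
    if "\<psi> \<in> dual_module K E" "\<psi>' \<in> dual_module K E" "m \<in> base K" for \<psi> \<psi>' m \<nu> \<nu>'
    using tensor_product_relations[OF dtens tensor_relations.balanced[of \<psi> "dual_module K E" m "base K" \<nu> UNIV]]
      tensor_product_relations[OF dtens tensor_relations.add_left[of \<psi> "dual_module K E" \<psi>' \<nu> UNIV]]
      tensor_product_relations[OF dtens tensor_relations.add_right[of \<psi> "dual_module K E" \<nu> UNIV \<nu>']] that
    by (simp_all add: frag_eval_diff diff_diff_eq frag_eval_add)
  have ev: "additive (?ev \<omega> f)"
    "\<psi> \<in> dual_module K E \<Longrightarrow> ?ev \<omega> f (dtens E \<psi> \<nu>) = \<omega> * \<psi> f * \<nu>" for \<omega> f \<psi> \<nu>
    by (rule tensor_lift_eq[OF dtens]; simp add: distrib_left distrib_right mult.assoc)+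
  have ev_rel: "?ev (\<omega> + \<omega>') f s = ?ev \<omega> f s + ?ev \<omega>' f s \<and> ?ev \<omega> (f + f') s = ?ev \<omega> f s + ?ev \<omega> f' s \<and>
      (m \<in> base K \<longrightarrow> ?ev (\<omega> * m) f s = ?ev \<omega> (lact E m f) s)" for \<omega> \<omega>' f f' m s
  proof (induction s rule: tensor_product_induct[OF dtens, consumes 0, case_names zero tensor diff])
    case zero
    show ?case by (simp only: additive.zero[OF ev(1)]) simp
  next
    case (tensor \<psi> \<nu>)
    show ?case unfolding ev(2)[OF tensor(1)]
      by (simp add: dual[OF tensor(1)] distrib_left distrib_right mult.assoc)
  next
    case (diff s s')
    then show ?case unfolding additive.diff[OF ev(1)] by auto
  qed
  have outer: "additive (\<lambda>x. eval_wedge K E x s)" "eval_wedge K E (tens E \<omega> f) s = ?ev \<omega> f s" for s \<omega> f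
    unfolding eval_wedge_def using ev_rel by (intro lift_tens; blast)+
  have hb: "additive (hodge_bar K E)"
    "hodge_bar K E (tens E \<nu> g) = dtens E (herm E g) (hodge K (star K \<nu>))" for \<nu> g
  proof -
    let ?B = "\<lambda>\<omega> f. dtens E (herm E f) (hodge K (star K \<omega>))"
    have "herm E (f + g) = herm E f + herm E g" "m \<in> base K \<Longrightarrow> herm E (lact E m g) = (\<lambda>f. herm E g f * star K m)"
      for f g m by (simp_all add: fun_eq_iff herm_add_left herm_lact_left)
    then have "?B (\<omega> + \<omega>') f = ?B \<omega> f + ?B \<omega>' f" "?B \<omega> (f + f') = ?B \<omega> f + ?B \<omega> f'"
      "m \<in> base K \<Longrightarrow> ?B (\<omega> * m) f = ?B \<omega> (lact E m f)" for \<omega> \<omega>' f f' m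
      using dtens_rel[OF herm_dual herm_dual one_base] dtens_rel(1)[OF herm_dual herm_dual star_forms]
      by (simp_all add: star_add hodge_add star_mult_base_right hodge_mult_base star_forms)
    from lift_tens[of ?B, OF this] show "additive (hodge_bar K E)"
      "hodge_bar K E (tens E \<nu> g) = dtens E (herm E g) (hodge K (star K \<nu>))"
      unfolding hodge_bar_def by blast+
  qed
  show ?thesis
  proof (induction x rule: tens_induct)
    case (tens \<omega> f)
    show ?case
    proof (induction y rule: tens_induct)
      case (tens \<nu> g)
      show ?case
        by (simp add: outer hb ev(2)[OF herm_dual] hodge_tens_tens pairing_tens hodge_star)
    next
      case (add y z)
      then show ?case
        by (simp add: outer(2) additive.add[OF hb(1)] additive.add[OF ev(1)] hodge_tens_add pairing_add_right)
    qed
  qed (simp add: additive.add[OF outer(1)] pairing_add_left)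
qed

lemma bundle_inner_eq: "bundle_inner K E \<phi> x y = \<phi> (vol K (pairing x (hodge_tens y)))"
  by (simp add: bundle_inner_def bundle_metric_def eval_wedge_hodge_bar)

lemma bundle_inner_additive: "is_state K \<phi> \<Longrightarrow> additive (bundle_inner K E \<phi> x)"
  by (rule additive.intro)
     (simp add: bundle_inner_eq hodge_tens_add pairing_add_right additive.add[OF state_vol_additive])

text \<open>
  The integral separates forms, and pairings separate elements of the tensor product.
\<close>

lemma bundle_inner_nondegenerate:
  assumes "positive_definite K" "is_state K \<phi>" "\<And>x. bundle_inner K E \<phi> x y = 0"
  shows "y = 0"
proof -
  have "pairing (tens E 1 f) (hodge_tens y) = 0" for f
  proof (rule integral_nondegenerate[OF assms(1,2)])
    show "\<phi> (vol K (\<omega> * pairing (tens E 1 f) (hodge_tens y))) = 0" for \<omega>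
      using assms(3)[of "tens E \<omega> f"] by (simp add: bundle_inner_eq pairing_tens_left_one[of \<omega>])
  qed
  then have "hodge_tens y = 0" by (rule pairing_separates)
  then have "map_tens E sgn_deg y = 0"
    using hodge_tens_hodge_tens[of y] additive.zero[OF map_tens_additive[OF right_module_map_hodge]] by simp
  then show ?thesis
    using map_tens_sgn_sgn[of y] additive.zero[OF map_tens_additive[OF right_module_map_sgn]] by simp
qed

lemma vol_sgn: "vol K (sgn_deg \<omega>) = vol K \<omega>"
proof (induction \<omega> rule: deg.homogeneous_induct)
  case (homogeneous k \<omega>)
  then show ?case
    by (cases "k = 2 * half_dim K") (auto simp: sgn_on scaleC_one vol_scale vol_lower)
qed (simp add: sgn_add vol_add)

text \<open>
  Only total degree \<open>2n\<close> contributes to the volume, and there the two degrees have the same parity.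
\<close>

lemma vol_pairing_sgn: "vol K (pairing (map_tens E sgn_deg x) y) = vol K (pairing x (map_tens E sgn_deg y))"
proof (induction x rule: tens_induct)
  case (tens \<omega> f)
  show ?case
  proof (induction y rule: tens_induct)
    case (tens \<nu> g)
    have "vol K (sgn_deg \<omega> * herm E g f * star K \<nu>) = vol K (sgn_deg (sgn_deg \<omega> * herm E g f * star K \<nu>))"
      by (simp only: vol_sgn)
    then show ?case
      by (simp add: map_tens_tens[OF right_module_map_sgn] pairing_tens sgn_mult sgn_sgn sgn_base[OF herm_base] star_sgn)
  qed (simp add: pairing_add_right map_tens_add[OF right_module_map_sgn] vol_add)
qed (simp add: pairing_add_left map_tens_add[OF right_module_map_sgn] vol_add)

text \<open>
  Integration by parts.  The square of the Hodge map is the sign of the degree, which absorbs the sign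
  from the Leibniz rule.
\<close>

lemma adjoint_from_pairing:
  assumes "positive_definite K" and \<phi>: "is_state K \<phi>"
    and \<delta>: "\<And>\<omega>. \<phi> (vol K (\<delta> \<omega>)) = 0"
    and DT: "\<And>x z. \<delta> (pairing x z) = pairing (DT x) z + pairing (map_tens E sgn_deg x) (DT' z)"
  shows "adjoint (bundle_inner K E \<phi>) DT = (\<lambda>y. - hodge_tens (DT' (hodge_tens y)))"
proof (rule adjoint_eqI)
  interpret I: additive "\<lambda>\<omega>. \<phi> (vol K \<omega>)" by (rule state_vol_additive[OF \<phi>])
  fix x y
  define z where "z = DT' (hodge_tens y)"
  have minus: "additive (pairing x)" by (simp add: additive_def pairing_add_right)
  have "0 = \<phi> (vol K (pairing (DT x) (hodge_tens y) + pairing (map_tens E sgn_deg x) z))"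
    using \<delta>[of "pairing x (hodge_tens y)"] by (simp add: DT z_def)
  then have "\<phi> (vol K (pairing (DT x) (hodge_tens y))) = - \<phi> (vol K (pairing (map_tens E sgn_deg x) z))"
    by (simp add: I.add eq_neg_iff_add_eq_0)
  also have "\<dots> = - \<phi> (vol K (pairing x (hodge_tens (hodge_tens z))))"
    by (simp add: vol_pairing_sgn hodge_tens_hodge_tens)
  also have "\<dots> = \<phi> (vol K (pairing x (hodge_tens (- hodge_tens z))))"
    by (simp add: I.minus additive.minus[OF minus] additive.minus[OF map_tens_additive[OF right_module_map_hodge]])
  finally show "bundle_inner K E \<phi> (DT x) y = bundle_inner K E \<phi> x (- hodge_tens (DT' (hodge_tens y)))"
    by (simp add: bundle_inner_eq z_def)
qed (use assms bundle_inner_additive bundle_inner_nondegenerate in blast)+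

text \<open>
  On \<open>\<omega> \<otimes> f\<close> the operator acts through finitely many operators on forms that depend on \<open>f\<close> but not on
  \<open>\<omega>\<close>.  All other operators act on the first leg, so the identities hold summand by summand.
\<close>

lemma kahler_identity_tens:
  assumes DT: "additive DT"
    and loc: "\<And>f. \<exists>xs. (\<forall>p\<in>set xs. kahler_operator c (fst p)) \<and>
      (\<forall>\<omega>. DT (tens E \<omega> f) = sum_list (map (\<lambda>p. tens E (fst p \<omega>) (snd p)) xs))"
  shows "hodge_tens (DT (hodge_tens x)) = c *\<^sub>C (Lambda_bundle K E (DT x) - DT (Lambda_bundle K E x))"
    and "L_bundle K E (hodge_tens (DT (hodge_tens x))) - hodge_tens (DT (hodge_tens (L_bundle K E x))) = c *\<^sub>C DT x"
proof -
  note maps = right_module_map_hodge right_module_map_lefschetz right_module_map_dual_lefschetz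
  note mt = maps[THEN map_tens_tens] and ma = maps[THEN map_tens_additive]
  note msum = ma[THEN additive_sum_list]
  have "hodge_tens (DT (hodge_tens x)) = c *\<^sub>C (Lambda_bundle K E (DT x) - DT (Lambda_bundle K E x)) \<and>
    L_bundle K E (hodge_tens (DT (hodge_tens x))) - hodge_tens (DT (hodge_tens (L_bundle K E x))) = c *\<^sub>C DT x"
  proof (induction x rule: tens_induct)
    case (tens \<omega> f)
    obtain xs where xs: "\<And>p. p \<in> set xs \<Longrightarrow> kahler_operator c (fst p)"
      and DTf: "\<And>\<omega>. DT (tens E \<omega> f) = sum_list (map (\<lambda>p. tens E (fst p \<omega>) (snd p)) xs)"
      using loc[of f] by blast
    have scale: "additive ((*\<^sub>C) c :: 't \<Rightarrow> 't)" by (simp add: additive_def scaleC_add_right)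
    have 1: "c *\<^sub>C (Lambda_bundle K E (DT (tens E \<omega> f)) - DT (Lambda_bundle K E (tens E \<omega> f))) =
        sum_list (map (\<lambda>p. tens E (c *\<^sub>C (dual_lefschetz K (fst p \<omega>) - fst p (dual_lefschetz K \<omega>))) (snd p)) xs)"
      by (simp add: Lambda_bundle_def mt DTf msum o_def sum_list_subtractf[symmetric] additive_sum_list[OF scale]
          tens_scale tens_diff)
    have 2: "L_bundle K E (hodge_tens (DT (hodge_tens (tens E \<omega> f)))) -
          hodge_tens (DT (hodge_tens (L_bundle K E (tens E \<omega> f)))) =
        sum_list (map (\<lambda>p. tens E (lefschetz K (hodge K (fst p (hodge K \<omega>))) -
          hodge K (fst p (hodge K (lefschetz K \<omega>)))) (snd p)) xs)"
      by (simp add: L_bundle_def mt DTf msum o_def sum_list_subtractf[symmetric] tens_diff)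
    have 3: "c *\<^sub>C DT (tens E \<omega> f) = sum_list (map (\<lambda>p. tens E (c *\<^sub>C fst p \<omega>) (snd p)) xs)"
      by (simp add: DTf additive_sum_list[OF scale] o_def tens_scale)
    have 4: "hodge_tens (DT (hodge_tens (tens E \<omega> f))) =
        sum_list (map (\<lambda>p. tens E (hodge K (fst p (hodge K \<omega>))) (snd p)) xs)"
      by (simp add: mt DTf msum o_def)
    show ?case unfolding 1 2 unfolding 3 4
      using kahler_identity[OF xs] by (simp add: lefschetz_def cong: map_cong)
  next
    case (add x y)
    have "L_bundle K E (x + y) = L_bundle K E x + L_bundle K E y"
      "Lambda_bundle K E (x + y) = Lambda_bundle K E x + Lambda_bundle K E y" for x y
      by (simp_all add: L_bundle_def Lambda_bundle_def ma additive.add)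
    then show ?case using add
      by (simp add: additive.add[OF DT] hodge_tens_add scaleC_add_right complex_vector.scale_right_diff_distrib algebra_simps)
  qed
  then show "hodge_tens (DT (hodge_tens x)) = c *\<^sub>C (Lambda_bundle K E (DT x) - DT (Lambda_bundle K E x))"
    and "L_bundle K E (hodge_tens (DT (hodge_tens x))) - hodge_tens (DT (hodge_tens (L_bundle K E x))) = c *\<^sub>C DT x"
    by auto
qed

text \<open>
  Writing \<open>D f\<close> as a sum of \<open>\<xi> \<otimes> g\<close> turns \<open>\<delta> \<omega> \<otimes> f + (-1)\<^bsup>|\<omega>|\<^esup> \<omega> \<and> D f\<close> into such a sum.
\<close>

lemma kahler_operators_of_connection:
  assumes "connection_along \<delta> D" "\<And>f. D f \<in> forms_tensor E (biforms K (r, s))" "r + s = 1"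
    and "kahler_operator (\<i> powi (int r - int s)) \<delta>"
  shows "\<exists>xs. (\<forall>p\<in>set xs. kahler_operator (\<i> powi (int r - int s)) (fst p)) \<and>
    (\<forall>\<omega>. leibniz_extension K E \<delta> D (tens E \<omega> f) = sum_list (map (\<lambda>p. tens E (fst p \<omega>) (snd p)) xs))"
proof -
  obtain ys where ys: "D f = sum_list (map (\<lambda>p. tens E (fst p) (snd p)) ys)"
    "\<And>p. p \<in> set ys \<Longrightarrow> fst p \<in> biforms K (r, s)"
    using forms_tensor_sum_list[OF assms(2) biforms_subspace] by metis
  let ?xs = "(\<delta>, f) # map (\<lambda>p. (\<lambda>\<omega>. sgn_deg \<omega> * fst p, snd p)) ys"
  have "leibniz_extension K E \<delta> D (tens E \<omega> f) = sum_list (map (\<lambda>p. tens E (fst p \<omega>) (snd p)) ?xs)" for \<omega>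
    by (simp add: leibniz_extension_tens[OF assms(1)] ys(1) wedge_tens o_def
        additive_sum_list[OF map_tens_additive[OF right_module_map_mult]])
  moreover have "\<forall>p\<in>set ?xs. kahler_operator (\<i> powi (int r - int s)) (fst p)"
    using assms(4) kahler_operator_mult[OF ys(2) assms(3)] by auto
  ultimately show ?thesis by blast
qed

lemma nakano_identities:
  assumes pos: "positive_definite K" and \<phi>: "is_state K \<phi>" and closed: "closed_integral K \<phi>"
    and chern: "is_chern_connection K E nabla"
  shows "commutator (L_bundle K E) (adjoint (bundle_inner K E \<phi>) (del_ext K E nabla))
           = (\<lambda>x. \<i> *\<^sub>C delbar_ext K E x)"
    and "commutator (L_bundle K E) (adjoint (bundle_inner K E \<phi>) (delbar_ext K E))
           = (\<lambda>x. - \<i> *\<^sub>C del_ext K E nabla x)"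
    and "commutator (Lambda_bundle K E) (del_ext K E nabla)
           = (\<lambda>x. \<i> *\<^sub>C adjoint (bundle_inner K E \<phi>) (delbar_ext K E) x)"
    and "commutator (Lambda_bundle K E) (delbar_ext K E)
           = (\<lambda>x. - \<i> *\<^sub>C adjoint (bundle_inner K E \<phi>) (del_ext K E nabla) x)"
proof -
  have adj_del: "adjoint (bundle_inner K E \<phi>) (del_ext K E nabla) =
      (\<lambda>y. - hodge_tens (delbar_ext K E (hodge_tens y)))"
    by (rule adjoint_from_pairing[OF pos \<phi> _ pairing_del_ext[OF chern]]) (rule integral_partial[OF \<phi> closed])
  have adj_delbar: "adjoint (bundle_inner K E \<phi>) (delbar_ext K E) =
      (\<lambda>y. - hodge_tens (del_ext K E nabla (hodge_tens y)))"
    by (rule adjoint_from_pairing[OF pos \<phi> _ pairing_delbar_ext[OF chern]]) (rule integral_partial[OF \<phi> closed])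
  have del: "additive (del_ext K E nabla)"
    unfolding del_ext_eq[OF chern] by (rule leibniz_extension_additive[OF connection_del_nabla[OF chern]])
  have delbar: "additive (delbar_ext K E)"
    unfolding delbar_ext_def by (rule leibniz_extension_additive[OF connection_dbar])
  note I_del = kahler_identity_tens[where c = \<i>, OF del]
    and I_delbar = kahler_identity_tens[where c = "- \<i>", OF delbar]
  have ops_del: "\<exists>xs. (\<forall>p\<in>set xs. kahler_operator \<i> (fst p)) \<and>
      (\<forall>\<omega>. del_ext K E nabla (tens E \<omega> f) = sum_list (map (\<lambda>p. tens E (fst p \<omega>) (snd p)) xs))" for f
    using kahler_operators_of_connection[OF connection_del_nabla[OF chern] del_nabla_forms[OF chern]]
      kahler_operator_del by (simp add: del_ext_eq[OF chern])
  have ops_delbar: "\<exists>xs. (\<forall>p\<in>set xs. kahler_operator (- \<i>) (fst p)) \<and>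
      (\<forall>\<omega>. delbar_ext K E (tens E \<omega> f) = sum_list (map (\<lambda>p. tens E (fst p \<omega>) (snd p)) xs))" for f
    using kahler_operators_of_connection[OF connection_dbar dbar_forms]
      kahler_operator_delbar by (simp add: delbar_ext_def)
  have L_minus: "L_bundle K E (- x) = - L_bundle K E x" for x
    unfolding L_bundle_def by (rule additive.minus[OF map_tens_additive[OF right_module_map_lefschetz]])
  have minus_diff: "- a - - b = - (a - b)" for a b :: 't by simp
  show "commutator (L_bundle K E) (adjoint (bundle_inner K E \<phi>) (del_ext K E nabla))
      = (\<lambda>x. \<i> *\<^sub>C delbar_ext K E x)"
    unfolding commutator_def adj_del L_minus minus_diff I_delbar(2)[OF ops_delbar] by (simp add: scaleC_minus_left)
  show "commutator (L_bundle K E) (adjoint (bundle_inner K E \<phi>) (delbar_ext K E))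
      = (\<lambda>x. - \<i> *\<^sub>C del_ext K E nabla x)"
    unfolding commutator_def adj_delbar L_minus minus_diff I_del(2)[OF ops_del] by (simp add: scaleC_minus_left)
  show "commutator (Lambda_bundle K E) (del_ext K E nabla)
      = (\<lambda>x. \<i> *\<^sub>C adjoint (bundle_inner K E \<phi>) (delbar_ext K E) x)"
    unfolding commutator_def adj_delbar I_del(1)[OF ops_del]
    by (simp add: scaleC_scaleC scaleC_one scaleC_minus_left flip: complex_vector.scale_minus_right)
  show "commutator (Lambda_bundle K E) (delbar_ext K E)
      = (\<lambda>x. - \<i> *\<^sub>C adjoint (bundle_inner K E \<phi>) (del_ext K E nabla) x)"
    unfolding commutator_def adj_del I_delbar(1)[OF ops_delbar]
    by (simp add: scaleC_scaleC scaleC_one scaleC_minus_left)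
qed

end

theorem theorem1p1:
  fixes H :: "'a::complex_algebra_1 hopf"
    and K :: "('a, 'w::complex_algebra_1) kahler"
    and \<phi> :: "'w \<Rightarrow> complex"
    and E :: "('a, 'w, 'f::complex_vector, 't::complex_vector, 's::complex_vector) bundle_data"
    and nabla :: "'f \<Rightarrow> 't"
  assumes "kahler_structure H K" and "positive_definite K"
    and "is_state K \<phi>" and "closed_integral K \<phi>"
    and "hermitian_holomorphic_bundle H K E"
    and "is_chern_connection K E nabla"
  shows "commutator (L_bundle K E) (adjoint (bundle_inner K E \<phi>) (del_ext K E nabla))
           = (\<lambda>x. \<i> *\<^sub>C delbar_ext K E x) \<and>
         commutator (L_bundle K E) (adjoint (bundle_inner K E \<phi>) (delbar_ext K E))
           = (\<lambda>x. - \<i> *\<^sub>C del_ext K E nabla x) \<and>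
         commutator (Lambda_bundle K E) (del_ext K E nabla)
           = (\<lambda>x. \<i> *\<^sub>C adjoint (bundle_inner K E \<phi>) (delbar_ext K E) x) \<and>
         commutator (Lambda_bundle K E) (delbar_ext K E)
           = (\<lambda>x. - \<i> *\<^sub>C adjoint (bundle_inner K E \<phi>) (del_ext K E nabla) x)"
proof -
  interpret hermitian_kahler_bundle H K E
    using assms(1,5) by (rule hermitian_kahler_bundle.intro)
  show ?thesis using nakano_identities[OF assms(2-4,6)] by blast
qed

end
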